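(* Let $\lambda>0$ and let $\alpha$ be a complex number such that $-1<\operatorname{Re}\alpha<5/2$. Then, for complex $z$ off the ray $[0,\infty)$, $$\frac{\pi}{\sin\pi\alpha}\left[z^{\alpha/2}J_{-\alpha}(\lambda\sqrt z)-(-z)^\alpha z^{-\alpha/2}J_\alpha(\lambda\sqrt z)\right]=\int_0^\infty\frac{t^{\alpha/2}J_\alpha(\lambda\sqrt t)\,dt}{t-z},$$ where $J_\alpha$ is the Bessel function and $z^\alpha$ is the single branch in the $z$-plane cut along the ray $(-\infty,0]$ such that $\arg z\in[-\pi,\pi]$.
   Context: $J_\alpha$ is the Bessel function of the first kind of order $\alpha$. All powers, including $\sqrt z=z^{1/2}$ and $(-z)^\alpha$, are taken with the branch described in the claim.
   Formalization: For 3/2 ≤ Re α < 5/2 the integral diverges as an improper integral (e.g. α=2, λ=1, z=−1) and is taken as the limit of averages of its partial integrals (Cesàro); for Re α < 3/2 it is the ordinary improper integral. At α = 0, 1, 2 the left side (0/0) is its limit in α. *)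

theory Defs
  imports "HOL-Analysis.Analysis"
begin

text \<open>
  The power series of the Bessel function of the first kind; using the entire function
  \<^term>\<open>rGamma\<close> for the reciprocal Gamma function makes the orders $-1, -2, \ldots$ regular.
  The power is the principal one, and the value at 0 is separate because
  \<^prop>\<open>0 powr 0 = (0::complex)\<close> whereas $J_0(0) = 1$.
\<close>

definition bessel_J :: "complex \<Rightarrow> complex \<Rightarrow> complex" where
  "bessel_J \<nu> w =
     (if w = 0 then (if \<nu> = 0 then 1 else 0)
      else (w / 2) powr \<nu> *
           (\<Sum>k. (-1) ^ k * rGamma (of_nat k + \<nu> + 1) / fact k * (w / 2) ^ (2 * k)))"

text \<open>
  The power $z^a$ belonging to a choice \<open>\<theta>\<close> of the argument of \<open>z\<close>. On the cut $(-\infty,0]$ both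
  boundary arguments $\pi$ and $-\pi$ are admitted, whereas \<^term>\<open>(powr)\<close> always takes $\pi$;
  for all other nonzero \<open>z\<close> the only choice in $[-\pi,\pi]$ is \<^term>\<open>Arg z\<close>.
\<close>

definition is_branch_arg :: "complex \<Rightarrow> real \<Rightarrow> bool" where
  "is_branch_arg z \<theta> \<longleftrightarrow> -pi \<le> \<theta> \<and> \<theta> \<le> pi \<and> z = of_real (cmod z) * cis \<theta>"

definition branch_powr :: "real \<Rightarrow> complex \<Rightarrow> complex \<Rightarrow> complex" where
  "branch_powr \<theta> z a = exp (a * (of_real (ln (cmod z)) + \<i> * of_real \<theta>))"

lemma branch_powr_Arg: "z \<noteq> 0 \<Longrightarrow> branch_powr (Arg z) z a = z powr a"
  by (simp add: branch_powr_def powr_def Ln_Arg)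

lemma is_branch_arg_unique:
  assumes "is_branch_arg z \<theta>" "z \<notin> \<real>\<^sub>\<le>\<^sub>0"
  shows "\<theta> = Arg z"
proof -
  have "\<theta> \<noteq> -pi"
  proof
    assume "\<theta> = -pi"
    then have "z = of_real (- cmod z)"
      using assms(1) by (simp add: is_branch_arg_def cis.ctr complex_eq_iff)
    then show False
      using assms(2) by (metis neg_le_0_iff_le norm_ge_zero nonpos_Reals_of_real_iff)
  qed
  moreover have "z \<noteq> 0" using assms(2) by auto
  then have "sgn z = cis \<theta>"
    using assms(1) unfolding is_branch_arg_def sgn_eq
    by (metis nonzero_mult_div_cancel_left norm_eq_zero of_real_eq_0_iff)
  ultimately show ?thesis
    using assms(1) by (intro cis_Arg_unique[symmetric]) (auto simp: is_branch_arg_def)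
qed

text \<open>
  Since \<open>z\<close> is off $[0,\infty)$, the point \<open>-z\<close> is off the cut, so its power is the principal one.
\<close>

definition bessel_side :: "real \<Rightarrow> real \<Rightarrow> complex \<Rightarrow> complex \<Rightarrow> complex" where
  "bessel_side lam \<theta> z \<alpha> =
     of_real pi / sin (of_real pi * \<alpha>) *
       (branch_powr \<theta> z (\<alpha> / 2) * bessel_J (- \<alpha>) (of_real lam * branch_powr \<theta> z (1 / 2))
        - (- z) powr \<alpha> * branch_powr \<theta> z (- \<alpha> / 2)
            * bessel_J \<alpha> (of_real lam * branch_powr \<theta> z (1 / 2)))"

definition bessel_integrand :: "real \<Rightarrow> complex \<Rightarrow> complex \<Rightarrow> real \<Rightarrow> complex" where
  "bessel_integrand lam z \<alpha> t =
     of_real t powr (\<alpha> / 2) * bessel_J \<alpha> (of_real (lam * sqrt t)) / (of_real t - z)"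

text \<open>
  An expression \<open>F\<close> in \<open>\<alpha>\<close> with denominator $\sin\pi\alpha$ has the form $0/0$ at the integers; its
  value \<open>v\<close> there is the limit.
\<close>

definition has_value_at :: "(complex \<Rightarrow> complex) \<Rightarrow> complex \<Rightarrow> complex \<Rightarrow> bool" where
  "has_value_at F \<alpha> v \<longleftrightarrow> (if \<alpha> \<in> \<int> then (F \<longlongrightarrow> v) (at \<alpha>) else v = F \<alpha>)"

text \<open>
  The integral $\int_0^\infty f(t)\,dt$ in the sense of Cesaro means of order one. The integrand above
  behaves at infinity like $t^{\alpha/2-5/4}$ times a cosine of $\lambda\sqrt t$ shifted by a
  constant. Hence its partial integrals converge only for $\mathrm{Re}\,\alpha < 3/2$, while their
  averages converge exactly for $\mathrm{Re}\,\alpha < 5/2$.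
\<close>

definition has_cesaro_integral :: "(real \<Rightarrow> complex) \<Rightarrow> complex \<Rightarrow> bool" where
  "has_cesaro_integral f v \<longleftrightarrow>
     (\<forall>T>0. f absolutely_integrable_on {0..T}) \<and>
     ((\<lambda>T. (1 / T) *\<^sub>R integral {0..T} (\<lambda>s. integral {0..s} f)) \<longlongrightarrow> v) at_top"

text \<open>The Cesaro integral extends the ordinary improper integral.\<close>

lemma improper_imp_cesaro_integral:
  assumes int: "\<And>T. T > 0 \<Longrightarrow> f absolutely_integrable_on {0..T}"
    and f: "(f has_integral v) {0..}"
  shows "has_cesaro_integral f v"
proof -
  define F where "F = (\<lambda>s. integral {0..s} f)"
  have F_cont: "continuous_on {0..T} F" if "T > 0" for T
    unfolding F_def using int[OF that]
    by (intro indefinite_integral_continuous_1 set_lebesgue_integral_eq_integral(1))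
  have F_lim: "(F \<longlongrightarrow> v) at_top"
  proof (rule tendstoI)
    fix e :: real assume "e > 0"
    then obtain B where B: "B > 0" "\<And>a b. ball 0 B \<subseteq> cbox a b \<Longrightarrow>
        norm (integral (cbox a b) (\<lambda>x. if x \<in> {0..} then f x else 0) - v) < e"
      using f unfolding has_integral_alt' by meson
    have "dist (F T) v < e" if "T \<ge> B" for T
    proof -
      have "ball 0 B \<subseteq> cbox (-B) T" using that by (auto simp: dist_real_def)
      from B(2)[OF this] have "norm (integral {-B..T} (\<lambda>x. if x \<in> {0..} then f x else 0) - v) < e"
        by simp
      moreover have "integral {-B..T} (\<lambda>x. if x \<in> {0..} then f x else 0) = F T"
      proof -
        have "{-B..T} \<inter> {0..} = {0..T}" using B(1) by auto
        then show ?thesis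
          unfolding F_def by (metis (no_types) Int_commute integral_restrict_Int)
      qed
      ultimately show ?thesis by (simp add: dist_norm)
    qed
    then show "\<forall>\<^sub>F T in at_top. dist (F T) v < e"
      by (auto simp: eventually_at_top_linorder)
  qed
  have "((\<lambda>T. (1 / T) *\<^sub>R integral {0..T} F) \<longlongrightarrow> v) at_top"
  proof (rule tendstoI)
    fix e :: real assume e: "e > 0"
    obtain B0 where B0: "\<And>s. s \<ge> B0 \<Longrightarrow> dist (F s) v < e / 2"
      using tendstoD[OF F_lim, of "e / 2"] e by (auto simp: eventually_at_top_linorder)
    define B where "B = max B0 1"
    have B: "B > 0" "\<And>s. s \<ge> B \<Longrightarrow> norm (F s - v) \<le> e / 2"
      using B0 by (auto simp: B_def dist_norm less_imp_le)
    define K where "K = norm (integral {0..B} (\<lambda>s. F s - v))"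
    have "dist ((1 / T) *\<^sub>R integral {0..T} F) v < e" if T: "T > B" "T > 2 * K / e" for T
    proof -
      have T0: "T > 0" using T B by linarith
      have ci: "(\<lambda>s. F s - v) integrable_on {0..T}"
        by (intro integrable_continuous_interval continuous_intros F_cont T0)
      have Fi: "F integrable_on {0..T}"
        by (intro integrable_continuous_interval F_cont T0)
      have "integral {0..T} (\<lambda>s. F s - v) = integral {0..T} F - T *\<^sub>R v"
        using T0 Fi by (subst integral_diff) auto
      then have eq: "(1 / T) *\<^sub>R integral {0..T} F - v = (1 / T) *\<^sub>R integral {0..T} (\<lambda>s. F s - v)"
        using T0 by (simp add: scaleR_diff_right)
      have "integral {0..T} (\<lambda>s. F s - v) =
            integral {0..B} (\<lambda>s. F s - v) + integral {B..T} (\<lambda>s. F s - v)"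
        using T B by (intro Henstock_Kurzweil_Integration.integral_combine[symmetric, OF _ _ ci]) auto
      moreover have "norm (integral {B..T} (\<lambda>s. F s - v)) \<le> (e / 2) * (T - B)"
      proof (rule integral_bound)
        show "continuous_on {B..T} (\<lambda>s. F s - v)"
          using F_cont[OF T0] B by (intro continuous_intros) (auto intro: continuous_on_subset)
      qed (use B T in auto)
      ultimately have "norm (integral {0..T} (\<lambda>s. F s - v)) \<le> K + (e / 2) * (T - B)"
        unfolding K_def by (metis add_left_mono norm_triangle_le)
      also have "\<dots> < e * T"
      proof -
        have "K < (e / 2) * T" using T(2) e by (simp add: field_simps)
        moreover have "(e / 2) * (T - B) \<le> (e / 2) * T" using B e by simp
        ultimately show ?thesis by (simp add: field_simps)
      qed
      finally have "norm (integral {0..T} (\<lambda>s. F s - v)) < e * T" .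
      then show ?thesis
        unfolding dist_norm eq using T0 by (simp add: field_simps)
    qed
    then show "\<forall>\<^sub>F T in at_top. dist ((1 / T) *\<^sub>R integral {0..T} F) v < e"
      by (intro eventually_mono[OF eventually_gt_at_top[of "max B (2 * K / e)"]]) auto
  qed
  then show ?thesis using int unfolding has_cesaro_integral_def F_def by blast
qed

end

(*
  Put c = lam^2/4, P_nu(t) = t^nu E_nu(c t) with E_nu entire, so that t^(alpha/2) J_alpha(lam sqrt t)
  is a multiple of P_alpha(t) and P_(nu+1)' = P_nu. Two integrations by parts turn the integral of
  P_alpha(t)/(t-z) into that of 2 P_(alpha+2)(t)/(t-z)^3, which converges absolutely for
  -1 < Re alpha < 5/2 because P_nu(t) = O(t^(Re nu/2 - 1/4)); the boundary terms vanish at infinity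
  for Re alpha < 3/2, and their averages vanish for Re alpha < 5/2. The regularised integral is
  holomorphic in alpha and in z, so by two applications of the identity theorem it suffices to take
  0 < alpha < 1 and z = -x < 0. There the Laplace transform of P_(alpha+2) rewrites it as
  F(x) = int_0^infinity s^(-alpha-1) exp(-s x - c/s) ds. F and the two functions on the left-hand side
  solve the same second order equation on x > 0, and the Wronskians of F with these two solutions are
  found from their limits at 0.
*)

theory Submission
  imports Defs "HOL-Complex_Analysis.Complex_Analysis"
begin

subsection \<open>Integrals over the half-line\<close>

text \<open>The integrand is bounded at infinity by a multiple of t^(Re \<alpha>/2 - 5/4), which is
  integrable there only for Re \<alpha> < 1/2. Each integration by parts gains a factor 1/t from the
  kernel and loses t^(1/2) by raising the order, so k of them give absolute convergence for Re
  \<alpha> < k + 1/2; the strip asks for k = 2. Holomorphy and Fubini are applied to that form only.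
  Holomorphy in the order needs a growth bound uniform over a disc of orders; it comes from an
  energy estimate for the Bessel equation instead of an asymptotic expansion. The identity is proved
  after multiplication by sin(pi \<alpha>)/pi. In that form both sides are holomorphic across the
  integers, and the value at an integer order is obtained by continuity. The interval 0 < \<alpha> <
  1 is where F(x) and x^(1-\<alpha>) F'(x) both have finite limits at x = 0. These are multiples of
  Gamma values and serve as initial data for the Wronskians.\<close>

definition halfline :: "real measure" where
  "halfline = restrict_space lborel {0<..}"

lemma sets_halfline [measurable_cong]: "sets halfline = sets (restrict_space borel {0<..})"
  by (simp add: halfline_def sets_restrict_space)

lemma space_halfline [simp]: "space halfline = {0<..}"
  by (simp add: halfline_def space_restrict_space)

lemma sigma_finite_halfline: "sigma_finite_measure halfline"
  unfolding halfline_def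
  by (intro sigma_finite_measure_restrict_space) (auto intro: sigma_finite_lborel)

text \<open>Restricting the measure to the open half-line makes continuity off 0 sufficient, so
  kernels that are singular at 0, such as \<open>s powr b\<close> or \<open>exp (- (c / s))\<close>,
  need no separate treatment there.\<close>

lemma measurable_halfline:
  fixes f :: "real \<Rightarrow> 'a::topological_space"
  assumes "continuous_on {0<..} f"
  shows "f \<in> borel_measurable halfline"
  using borel_measurable_continuous_on_restrict[OF assms]
  by (simp add: measurable_def sets_halfline space_restrict_space)

lemma integrable_halfline_iff:
  fixes f :: "real \<Rightarrow> 'a::{banach,second_countable_topology}"
  shows "integrable halfline f \<longleftrightarrow> set_integrable lborel {0<..} f"
  by (simp add: halfline_def set_integrable_def integrable_restrict_space)

lemma integral_halfline_eq:
  fixes f :: "real \<Rightarrow> 'a::{banach,second_countable_topology}"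
  shows "integral\<^sup>L halfline f = set_lebesgue_integral lborel {0<..} f"
  by (simp add: halfline_def set_lebesgue_integral_def integral_restrict_space)

lemma borel_measurable_halfline_iff:
  fixes f :: "real \<Rightarrow> 'a::{banach,second_countable_topology}"
  shows "f \<in> borel_measurable halfline \<longleftrightarrow> set_borel_measurable lborel {0<..} f"
  by (simp add: halfline_def set_borel_measurable_def borel_measurable_restrict_space_iff)

text \<open>The link to the gauge integral, in which the changes of variables below are carried out.
  Absolute integrability there refers to the completed measure, while \<open>halfline\<close> has
  only Borel sets; hence the measurability hypothesis.\<close>

lemma halfline_absolutely_integrable_iff:
  fixes f :: "real \<Rightarrow> 'a::euclidean_space"
  assumes "f \<in> borel_measurable halfline"
  shows "integrable halfline f \<longleftrightarrow> f absolutely_integrable_on {0<..}"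
  using assms unfolding integrable_halfline_iff borel_measurable_halfline_iff
  by (metis integrable_completion set_borel_measurable_def set_integrable_def)

lemma halfline_integral_eq_integral:
  fixes f :: "real \<Rightarrow> 'a::euclidean_space"
  assumes "integrable halfline f"
  shows "integral\<^sup>L halfline f = integral {0<..} f"
  using assms unfolding integrable_halfline_iff integral_halfline_eq
  by (rule set_borel_integral_eq_integral(2))

lemma integrable_halfline_bound:
  fixes f :: "real \<Rightarrow> 'a::{banach,second_countable_topology}"
  assumes "integrable halfline g" "f \<in> borel_measurable halfline"
    "\<And>t. t > 0 \<Longrightarrow> norm (f t) \<le> g t"
  shows "integrable halfline f"
  by (rule Bochner_Integration.integrable_bound[OF assms(1,2)])
     (use assms(3) in \<open>force intro!: AE_I2 simp: \<close>)

text \<open>Euler's integral after the substitution u = s t. The exponent a + 1 on s collects s^a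
  from the power and s from the Jacobian.\<close>

lemma halfline_Gamma_integral:
  fixes a s :: real
  assumes "a > -1" "s > 0"
  shows "integrable halfline (\<lambda>t. t powr a * exp (- (s * t)))"
    and "integral\<^sup>L halfline (\<lambda>t. t powr a * exp (- (s * t))) = Gamma (a + 1) / s powr (a + 1)"
proof -
  define f where "f = (\<lambda>t::real. t powr a * exp (- t))"
  have eq: "f t = t powr ((a + 1) - 1) / exp t" for t
    by (simp add: f_def exp_minus field_simps)
  have hi: "(f has_integral Gamma (a + 1)) {0..}"
    unfolding eq[abs_def] using assms by (intro Gamma_integral_real) auto
  have hi': "(f has_integral Gamma (a + 1)) {0<..}"
  proof -
    have "negligible {x \<in> {0..} - {0<..}. f x \<noteq> 0}" "negligible {x \<in> {0<..} - {0..}. f x \<noteq> 0}"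
      by (rule negligible_subset[of "{0}"]; force)+
    from has_integral_spike_set_eq[OF this] hi show ?thesis by blast
  qed
  have abs: "f absolutely_integrable_on {0<..}"
    using hi' by (intro nonnegative_absolutely_integrable_1) (auto simp: f_def)
  have img: "(\<lambda>x. s * x) ` {0<..} = {0<..}"
  proof (intro equalityI subsetI)
    fix x :: real assume "x \<in> {0<..}"
    then have "x = s * (x / s)" "x / s \<in> {0<..}" using assms by auto
    then show "x \<in> (\<lambda>x. s * x) ` {0<..}" by blast
  qed (use assms in auto)
  have inj: "inj_on (\<lambda>x. s * x) {0<..}" using assms by (auto simp: inj_on_def)
  have *: "(\<lambda>x. \<bar>s\<bar> * f (s * x)) absolutely_integrable_on {0<..} \<and>
      integral {0<..} (\<lambda>x. \<bar>s\<bar> * f (s * x)) = Gamma (a + 1)"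
    using has_absolute_integral_change_of_variables_1'
      [of "{0<..}" "\<lambda>x. s * x" "\<lambda>_. s" f "Gamma (a + 1)"] abs hi' img inj
    by (auto intro!: derivative_eq_intros simp: integral_unique)
  have sc: "\<bar>s\<bar> * f (s * x) = s powr (a + 1) * (x powr a * exp (- (s * x)))" if "x > 0" for x
    using assms that by (simp add: f_def powr_mult powr_add)
  have "(\<lambda>x. s powr (a + 1) * (x powr a * exp (- (s * x)))) absolutely_integrable_on {0<..}"
    using * by (subst set_integrable_cong[OF refl refl sc[symmetric]]) auto
  then have "(\<lambda>x. (1 / s powr (a + 1)) * (s powr (a + 1) * (x powr a * exp (- (s * x)))))
    absolutely_integrable_on {0<..}"
    by - (rule set_integrable_mult_right)
  moreover have "(\<lambda>x. (1 / s powr (a + 1)) * (s powr (a + 1) * (x powr a * exp (- (s * x))))) =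
      (\<lambda>x. x powr a * exp (- (s * x)))"
    using assms by (simp add: fun_eq_iff)
  ultimately have A: "(\<lambda>x. x powr a * exp (- (s * x))) absolutely_integrable_on {0<..}"
    by (simp only:)
  have m: "(\<lambda>t. t powr a * exp (- (s * t))) \<in> borel_measurable halfline"
    by (intro measurable_halfline continuous_intros) auto
  show 1: "integrable halfline (\<lambda>t. t powr a * exp (- (s * t)))"
    using A halfline_absolutely_integrable_iff[OF m] by simp
  have "Gamma (a + 1) = integral {0<..} (\<lambda>x. s powr (a + 1) * (x powr a * exp (- (s * x))))"
    using * sc by (metis (no_types, lifting) greaterThan_iff integral_cong)
  then show "integral\<^sup>L halfline (\<lambda>t. t powr a * exp (- (s * t))) = Gamma (a + 1) / s powr (a + 1)"
    using halfline_integral_eq_integral[OF 1] assms by simp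
qed

text \<open>The substitution t = 1/u exchanges 0 and infinity; it is what turns integrals with the
  factor \<open>exp (- (c / s))\<close> into Gamma integrals.\<close>

lemma halfline_inversion:
  fixes f :: "real \<Rightarrow> real"
  assumes "integrable halfline f" "continuous_on {0<..} f"
  shows "integrable halfline (\<lambda>u. f (1 / u) / u\<^sup>2)"
    and "integral\<^sup>L halfline (\<lambda>u. f (1 / u) / u\<^sup>2) = integral\<^sup>L halfline f"
proof -
  have abs: "f absolutely_integrable_on {0<..}"
    using assms halfline_absolutely_integrable_iff measurable_halfline by blast
  have img: "(\<lambda>x::real. 1 / x) ` {0<..} = {0<..}"
  proof (intro equalityI subsetI)
    fix x :: real assume "x \<in> {0<..}"
    then have "x = 1 / (1 / x)" "1 / x \<in> {0<..}" by auto
    then show "x \<in> (\<lambda>x. 1 / x) ` {0<..}" by blast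
  qed auto
  have inj: "inj_on (\<lambda>x::real. 1 / x) {0<..}" by (auto simp: inj_on_def)
  have der: "((\<lambda>x. 1 / x) has_field_derivative (- (1 / x\<^sup>2))) (at x within {0<..})"
    if "x \<in> {0<..}" for x :: real
    using that by (auto intro!: derivative_eq_intros simp: power2_eq_square)
  have *: "(\<lambda>x. \<bar>- (1 / x\<^sup>2)\<bar> * f (1 / x)) absolutely_integrable_on {0<..} \<and>
      integral {0<..} (\<lambda>x. \<bar>- (1 / x\<^sup>2)\<bar> * f (1 / x)) = integral {0<..} f"
    using has_absolute_integral_change_of_variables_1'
      [of "{0<..}" "\<lambda>x. 1 / x" "\<lambda>x. - (1 / x\<^sup>2)" f "integral {0<..} f"] abs img inj der
    by auto
  have m: "(\<lambda>u. f (1 / u) / u\<^sup>2) \<in> borel_measurable halfline"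
    by (intro measurable_halfline continuous_intros continuous_on_compose2[OF assms(2)]) auto
  have e: "(\<lambda>x. \<bar>- (1 / x\<^sup>2)\<bar> * f (1 / x)) = (\<lambda>u. f (1 / u) / u\<^sup>2)" by (auto simp: fun_eq_iff)
  show 1: "integrable halfline (\<lambda>u. f (1 / u) / u\<^sup>2)"
    using * halfline_absolutely_integrable_iff[OF m] unfolding e by simp
  show "integral\<^sup>L halfline (\<lambda>u. f (1 / u) / u\<^sup>2) = integral\<^sup>L halfline f"
    using * unfolding e halfline_integral_eq_integral[OF 1] halfline_integral_eq_integral[OF assms(1)]
    by simp
qed

lemma halfline_scaling:
  fixes f :: "real \<Rightarrow> real"
  assumes "integrable halfline f" "continuous_on {0<..} f" "s > 0"
  shows "integral\<^sup>L halfline (\<lambda>u. s * f (s * u)) = integral\<^sup>L halfline f"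
proof -
  have abs: "f absolutely_integrable_on {0<..}"
    using assms halfline_absolutely_integrable_iff measurable_halfline by blast
  have img: "(\<lambda>x. s * x) ` {0<..} = {0<..}"
  proof (intro equalityI subsetI)
    fix x :: real assume "x \<in> {0<..}"
    then have "x = s * (x / s)" "x / s \<in> {0<..}" using assms by auto
    then show "x \<in> (\<lambda>x. s * x) ` {0<..}" by blast
  qed (use assms in auto)
  have inj: "inj_on (\<lambda>x. s * x) {0<..}" using assms by (auto simp: inj_on_def)
  have *: "(\<lambda>x. \<bar>s\<bar> * f (s * x)) absolutely_integrable_on {0<..} \<and>
      integral {0<..} (\<lambda>x. \<bar>s\<bar> * f (s * x)) = integral {0<..} f"
    using has_absolute_integral_change_of_variables_1'
      [of "{0<..}" "\<lambda>x. s * x" "\<lambda>_. s" f "integral {0<..} f"] abs img inj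
    by (auto intro!: derivative_eq_intros)
  have m: "(\<lambda>u. s * f (s * u)) \<in> borel_measurable halfline"
    by (intro measurable_halfline continuous_intros continuous_on_compose2[OF assms(2)])
       (use assms in auto)
  have e: "\<bar>s\<bar> = s" using assms by simp
  have 1: "integrable halfline (\<lambda>u. s * f (s * u))"
    using * halfline_absolutely_integrable_iff[OF m] unfolding e by simp
  show ?thesis
    using * unfolding e halfline_integral_eq_integral[OF 1] halfline_integral_eq_integral[OF assms(1)]
    by simp
qed

text \<open>The antiderivative (1 + t)^(1-p) / (1-p) tends to 0 at infinity because p > 1. These
  powers are the majorants of the regularised integrand.\<close>

lemma integrable_halfline_powr:
  fixes p :: real
  assumes "p > 1"
  shows "integrable halfline (\<lambda>t. (1 + t) powr (- p))"
proof -
  define F where "F = (\<lambda>t::real. (1 + t) powr (1 - p) / (1 - p))"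
  have "set_integrable lborel (einterval 0 \<infinity>) (\<lambda>t. (1 + t) powr (- p))"
  proof (rule interval_integral_FTC_nonneg(1)[where F = F and A = "1 / (1 - p)" and B = 0])
    show "DERIV F x :> (1 + x) powr (- p)" if "0 < ereal x" "ereal x < \<infinity>" for x
    proof -
      have "DERIV F x :> (1 - p) * (1 + x) powr (1 - p - 1) / (1 - p)"
        unfolding F_def using that assms by (auto intro!: derivative_eq_intros)
      then show ?thesis using assms by simp
    qed
    show "isCont (\<lambda>t. (1 + t) powr (- p)) x" if "0 < ereal x" "ereal x < \<infinity>" for x
      using that by (intro continuous_intros) auto
    show "((F \<circ> real_of_ereal) \<longlongrightarrow> 1 / (1 - p)) (at_right 0)"
    proof -
      have "(F \<longlongrightarrow> F 0) (at_right 0)"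
        unfolding F_def using assms by (intro tendsto_intros) auto
      then show ?thesis
        unfolding zero_ereal_def by (subst ereal_tendsto_simps1) (simp add: F_def)
    qed
    show "((F \<circ> real_of_ereal) \<longlongrightarrow> 0) (at_left \<infinity>)"
    proof -
      have "((\<lambda>t. (1 + t) powr (1 - p) / (1 - p)) \<longlongrightarrow> 0 / (1 - p)) at_top"
        using assms
        by (intro tendsto_intros tendsto_neg_powr filterlim_tendsto_add_at_top[OF tendsto_const]
            filterlim_ident) auto
      then show ?thesis by (subst ereal_tendsto_simps1) (simp add: F_def)
    qed
  qed auto
  moreover have "einterval 0 \<infinity> = {0<..}" by (auto simp: einterval_def)
  ultimately show ?thesis by (simp add: integrable_halfline_iff)
qed

subsection \<open>Parameter integrals\<close>

text \<open>Dominated convergence along every sequence in \<open>X\<close> that tends to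
  \<open>x0\<close>. A general set \<open>X\<close> covers both the one-sided limits at 0 and the
  punctured balls of difference quotients.\<close>

lemma tendsto_integral_at:
  fixes f :: "'b::first_countable_topology \<Rightarrow> 'a \<Rightarrow> 'c::{banach,second_countable_topology}"
  assumes "\<And>x. x \<in> X \<Longrightarrow> f x \<in> borel_measurable M" "f0 \<in> borel_measurable M" "integrable M g"
    and dom: "\<And>x t. x \<in> X \<Longrightarrow> t \<in> space M \<Longrightarrow> norm (f x t) \<le> g t"
    and lim: "\<And>t. t \<in> space M \<Longrightarrow> ((\<lambda>x. f x t) \<longlongrightarrow> f0 t) (at x0 within X)"
  shows "((\<lambda>x. integral\<^sup>L M (f x)) \<longlongrightarrow> integral\<^sup>L M f0) (at x0 within X)"
  unfolding tendsto_at_iff_sequentially comp_def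
proof (intro allI impI)
  fix Y :: "nat \<Rightarrow> 'b" assume Y: "\<forall>i. Y i \<in> X - {x0}" "Y \<longlonglongrightarrow> x0"
  show "(\<lambda>i. integral\<^sup>L M (f (Y i))) \<longlonglongrightarrow> integral\<^sup>L M f0"
  proof (rule integral_dominated_convergence[where w = g])
    show "AE t in M. (\<lambda>i. f (Y i) t) \<longlonglongrightarrow> f0 t"
    proof (rule AE_I2)
      fix t assume "t \<in> space M"
      from lim[OF this] Y show "(\<lambda>i. f (Y i) t) \<longlonglongrightarrow> f0 t"
        unfolding tendsto_at_iff_sequentially comp_def by blast
    qed
  qed (use assms Y in \<open>auto intro!: AE_I2\<close>)
qed

text \<open>The mean value inequality turns the majorant \<open>g\<close> of the derivative into a
  Lipschitz bound, so the difference quotients are dominated by the same \<open>g\<close>, and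
  integrability at \<open>x0\<close> spreads to the whole ball.\<close>

lemma has_field_derivative_integral:
  fixes f :: "'b::{real_normed_field,banach,second_countable_topology} \<Rightarrow> 'a \<Rightarrow> 'b"
  assumes r: "r > 0"
    and meas: "\<And>x. x \<in> ball x0 r \<Longrightarrow> f x \<in> borel_measurable M"
    and int0: "integrable M (f x0)"
    and intg: "integrable M g"
    and der: "\<And>x t. x \<in> ball x0 r \<Longrightarrow> t \<in> space M \<Longrightarrow>
        ((\<lambda>x. f x t) has_field_derivative f' x t) (at x)"
    and dom: "\<And>x t. x \<in> ball x0 r \<Longrightarrow> t \<in> space M \<Longrightarrow> norm (f' x t) \<le> g t"
  shows "((\<lambda>x. integral\<^sup>L M (f x)) has_field_derivative integral\<^sup>L M (f' x0)) (at x0)"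
proof -
  have x0: "x0 \<in> ball x0 r" using r by simp
  have lip: "norm (f x t - f x0 t) \<le> g t * norm (x - x0)"
    if "x \<in> ball x0 r" "t \<in> space M" for x t
    by (rule field_differentiable_bound[where S = "ball x0 r" and f' = "\<lambda>x. f' x t"])
       (use that x0 der dom in \<open>auto intro: DERIV_subset\<close>)
  have bound: "norm ((f x t - f x0 t) / (x - x0)) \<le> g t" if "x \<in> ball x0 r - {x0}" "t \<in> space M" for x t
    using lip[of x t] that by (simp add: norm_divide divide_le_eq)
  have intx: "integrable M (f x)" if "x \<in> ball x0 r" for x
  proof -
    have "integrable M (\<lambda>t. f x t - f x0 t)"
    proof (rule Bochner_Integration.integrable_bound)
      show "integrable M (\<lambda>t. g t * norm (x - x0))" using intg by simp
      show "(\<lambda>t. f x t - f x0 t) \<in> borel_measurable M"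
        using meas[OF that] meas[OF x0] by simp
      show "AE t in M. norm (f x t - f x0 t) \<le> norm (g t * norm (x - x0))"
        using lip[OF that] by (intro AE_I2) (metis abs_ge_self dual_order.trans real_norm_def)
    qed
    from Bochner_Integration.integrable_add[OF this int0] show ?thesis by simp
  qed
  have lim: "((\<lambda>x. (f x t - f x0 t) / (x - x0)) \<longlongrightarrow> f' x0 t) (at x0 within (ball x0 r - {x0}))"
    if "t \<in> space M" for t
    using der[OF x0 that] unfolding has_field_derivative_iff
    by (rule tendsto_within_subset) auto
  \<comment> \<open>The derivative is measurable as the pointwise limit of difference quotients
    along one sequence tending to \<open>x0\<close>.\<close>
  have m': "f' x0 \<in> borel_measurable M"
  proof -
    have "x0 islimpt ball x0 r"
      using r by (simp add: interior_limit_point)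
    then obtain Y where Y: "\<And>i. Y i \<in> ball x0 r - {x0}" "Y \<longlonglongrightarrow> x0"
      unfolding islimpt_sequential by blast
    show ?thesis
    proof (rule borel_measurable_LIMSEQ_metric)
      show "(\<lambda>t. (f (Y i) t - f x0 t) / (Y i - x0)) \<in> borel_measurable M" for i
        using meas[of "Y i"] meas[OF x0] Y(1)[of i] by simp
      show "(\<lambda>i. (f (Y i) t - f x0 t) / (Y i - x0)) \<longlonglongrightarrow> f' x0 t" if "t \<in> space M" for t
        using lim[OF that] Y unfolding tendsto_at_iff_sequentially comp_def by auto
    qed
  qed
  have "((\<lambda>x. integral\<^sup>L M (\<lambda>t. (f x t - f x0 t) / (x - x0))) \<longlongrightarrow> integral\<^sup>L M (f' x0))
      (at x0 within (ball x0 r - {x0}))"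
  proof (rule tendsto_integral_at[OF _ m' intg])
    show "(\<lambda>t. (f x t - f x0 t) / (x - x0)) \<in> borel_measurable M" if "x \<in> ball x0 r - {x0}" for x
      using meas[of x] meas[OF x0] that by simp
  qed (use bound lim in auto)
  then have "((\<lambda>x. (integral\<^sup>L M (f x) - integral\<^sup>L M (f x0)) / (x - x0)) \<longlongrightarrow> integral\<^sup>L M (f' x0))
      (at x0 within (ball x0 r - {x0}))"
    by (rule Lim_transform_eventually)
       (auto simp: eventually_at_filter intx int0 intro!: always_eventually)
  moreover have "at x0 within (ball x0 r - {x0}) = at x0"
    using at_within_open[of x0 "ball x0 r"] r by (simp add: at_within_def)
  ultimately show ?thesis by (simp add: has_field_derivative_iff)
qed

text \<open>Cauchy's inequality on discs of radius \<open>r\<close> converts a local majorant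
  \<open>g\<close> of the functions into the majorant \<open>g t / r\<close> of their derivatives,
  so only the functions themselves have to be estimated.\<close>

lemma holomorphic_on_integral:
  fixes f :: "complex \<Rightarrow> 'a \<Rightarrow> complex"
  assumes S: "open S"
    and meas: "\<And>x. x \<in> S \<Longrightarrow> f x \<in> borel_measurable M"
    and hol: "\<And>t. t \<in> space M \<Longrightarrow> (\<lambda>x. f x t) holomorphic_on S"
    and dom: "\<And>x0. x0 \<in> S \<Longrightarrow> \<exists>r>0. \<exists>g. integrable M g \<and>
        (\<forall>x\<in>ball x0 r \<inter> S. \<forall>t\<in>space M. norm (f x t) \<le> g t)"
  shows "(\<lambda>x. integral\<^sup>L M (f x)) holomorphic_on S"
proof (rule holomorphic_onI)
  fix x0 assume x0: "x0 \<in> S"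
  obtain r0 g where r0: "r0 > 0" and g: "integrable M g"
    and b: "\<And>x t. x \<in> ball x0 r0 \<inter> S \<Longrightarrow> t \<in> space M \<Longrightarrow> norm (f x t) \<le> g t"
    using dom[OF x0] by blast
  obtain r1 where r1: "r1 > 0" "ball x0 r1 \<subseteq> S" using S x0 openE by blast
  \<comment> \<open>Closed discs of radius \<open>r\<close> about points of \<open>ball x0 r\<close>
    then stay inside both the domain and the disc where \<open>g\<close> dominates.\<close>
  define r where "r = min r0 r1 / 3"
  have r: "r > 0" using r0 r1 by (simp add: r_def)
  have sub: "cball x r \<subseteq> ball x0 r0 \<inter> S" if "x \<in> ball x0 r" for x
  proof
    fix y assume "y \<in> cball x r"
    then have "dist x0 y < 3 * r" using that dist_triangle[of x0 y x] r by simp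
    then have "y \<in> ball x0 r0 \<inter> ball x0 r1" by (simp add: r_def)
    then show "y \<in> ball x0 r0 \<inter> S" using r1 by auto
  qed
  have "((\<lambda>x. integral\<^sup>L M (f x)) has_field_derivative
      integral\<^sup>L M (\<lambda>t. deriv (\<lambda>x. f x t) x0)) (at x0)"
  proof (rule has_field_derivative_integral[OF r, where g = "\<lambda>t. g t / r" and f' = "\<lambda>x t. deriv (\<lambda>x. f x t) x"])
    have x0': "x0 \<in> ball x0 r0 \<inter> S" using r0 x0 by auto
    show "f x \<in> borel_measurable M" if "x \<in> ball x0 r" for x
      using sub[OF that] r by (intro meas) auto
    show "integrable M (f x0)"
      using b[OF x0'] meas[OF x0]
      by (intro Bochner_Integration.integrable_bound[OF g] AE_I2)
         (auto intro: order_trans[OF _ abs_ge_self])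
    show "integrable M (\<lambda>t. g t / r)" using g by simp
    fix x t assume x: "x \<in> ball x0 r" and t: "t \<in> space M"
    have xS: "x \<in> S" using sub[OF x] r by auto
    show "((\<lambda>x. f x t) has_field_derivative deriv (\<lambda>x. f x t) x) (at x)"
      using holomorphic_derivI[OF hol[OF t] S xS] .
    have "norm ((deriv ^^ 1) (\<lambda>x. f x t) x) \<le> fact 1 * g t / r ^ 1"
    proof (rule Cauchy_inequality)
      show "(\<lambda>x. f x t) holomorphic_on ball x r"
        using hol[OF t] sub[OF x]
        by (meson Int_lower2 ball_subset_cball holomorphic_on_subset subset_trans)
      show "continuous_on (cball x r) (\<lambda>x. f x t)"
        using hol[OF t] sub[OF x]
        by (meson Int_lower2 continuous_on_subset holomorphic_on_imp_continuous_on subset_trans)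
      show "norm (f y t) \<le> g t" if "norm (x - y) = r" for y
        using that sub[OF x] t by (intro b) (auto simp: dist_norm subset_iff)
    qed (use r in auto)
    then show "norm (deriv (\<lambda>x. f x t) x) \<le> g t / r" by simp
  qed
  then show "(\<lambda>x. integral\<^sup>L M (f x)) field_differentiable at x0 within S"
    using field_differentiable_at_within field_differentiable_def by blast
qed

subsection \<open>The entire part of the Bessel function\<close>

text \<open>The Bessel-Clifford function at \<open>- y\<close>: J_\<nu>(w) = (w/2)^\<nu>
  E_\<nu>(w^2/4). All multivaluedness sits in the power; E is entire in the order as well as in
  y.\<close>

definition bessel_E :: "complex \<Rightarrow> complex \<Rightarrow> complex" where
  "bessel_E \<nu> y = (\<Sum>k. (-1) ^ k * rGamma (of_nat k + \<nu> + 1) / fact k * y ^ k)"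

text \<open>Since w rGamma(w + 1) = rGamma(w), a shift by 1 cannot increase the modulus once |w| is
  at least 1, which holds for w = k + \<nu> + 1 as soon as k is at least R. The remaining arguments
  lie in a fixed compact disc.\<close>

lemma rGamma_shift_bound:
  fixes R :: real
  shows "\<exists>M>0. \<forall>k. \<forall>\<nu>::complex. norm \<nu> \<le> R \<longrightarrow> norm (rGamma (of_nat k + \<nu> + 1)) \<le> M"
proof -
  define N where "N = nat \<lceil>R\<rceil>"
  have "compact (rGamma ` cball (0::complex) (N + R + 1))"
    by (intro compact_continuous_image continuous_intros) auto
  then obtain M where M: "M > 0" "\<And>w::complex. norm w \<le> N + R + 1 \<Longrightarrow> norm (rGamma w) \<le> M"
    using compact_imp_bounded bounded_pos by (metis dist_0_norm image_eqI mem_cball)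
  have "norm (rGamma (of_nat k + \<nu> + 1)) \<le> M" if "norm \<nu> \<le> R" for k and \<nu> :: complex
  proof (induction k)
    case 0
    have "norm (\<nu> + 1) \<le> R + 1" using that norm_triangle_ineq[of \<nu> 1] by simp
    then show ?case using M(2)[of "\<nu> + 1"] by simp
  next
    case (Suc k)
    show ?case
    proof (cases "Suc k \<le> N")
      case True
      have "norm (of_nat (Suc k) + \<nu> + 1) \<le> norm (of_nat (Suc k) :: complex) + norm \<nu> + norm (1::complex)"
        by (rule norm_triangle_le)+ (simp add: norm_triangle_ineq)
      also have "\<dots> \<le> N + R + 1" using True that by (simp del: of_nat_Suc)
      finally show ?thesis by (rule M(2))
    next
      case False
      then have "R \<le> k" unfolding N_def by linarith
      define w where "w = of_nat k + \<nu> + 1"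
      have "real k + 1 = norm (w - \<nu>)" unfolding w_def
        by (metis (no_types, opaque_lifting) add.assoc add.commute add_diff_cancel_right' norm_of_nat of_nat_Suc)
      then have "1 \<le> norm w" using norm_triangle_ineq4[of w \<nu>] that \<open>R \<le> k\<close> by linarith
      have "w * rGamma (w + 1) = rGamma w" by (rule rGamma_plus1)
      then have "norm (rGamma (w + 1)) \<le> norm (rGamma w)"
        using \<open>1 \<le> norm w\<close> by (metis mult_right_mono mult_1 norm_ge_zero norm_mult)
      also have "\<dots> \<le> M" using Suc.IH by (simp add: w_def)
      finally show ?thesis by (simp add: w_def add_ac)
    qed
  qed
  with M show ?thesis by blast
qed

lemma summable_exp_norm_bound:
  fixes M y :: real
  shows "(\<lambda>k. M * (y ^ k / fact k)) sums (M * exp y)"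
  using sums_mult[OF exp_converges[of y], of M] by (simp add: field_simps scaleR_conv_of_real)

lemma bessel_E_term_bound:
  assumes "norm (rGamma (of_nat k + \<nu> + 1)) \<le> M" "norm y \<le> Y"
  shows "norm ((-1) ^ k * rGamma (of_nat k + \<nu> + 1) / fact k * (y::complex) ^ k) \<le> M * (Y ^ k / fact k)"
proof -
  have "norm (rGamma (of_nat k + \<nu> + 1)) * (norm y ^ k / fact k) \<le> M * (Y ^ k / fact k)"
    using assms by (intro mult_mono divide_right_mono power_mono) (auto intro: order_trans[OF norm_ge_zero])
  then show ?thesis by (simp add: norm_mult norm_divide norm_power)
qed

lemma summable_bessel_E:
  "summable (\<lambda>k. norm ((-1) ^ k * rGamma (of_nat k + \<nu> + 1) / fact k * (y::complex) ^ k))"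
proof -
  obtain M where "\<And>k. norm (rGamma (of_nat k + \<nu> + 1)) \<le> M"
    using rGamma_shift_bound[of "norm \<nu>"] by blast
  then show ?thesis
    using bessel_E_term_bound[of _ \<nu> M y "norm y"]
    by (intro summable_comparison_test'[OF sums_summable[OF summable_exp_norm_bound[of M "norm y"]], of 0])
       (simp del: norm_mult)
qed

lemma sums_bessel_E:
  "(\<lambda>k. (-1) ^ k * rGamma (of_nat k + \<nu> + 1) / fact k * y ^ k) sums bessel_E \<nu> y"
  unfolding bessel_E_def by (rule summable_sums[OF summable_norm_cancel[OF summable_bessel_E]])

lemma bessel_E_bound:
  "\<exists>M>0. \<forall>\<nu> y. norm \<nu> \<le> R \<longrightarrow> norm (bessel_E \<nu> y) \<le> M * exp (norm y)"
proof -
  obtain M where M: "M > 0" "\<And>k \<nu>. norm \<nu> \<le> R \<Longrightarrow> norm (rGamma (of_nat k + \<nu> + 1 :: complex)) \<le> M"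
    using rGamma_shift_bound[of R] by blast
  have "norm (bessel_E \<nu> y) \<le> M * exp (norm y)" if "norm \<nu> \<le> R" for \<nu> y
  proof -
    have "norm (bessel_E \<nu> y) \<le> (\<Sum>k. M * (norm y ^ k / fact k))"
      unfolding bessel_E_def
      using bessel_E_term_bound[OF M(2)[OF that], of y "norm y"]
      by (intro norm_suminf_le) (use summable_exp_norm_bound sums_summable in blast)+
    also have "\<dots> = M * exp (norm y)"
      using summable_exp_norm_bound[of M "norm y"] by (simp add: sums_iff)
    finally show ?thesis .
  qed
  with M show ?thesis by blast
qed

text \<open>The exponential majorant of the series is uniform for orders in a disc, so the entire
  partial sums converge locally uniformly in the order.\<close>

lemma bessel_E_holomorphic_order: "(\<lambda>\<nu>. bessel_E \<nu> y) holomorphic_on UNIV"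
proof (rule holomorphic_uniform_sequence[where f = "\<lambda>n \<nu>. \<Sum>k<n. (-1) ^ k * rGamma (of_nat k + \<nu> + 1) / fact k * y ^ k"])
  show "(\<lambda>\<nu>. \<Sum>k<n. (-1) ^ k * rGamma (of_nat k + \<nu> + 1) / fact k * y ^ k) holomorphic_on UNIV" for n
    by (intro holomorphic_intros) auto
  show "\<exists>d>0. cball x d \<subseteq> UNIV \<and> uniform_limit (cball x d)
      (\<lambda>n \<nu>. \<Sum>k<n. (-1) ^ k * rGamma (of_nat k + \<nu> + 1) / fact k * y ^ k) (\<lambda>\<nu>. bessel_E \<nu> y) sequentially" for x
  proof (intro exI conjI)
    obtain M where M: "\<And>k \<nu>. norm \<nu> \<le> norm x + 1 \<Longrightarrow> norm (rGamma (of_nat k + \<nu> + 1 :: complex)) \<le> M"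
      using rGamma_shift_bound[of "norm x + 1"] by blast
    have b: "norm \<nu> \<le> norm x + 1" if "\<nu> \<in> cball x 1" for \<nu>
      using that norm_triangle_ineq4[of x "x - \<nu>"] by (simp add: dist_norm)
    show "uniform_limit (cball x 1)
      (\<lambda>n \<nu>. \<Sum>k<n. (-1) ^ k * rGamma (of_nat k + \<nu> + 1) / fact k * y ^ k) (\<lambda>\<nu>. bessel_E \<nu> y) sequentially"
      unfolding bessel_E_def
    proof (rule Weierstrass_m_test)
      show "summable (\<lambda>k. M * (norm y ^ k / fact k))"
        using summable_exp_norm_bound sums_summable by blast
    qed (use bessel_E_term_bound M b in blast)
  qed auto
qed auto

lemma bessel_E_deriv: "(bessel_E \<nu> has_field_derivative - bessel_E (\<nu> + 1) y) (at y)"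
proof -
  define a where "a = (\<lambda>k. (-1) ^ k * rGamma (of_nat k + \<nu> + 1) / fact k)"
  have s: "summable (\<lambda>k. a k * x ^ k)" for x
    unfolding a_def by (rule summable_norm_cancel[OF summable_bessel_E])
  have d: "diffs a k = - ((-1) ^ k * rGamma (of_nat k + (\<nu> + 1) + 1) / fact k)" for k
  proof -
    have "of_nat k + (\<nu> + 1) + 1 = of_nat (Suc k) + \<nu> + 1" by simp
    then show ?thesis
      unfolding a_def diffs_def fact_Suc power_Suc by (simp only:) (simp del: of_nat_Suc)
  qed
  have "((\<lambda>y. \<Sum>k. a k * y ^ k) has_field_derivative (\<Sum>k. diffs a k * y ^ k)) (at y)"
    by (rule termdiffs_strong_converges_everywhere[OF s])
  moreover have "(\<Sum>k. diffs a k * y ^ k) = - bessel_E (\<nu> + 1) y"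
    using sums_minus[OF sums_bessel_E[of "\<nu> + 1" y]] by (simp add: d sums_iff)
  ultimately show ?thesis by (simp add: a_def bessel_E_def[abs_def])
qed

text \<open>The three-term recurrence J_(\<nu>-1) + J_(\<nu>+1) = (2\<nu>/w) J_\<nu>. On
  coefficients, (k + \<nu>) rGamma(k + \<nu> + 1) = rGamma(k + \<nu>): the part with \<nu> gives
  \<nu> E_\<nu>, and the part with k gives y times the derivative of E_\<nu>.\<close>

lemma bessel_E_recurrence: "bessel_E (\<nu> - 1) y = \<nu> * bessel_E \<nu> y - y * bessel_E (\<nu> + 1) y"
proof -
  define a where "a = (\<lambda>k. (-1) ^ k * rGamma (of_nat k + \<nu> + 1) / fact k)"
  have d: "diffs a k = - ((-1) ^ k * rGamma (of_nat k + (\<nu> + 1) + 1) / fact k)" for k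
  proof -
    have "of_nat k + (\<nu> + 1) + 1 = of_nat (Suc k) + \<nu> + 1" by simp
    then show ?thesis
      unfolding a_def diffs_def fact_Suc power_Suc by (simp only:) (simp del: of_nat_Suc)
  qed
  have dE: "(\<lambda>k. diffs a k * y ^ k) sums (- bessel_E (\<nu> + 1) y)"
    using sums_minus[OF sums_bessel_E[of "\<nu> + 1" y]] by (simp add: d)
  \<comment> \<open>The truncated exponent at k = 0 is harmless because that term carries the factor
    k; multiplying by y therefore restores y^k for every k.\<close>
  have "(\<lambda>k. of_nat k * a k * y ^ (k - Suc 0)) sums (- bessel_E (\<nu> + 1) y)"
    using diffs_equiv[of a y] dE by (simp add: sums_iff)
  then have "(\<lambda>k. y * (of_nat k * a k * y ^ (k - Suc 0))) sums (y * - bessel_E (\<nu> + 1) y)"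
    by (rule sums_mult)
  moreover have "y * (of_nat k * a k * y ^ (k - Suc 0)) = of_nat k * a k * y ^ k" for k
    by (cases k) auto
  ultimately have 1: "(\<lambda>k. of_nat k * a k * y ^ k) sums (y * - bessel_E (\<nu> + 1) y)" by simp
  have 2: "(\<lambda>k. \<nu> * (a k * y ^ k)) sums (\<nu> * bessel_E \<nu> y)"
    using sums_bessel_E unfolding a_def by (rule sums_mult)
  have "\<nu> * (a k * y ^ k) + of_nat k * a k * y ^ k =
      (-1) ^ k * rGamma (of_nat k + (\<nu> - 1) + 1) / fact k * y ^ k" for k
  proof -
    have eq: "of_nat k + (\<nu> - 1) + 1 = of_nat k + \<nu>" by simp
    have pl: "rGamma (of_nat k + \<nu>) = (of_nat k + \<nu>) * rGamma (of_nat k + \<nu> + 1)"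
      by (rule rGamma_plus1[symmetric])
    have "\<nu> * (e * r / d * x) + n * (e * r / d) * x = e * ((n + \<nu>) * r) / d * x" for e r d x n :: complex
      by (simp add: divide_inverse algebra_simps)
    then show ?thesis unfolding eq pl a_def .
  qed
  with sums_add[OF 2 1] sums_bessel_E[of "\<nu> - 1" y] show ?thesis
    using sums_unique2 by (simp add: add.commute)
qed

lemma bessel_E_holomorphic: "bessel_E \<nu> holomorphic_on S"
  using bessel_E_deriv by (meson field_differentiable_at_within field_differentiable_def holomorphic_onI)

lemma bessel_E_0 [simp]: "bessel_E \<nu> 0 = rGamma (\<nu> + 1)"
  by (simp add: bessel_E_def powser_zero[of "\<lambda>k. (-1) ^ k * rGamma (of_nat k + \<nu> + 1) / fact k", simplified])

text \<open>
  For \<open>c = lam\<^sup>2 / 4\<close> this is $t^{\nu/2} J_\nu(\lambda \sqrt t)$ up to a constant factor; the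
  normalisation is chosen so that differentiation in \<open>t\<close> lowers \<open>\<nu>\<close> by one.
\<close>

definition bessel_P :: "real \<Rightarrow> complex \<Rightarrow> real \<Rightarrow> complex" where
  "bessel_P c \<nu> t = of_real t powr \<nu> * bessel_E \<nu> (of_real (c * t))"

lemma bessel_P_0 [simp]: "bessel_P c \<nu> 0 = 0"
  by (simp add: bessel_P_def)

text \<open>The product rule followed by the recurrence. The constant is complex so that the same
  rule serves \<open>bessel_P\<close> and, with - c in place of c, the solutions used on the
  negative axis.\<close>

lemma powr_entire_deriv:
  assumes z: "z \<notin> \<real>\<^sub>\<le>\<^sub>0"
  shows "((\<lambda>z. z powr \<nu> * bessel_E \<nu> (c * z)) has_field_derivative
           z powr (\<nu> - 1) * bessel_E (\<nu> - 1) (c * z)) (at z)"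
proof -
  have z0: "z \<noteq> 0" using z by auto
  have E: "((\<lambda>z. bessel_E \<nu> (c * z)) has_field_derivative (- bessel_E (\<nu> + 1) (c * z)) * c) (at z)"
    by (rule DERIV_chain2[OF bessel_E_deriv]) (auto intro!: derivative_eq_intros)
  have pw: "((\<lambda>z. z powr \<nu>) has_field_derivative \<nu> * z powr (\<nu> - 1)) (at z)"
    using z by (rule has_field_derivative_powr)
  have "((\<lambda>z. z powr \<nu> * bessel_E \<nu> (c * z)) has_field_derivative
      (z powr \<nu> * ((- bessel_E (\<nu> + 1) (c * z)) * c) + \<nu> * z powr (\<nu> - 1) * bessel_E \<nu> (c * z))) (at z)"
    by (rule DERIV_cong[OF DERIV_mult[OF pw E]]) (simp add: algebra_simps)
  moreover have "z powr \<nu> = z powr (\<nu> - 1) * z"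
    using z0 by (metis diff_add_cancel powr_add powr_to_1)
  ultimately show ?thesis
    by (simp add: bessel_E_recurrence[of \<nu>] algebra_simps)
qed

lemma bessel_P_deriv:
  assumes "t > 0"
  shows "(bessel_P c \<nu> has_vector_derivative bessel_P c (\<nu> - 1) t) (at t)"
  using has_vector_derivative_real_field[OF powr_entire_deriv[of "of_real t" \<nu> "of_real c"]] assms
  by (simp add: bessel_P_def[abs_def])

text \<open>As lowering the order is differentiation, this is Bessel's equation in the form t P'' =
  (\<nu> - 1) P' - c P. It is the recurrence of \<open>bessel_E\<close> multiplied by a power of
  t.\<close>

lemma bessel_P_ode:
  assumes "t > 0"
  shows "of_real t * bessel_P c (\<nu> - 2) t = (\<nu> - 1) * bessel_P c (\<nu> - 1) t - of_real c * bessel_P c \<nu> t"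
proof -
  have p: "of_real t powr (a + 1) = of_real t * of_real t powr a" for a :: complex
    using assms by (simp add: powr_add)
  have e: "bessel_E (\<nu> - 2) (of_real (c * t)) =
      (\<nu> - 1) * bessel_E (\<nu> - 1) (of_real (c * t)) - of_real (c * t) * bessel_E \<nu> (of_real (c * t))"
    using bessel_E_recurrence[of "\<nu> - 1" "of_real (c * t)"] by simp
  have p1: "of_real t powr \<nu> = of_real t * of_real t powr (\<nu> - 1)"
    and p2: "of_real t powr (\<nu> - 1) = of_real t * of_real t powr (\<nu> - 2)"
    using p[of "\<nu> - 1"] p[of "\<nu> - 2"] by simp_all
  have alg: "u * (q * (n * E1 - c' * u * E0)) = n * (u * q * E1) - c' * (u * (u * q) * E0)"
    for u q n c' E0 E1 :: complex
    by (simp add: algebra_simps)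
  show ?thesis
    unfolding bessel_P_def e p1 unfolding p2 of_real_mult by (rule alg)
qed

lemma continuous_on_bessel_P: "continuous_on {0<..} (bessel_P c \<nu>)"
  using bessel_P_deriv[of _ c \<nu>]
  by (intro continuous_at_imp_continuous_on) (auto intro: has_vector_derivative_continuous)

text \<open>Far too large at infinity, but sharp in the power at 0 and uniform in the order; it
  serves near 0 and on bounded ranges of t.\<close>

lemma bessel_P_bound_exp:
  assumes "c \<ge> 0"
  shows "\<exists>M>0. \<forall>\<nu> t. norm \<nu> \<le> R \<longrightarrow> t > 0 \<longrightarrow> norm (bessel_P c \<nu> t) \<le> M * t powr Re \<nu> * exp (c * t)"
proof -
  obtain M where M: "M > 0" "\<And>\<nu> y. norm \<nu> \<le> R \<Longrightarrow> norm (bessel_E \<nu> y) \<le> M * exp (norm y)"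
    using bessel_E_bound[of R] by blast
  have "norm (bessel_P c \<nu> t) \<le> M * t powr Re \<nu> * exp (c * t)" if "norm \<nu> \<le> R" "t > 0" for \<nu> t
  proof -
    have "norm (bessel_P c \<nu> t) = t powr Re \<nu> * norm (bessel_E \<nu> (of_real (c * t)))"
      using that by (simp add: bessel_P_def norm_mult norm_powr_real_powr)
    also have "\<dots> \<le> t powr Re \<nu> * (M * exp (c * t))"
      using M(2)[OF that(1), of "of_real (c * t)"] assms that
      by (intro mult_left_mono) (auto simp: norm_mult)
    finally show ?thesis by (simp add: mult_ac)
  qed
  with M show ?thesis by blast
qed

text \<open>For Re \<nu> > 0 the power tends to 0 at the origin, in agreement with the default value
  of \<open>0 powr \<nu>\<close>.\<close>

lemma continuous_on_bessel_P_0: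
  assumes "c \<ge> 0" "Re \<nu> > 0"
  shows "continuous_on {0..} (bessel_P c \<nu>)"
  unfolding continuous_on_def
proof
  fix t :: real assume t: "t \<in> {0..}"
  show "(bessel_P c \<nu> \<longlongrightarrow> bessel_P c \<nu> t) (at t within {0..})"
  proof (cases "t = 0")
    case False
    then have "isCont (bessel_P c \<nu>) t"
      using t bessel_P_deriv[of t c \<nu>] has_vector_derivative_continuous by auto
    then show ?thesis unfolding isCont_def by (rule tendsto_within_subset) auto
  next
    case True
    obtain M where M: "\<And>t. t > 0 \<Longrightarrow> norm (bessel_P c \<nu> t) \<le> M * t powr Re \<nu> * exp (c * t)"
      using bessel_P_bound_exp[OF assms(1), of "norm \<nu>"] by blast
    have "((\<lambda>t. M * t powr Re \<nu> * exp (c * t)) \<longlongrightarrow> M * 0 powr Re \<nu> * exp (c * 0)) (at 0 within {0..})"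
      using assms by (intro tendsto_intros) (auto simp: eventually_at_filter)
    then have "((\<lambda>t. M * t powr Re \<nu> * exp (c * t)) \<longlongrightarrow> 0) (at 0 within {0..})" using assms by simp
    then have "(bessel_P c \<nu> \<longlongrightarrow> 0) (at 0 within {0..})"
      by (rule Lim_null_comparison[rotated]) (auto simp: eventually_at_filter intro!: always_eventually M)
    then show ?thesis using True by simp
  qed
qed

lemma bessel_P_holomorphic_order:
  assumes "t > 0"
  shows "(\<lambda>\<nu>. bessel_P c \<nu> t) holomorphic_on S"
  unfolding bessel_P_def using assms
  by (intro holomorphic_intros holomorphic_on_subset[OF bessel_E_holomorphic_order]) auto

subsection \<open>Growth at infinity\<close>

text \<open>
  Without the cross term the derivative of the energy contains only \<open>Q t \<bullet> Q t\<close>, which would merely give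
  growth \<open>t powr (2 * \<kappa>)\<close>; the cross term equidistributes it between \<open>P\<close> and \<open>Q\<close>, so that the
  energy grows like \<open>t powr \<kappa>\<close>.
\<close>

lemma bessel_P_energy_deriv:
  fixes c t :: real and \<nu> :: complex
  assumes t: "t > 0"
  defines "\<kappa> \<equiv> Re \<nu> - 1 / 2"
  defines "P \<equiv> bessel_P c \<nu>" and "Q \<equiv> bessel_P c (\<nu> - 1)"
  defines "A \<equiv> (\<lambda>t. c * (P t \<bullet> P t) + t * (Q t \<bullet> Q t) - \<kappa> * (P t \<bullet> Q t))"
  shows "(A has_real_derivative
      (\<kappa> * A t + \<kappa>\<^sup>2 * (P t \<bullet> Q t) - \<kappa> * (P t \<bullet> ((\<nu> - 1) * Q t))) / t) (at t)"
proof -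
  define Q' where "Q' = bessel_P c (\<nu> - 2) t"
  have dP: "(P has_vector_derivative Q t) (at t)"
    unfolding P_def Q_def by (rule bessel_P_deriv[OF t])
  have dQ: "(Q has_vector_derivative Q') (at t)"
    using bessel_P_deriv[OF t, of c "\<nu> - 1"] unfolding Q_def Q'_def by simp
  note inner = bounded_bilinear.has_vector_derivative[OF bounded_bilinear_inner]
  have d: "((\<lambda>t. P t \<bullet> P t) has_real_derivative (P t \<bullet> Q t + Q t \<bullet> P t)) (at t)"
     "((\<lambda>t. Q t \<bullet> Q t) has_real_derivative (Q t \<bullet> Q' + Q' \<bullet> Q t)) (at t)"
     "((\<lambda>t. P t \<bullet> Q t) has_real_derivative (P t \<bullet> Q' + Q t \<bullet> Q t)) (at t)"
    unfolding has_real_derivative_iff_has_vector_derivative by (intro inner dP dQ)+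
  have ode: "of_real t * Q' = (\<nu> - 1) * Q t - of_real c * P t"
    unfolding P_def Q_def Q'_def by (rule bessel_P_ode[OF t])
  \<comment> \<open>The differential equation removes Q' from the derivative of the energy.\<close>
  have tQ: "t * (x \<bullet> Q') = x \<bullet> ((\<nu> - 1) * Q t) - c * (x \<bullet> P t)" for x
  proof -
    have "t * (x \<bullet> Q') = x \<bullet> (of_real t * Q')" by (simp add: scaleR_conv_of_real[symmetric])
    also have "\<dots> = x \<bullet> ((\<nu> - 1) * Q t) - c * (x \<bullet> P t)"
      unfolding ode by (simp add: inner_diff_right scaleR_conv_of_real[symmetric])
    finally show ?thesis .
  qed
  \<comment> \<open>The imaginary part of \<nu> - 1 turns Q into an orthogonal direction, so only Re
    \<nu> - 1 = \<kappa> - 1/2 survives. With this \<kappa> the |Q|^2 terms of t A' add up to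
    \<kappa> t |Q|^2, exactly their share in \<kappa> A.\<close>
  have QQ: "Q t \<bullet> ((\<nu> - 1) * Q t) = (\<kappa> - 1 / 2) * (Q t \<bullet> Q t)"
    by (simp add: inner_complex_def \<kappa>_def algebra_simps)
  have "(A has_real_derivative (c * (P t \<bullet> Q t + Q t \<bullet> P t)
      + (t * (Q t \<bullet> Q' + Q' \<bullet> Q t) + Q t \<bullet> Q t) - \<kappa> * (P t \<bullet> Q' + Q t \<bullet> Q t))) (at t)"
    unfolding A_def by (auto intro!: derivative_eq_intros d)
  moreover have "t * (c * (P t \<bullet> Q t + Q t \<bullet> P t)
      + (t * (Q t \<bullet> Q' + Q' \<bullet> Q t) + Q t \<bullet> Q t) - \<kappa> * (P t \<bullet> Q' + Q t \<bullet> Q t))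
      = \<kappa> * A t + \<kappa>\<^sup>2 * (P t \<bullet> Q t) - \<kappa> * (P t \<bullet> ((\<nu> - 1) * Q t))" (is "t * ?l = ?r")
  proof -
    have "t * ?l = t * (2 * c * (P t \<bullet> Q t) + 2 * (t * (Q t \<bullet> Q')) + Q t \<bullet> Q t - \<kappa> * (Q t \<bullet> Q t))
        - \<kappa> * (t * (P t \<bullet> Q'))"
      by (simp add: inner_commute algebra_simps)
    also have "\<dots> = ?r"
      unfolding tQ QQ A_def by (simp add: inner_commute algebra_simps power2_eq_square)
    finally show ?thesis .
  qed
  ultimately show ?thesis using t by (metis nonzero_mult_div_cancel_left less_numeral_extra(3))
qed

text \<open>By the inequality of means, 2 sqrt(c t) |P| |Q| is at most c |P|^2 + t |Q|^2, so once
  sqrt(c t) exceeds the bound on |\<kappa>| the cross term costs at most half of the diagonal part.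
  The first estimate controls the error terms of the energy derivative, the second recovers P from
  the energy.\<close>

lemma bessel_P_energy_compare:
  fixes c t :: real and P Q :: complex
  assumes c: "c > 0" and t: "t > 0" and k: "\<bar>\<kappa>\<bar> \<le> R + 1 / 2" and ct: "R + 1 / 2 \<le> sqrt (c * t)"
  defines "A \<equiv> c * (P \<bullet> P) + t * (Q \<bullet> Q) - \<kappa> * (P \<bullet> Q)"
  shows "norm P * norm Q * sqrt (c * t) \<le> A" "c * (norm P)\<^sup>2 \<le> 2 * A"
proof -
  define x where "x = norm P * norm Q"
  have x0: "x \<ge> 0" by (simp add: x_def)
  have "0 \<le> (sqrt c * norm P - sqrt t * norm Q)\<^sup>2" by simp
  also have "\<dots> = c * (norm P)\<^sup>2 + t * (norm Q)\<^sup>2 - 2 * (x * sqrt (c * t))"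
    using c t by (simp add: power2_diff power_mult_distrib x_def real_sqrt_mult)
  finally have amgm: "2 * (x * sqrt (c * t)) \<le> c * (norm P)\<^sup>2 + t * (norm Q)\<^sup>2" by simp
  have "\<kappa> * (P \<bullet> Q) \<le> \<bar>\<kappa>\<bar> * \<bar>P \<bullet> Q\<bar>" by (metis abs_ge_self abs_mult)
  also have "\<dots> \<le> (R + 1 / 2) * x"
    unfolding x_def by (intro mult_mono k Cauchy_Schwarz_ineq2) (use k in auto)
  also have "\<dots> \<le> sqrt (c * t) * x" by (intro mult_right_mono ct x0)
  finally have "A \<ge> c * (norm P)\<^sup>2 + t * (norm Q)\<^sup>2 - x * sqrt (c * t)"
    unfolding A_def by (simp add: power2_norm_eq_inner mult.commute)
  moreover have "c * (norm P)\<^sup>2 \<ge> 0" "t * (norm Q)\<^sup>2 \<ge> 0" using c t by simp_all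
  ultimately show "norm P * norm Q * sqrt (c * t) \<le> A" "c * (norm P)\<^sup>2 \<le> 2 * A"
    using amgm unfolding x_def[symmetric] by linarith+
qed

text \<open>A Gronwall argument: for large t the energy satisfies A' <= (\<kappa>/t + L t^(-3/2)) A.
  The second coefficient is integrable at infinity, so A = O(t^\<kappa>), and c |P|^2 <= 2 A gives
  half of the exponent \<kappa> = Re \<nu> - 1/2. Every constant depends on R and c alone.\<close>

lemma bessel_P_growth:
  assumes c: "c > 0" and R: "R \<ge> 0"
  shows "\<exists>C>0. \<forall>\<nu> t. norm \<nu> \<le> R \<longrightarrow> t \<ge> 1 \<longrightarrow> norm (bessel_P c \<nu> t) \<le> C * t powr (Re \<nu> / 2 - 1 / 4)"
proof -
  \<comment> \<open>Beyond T the energy dominates its cross term for every order with |\<nu>| <=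
    R.\<close>
  define T where "T = max 1 ((R + 1 / 2)\<^sup>2 / c)"
  have T1: "T \<ge> 1" by (simp add: T_def)
  have T: "R + 1 / 2 \<le> sqrt (c * t)" if "t \<ge> T" for t
  proof (rule real_le_rsqrt)
    have "(R + 1 / 2)\<^sup>2 / c \<le> t" using that by (simp add: T_def)
    then show "(R + 1 / 2)\<^sup>2 \<le> c * t" using c by (simp add: field_simps)
  qed
  \<comment> \<open>The radius R + 1 makes the bound cover the order \<nu> - 1 of the derivative
    too.\<close>
  obtain M where M: "M > 0"
    "\<And>\<nu> t. norm \<nu> \<le> R + 1 \<Longrightarrow> t > 0 \<Longrightarrow> norm (bessel_P c \<nu> t) \<le> M * t powr Re \<nu> * exp (c * t)"
    using bessel_P_bound_exp[of c "R + 1"] c by auto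
  define D where "D = M * T powr (R + 1) * exp (c * T)"
  have D0: "D > 0" using M T1 by (simp add: D_def)
  have D: "norm (bessel_P c \<nu> t) \<le> D" if "norm \<nu> \<le> R + 1" "1 \<le> t" "t \<le> T" for \<nu> t
  proof -
    have "t powr Re \<nu> \<le> t powr (R + 1)"
      using that abs_Re_le_cmod[of \<nu>] by (intro powr_mono) auto
    also have "\<dots> \<le> T powr (R + 1)" using that R by (intro powr_mono2) auto
    finally have "M * t powr Re \<nu> * exp (c * t) \<le> D"
      unfolding D_def using M(1) c that by (intro mult_mono) auto
    with M(2)[of \<nu> t] that show ?thesis by simp
  qed
  \<comment> \<open>The numerator bounds \<kappa>^2 + |\<kappa>| |\<nu> - 1|, the coefficient of |P|
    |Q| in the error terms; the factor 1 / sqrt c comes from estimating |P| |Q| by A / sqrt(c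
    t).\<close>
  define L where "L = ((R + 1 / 2)\<^sup>2 + (R + 1 / 2) * (R + 1)) / sqrt c"
  have L0: "L \<ge> 0" using R c by (simp add: L_def)
  define E where "E = (c + T + (R + 1 / 2)) * D\<^sup>2 * T powr (R + 1 / 2) * exp (2 * L)"
  have main: "c * (norm (bessel_P c \<nu> t))\<^sup>2 \<le> 2 * (E * t powr (Re \<nu> - 1 / 2))"
    if \<nu>: "norm \<nu> \<le> R" and t: "t \<ge> T" for \<nu> t
  proof -
    define \<kappa> where "\<kappa> = Re \<nu> - 1 / 2"
    define P Q where "P = bessel_P c \<nu>" and "Q = bessel_P c (\<nu> - 1)"
    define A where "A = (\<lambda>t. c * (P t \<bullet> P t) + t * (Q t \<bullet> Q t) - \<kappa> * (P t \<bullet> Q t))"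
    have \<kappa>: "\<bar>\<kappa>\<bar> \<le> R + 1 / 2" using \<nu> abs_Re_le_cmod[of \<nu>] unfolding \<kappa>_def by linarith
    have n1: "norm (\<nu> - 1) \<le> R + 1" using \<nu> norm_triangle_ineq4[of \<nu> 1] by simp
    define A' where "A' = (\<lambda>t. (\<kappa> * A t + \<kappa>\<^sup>2 * (P t \<bullet> Q t) - \<kappa> * (P t \<bullet> ((\<nu> - 1) * Q t))) / t)"
    have dA: "(A has_real_derivative A' s) (at s)" if "s > 0" for s
      using bessel_P_energy_deriv[OF that, of c \<nu>] unfolding A_def A'_def P_def Q_def \<kappa>_def .
    \<comment> \<open>The energy times the integrating factor of the differential inequality; 2 L
      t^(-1/2) is an antiderivative of - L t^(-3/2).\<close>
    define B where "B = (\<lambda>t. A t * (t powr (- \<kappa>) * exp (2 * L * t powr (- (1 / 2)))))"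
    have A'_le: "A' s \<le> \<kappa> * A s / s + L * s powr (- (3 / 2)) * A s" if s: "s \<ge> T" for s
    proof -
      have s0: "s > 0" using s T1 by simp
      have A1: "norm (P s) * norm (Q s) * sqrt (c * s) \<le> A s"
        using bessel_P_energy_compare(1)[OF c s0 \<kappa> T[OF s]] unfolding A_def .
      have "\<kappa>\<^sup>2 * (P s \<bullet> Q s) \<le> (R + 1 / 2)\<^sup>2 * (norm (P s) * norm (Q s))"
        by (intro order_trans[OF mult_left_mono[OF norm_cauchy_schwarz]] mult_right_mono)
           (use \<kappa> abs_le_square_iff[of \<kappa> "R + 1 / 2"] R in auto)
      moreover have "- \<kappa> * (P s \<bullet> ((\<nu> - 1) * Q s)) \<le> (R + 1 / 2) * (R + 1) * (norm (P s) * norm (Q s))"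
      proof -
        have "- \<kappa> * (P s \<bullet> ((\<nu> - 1) * Q s)) \<le> \<bar>\<kappa>\<bar> * \<bar>P s \<bullet> ((\<nu> - 1) * Q s)\<bar>"
          by (metis abs_ge_self abs_minus_cancel abs_mult)
        also have "\<dots> \<le> (R + 1 / 2) * (norm (P s) * norm ((\<nu> - 1) * Q s))"
          by (intro mult_mono \<kappa> Cauchy_Schwarz_ineq2) (use R in auto)
        also have "\<dots> \<le> (R + 1 / 2) * (norm (P s) * ((R + 1) * norm (Q s)))"
          unfolding norm_mult using R by (intro mult_left_mono mult_right_mono n1) auto
        finally show ?thesis by (simp add: mult_ac)
      qed
      ultimately have "\<kappa>\<^sup>2 * (P s \<bullet> Q s) - \<kappa> * (P s \<bullet> ((\<nu> - 1) * Q s))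
          \<le> ((R + 1 / 2)\<^sup>2 + (R + 1 / 2) * (R + 1)) * (norm (P s) * norm (Q s))"
        by (simp add: distrib_right)
      also have "\<dots> \<le> ((R + 1 / 2)\<^sup>2 + (R + 1 / 2) * (R + 1)) * (A s / sqrt (c * s))"
        using A1 c s0 R by (intro mult_left_mono) (auto simp: field_simps)
      also have "\<dots> = L * s powr (- (1 / 2)) * A s"
        using s0 by (simp add: L_def real_sqrt_mult powr_minus powr_half_sqrt field_simps)
      finally have "A' s \<le> (\<kappa> * A s + L * s powr (- (1 / 2)) * A s) / s"
        unfolding A'_def using s0 by (intro divide_right_mono) auto
      also have "s powr (- (1 / 2)) = s * s powr (- (3 / 2))"
        using s0 powr_mult_base[of s "- (3 / 2)"] by simp
      finally show ?thesis using s0 by (simp add: field_simps)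
    qed
    have "B t \<le> B T"
    proof (rule DERIV_nonpos_imp_nonincreasing[OF t])
      fix s assume s: "T \<le> s" "s \<le> t"
      then have s0: "s > 0" using T1 by simp
      define w where "w = s powr (- \<kappa>) * exp (2 * L * s powr (- (1 / 2)))"
      have dw: "((\<lambda>t. t powr (- \<kappa>) * exp (2 * L * t powr (- (1 / 2)))) has_real_derivative
          w * (- \<kappa> / s - L * s powr (- (3 / 2)))) (at s)"
      proof -
        have e: "s powr (- \<kappa> - 1) = s powr (- \<kappa>) / s" using s0 by (simp add: powr_diff)
        show ?thesis
          using s0 by (auto intro!: derivative_eq_intros simp: w_def e) (simp add: algebra_simps)
      qed
      have "(B has_real_derivative (A' s * w + w * (- \<kappa> / s - L * s powr (- (3 / 2))) * A s)) (at s)"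
        unfolding B_def w_def[symmetric] using DERIV_mult[OF dA[OF s0] dw] by (simp add: w_def)
      moreover have "A' s * w + w * (- \<kappa> / s - L * s powr (- (3 / 2))) * A s
          = w * (A' s - (\<kappa> * A s / s + L * s powr (- (3 / 2)) * A s))"
        by (simp add: algebra_simps)
      moreover have "\<dots> \<le> 0"
        using A'_le[OF s(1)] by (intro mult_nonneg_nonpos) (auto simp: w_def)
      ultimately show "\<exists>y. (B has_real_derivative y) (at s) \<and> y \<le> 0" by metis
    qed
    have A_nonneg: "A s \<ge> 0" if "s \<ge> T" for s
      using bessel_P_energy_compare(2)[OF c _ \<kappa> T[OF that], of "P s" "Q s"] that T1 c
      unfolding A_def by (smt (verit) mult_nonneg_nonneg zero_le_power2)
    have t0: "t > 0" using t T1 by simp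
    have PT: "norm (P T) \<le> D" "norm (Q T) \<le> D"
      unfolding P_def Q_def using \<nu> n1 T1 by (auto intro!: D)
    have AT: "A T \<le> (c + T + (R + 1 / 2)) * D\<^sup>2"
    proof -
      have "\<bar>P T \<bullet> Q T\<bar> \<le> D * D"
        by (rule order_trans[OF Cauchy_Schwarz_ineq2]) (intro mult_mono PT; use D0 in simp)
      then have "\<bar>\<kappa>\<bar> * \<bar>P T \<bullet> Q T\<bar> \<le> (R + 1 / 2) * (D * D)"
        using R by (intro mult_mono \<kappa>) auto
      moreover have "- \<kappa> * (P T \<bullet> Q T) \<le> \<bar>\<kappa>\<bar> * \<bar>P T \<bullet> Q T\<bar>"
        by (metis abs_ge_self abs_minus_cancel abs_mult)
      ultimately have "- \<kappa> * (P T \<bullet> Q T) \<le> (R + 1 / 2) * (D * D)" by linarith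
      moreover have "c * (P T \<bullet> P T) \<le> c * D\<^sup>2" "T * (Q T \<bullet> Q T) \<le> T * D\<^sup>2"
        using PT c T1 by (auto simp flip: power2_norm_eq_inner intro!: mult_left_mono power_mono)
      ultimately show ?thesis unfolding A_def by (simp add: algebra_simps power2_eq_square)
    qed
    have "A t * t powr (- \<kappa>) \<le> B t"
    proof -
      have "1 \<le> exp (2 * L * t powr (- (1 / 2)))" using L0 by simp
      then have "A t * t powr (- \<kappa>) * 1 \<le> A t * t powr (- \<kappa>) * exp (2 * L * t powr (- (1 / 2)))"
        using A_nonneg[OF t] by (intro mult_left_mono) auto
      then show ?thesis by (simp add: B_def)
    qed
    also note \<open>B t \<le> B T\<close>
    also have "B T \<le> E"
    proof -
      have "T powr (- (1 / 2)) \<le> T powr 0" using T1 by (intro powr_mono) auto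
      then have "exp (2 * L * T powr (- (1 / 2))) \<le> exp (2 * L)" using L0 T1 by (simp add: mult_left_le)
      moreover have "T powr (- \<kappa>) \<le> T powr (R + 1 / 2)" using \<kappa> T1 by (intro powr_mono) auto
      ultimately have "B T \<le> ((c + T + (R + 1 / 2)) * D\<^sup>2) * (T powr (R + 1 / 2) * exp (2 * L))"
        unfolding B_def using AT A_nonneg[of T] c T1 R by (intro mult_mono) auto
      then show ?thesis by (simp add: E_def mult_ac)
    qed
    finally have "A t \<le> E * t powr \<kappa>" using t0 by (simp add: powr_minus field_simps)
    moreover have "c * (norm (P t))\<^sup>2 \<le> 2 * A t"
      unfolding A_def by (rule bessel_P_energy_compare(2)[OF c t0 \<kappa> T[OF t]])
    ultimately have "c * (norm (P t))\<^sup>2 \<le> 2 * (E * t powr \<kappa>)" by linarith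
    then show ?thesis by (simp add: P_def \<kappa>_def)
  qed
  \<comment> \<open>The first entry is the energy bound beyond T. On [1, T] the functions are
    bounded by D, and the power of T compensates for t^(Re \<nu>/2 - 1/4), which can be as small as
    T^(-(R/2 + 1/4)).\<close>
  define C where "C = max (sqrt (2 * E / c)) (D * T powr (R / 2 + 1 / 4))"
  have "C > 0" using D0 T1 by (simp add: C_def less_max_iff_disj)
  moreover have "norm (bessel_P c \<nu> t) \<le> C * t powr (Re \<nu> / 2 - 1 / 4)" if \<nu>: "norm \<nu> \<le> R" and t: "t \<ge> 1" for \<nu> t
  proof (cases "t \<ge> T")
    case True
    have "(norm (bessel_P c \<nu> t))\<^sup>2 \<le> 2 * E / c * t powr (Re \<nu> - 1 / 2)"
      using main[OF \<nu> True] c by (simp add: field_simps)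
    then have "norm (bessel_P c \<nu> t) \<le> sqrt (2 * E / c * t powr (Re \<nu> - 1 / 2))"
      by (rule real_le_rsqrt)
    also have "\<dots> = sqrt (2 * E / c) * t powr (Re \<nu> / 2 - 1 / 4)"
    proof -
      have "sqrt (t powr (Re \<nu> - 1 / 2)) = t powr (Re \<nu> / 2 - 1 / 4)"
        using t by (simp add: powr_half_sqrt[symmetric] powr_powr diff_divide_distrib)
      then show ?thesis unfolding real_sqrt_mult by simp
    qed
    also have "\<dots> \<le> C * t powr (Re \<nu> / 2 - 1 / 4)" by (intro mult_right_mono) (auto simp: C_def)
    finally show ?thesis .
  next
    case False
    have Re: "- R \<le> Re \<nu>" using \<nu> abs_Re_le_cmod[of \<nu>] by linarith
    have "T powr (- (R / 2 + 1 / 4)) \<le> t powr (- (R / 2 + 1 / 4))"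
      using False t R by (intro powr_mono2') auto
    also have "\<dots> \<le> t powr (Re \<nu> / 2 - 1 / 4)" using t Re by (intro powr_mono) auto
    finally have "D * T powr (R / 2 + 1 / 4) * T powr (- (R / 2 + 1 / 4))
        \<le> D * T powr (R / 2 + 1 / 4) * t powr (Re \<nu> / 2 - 1 / 4)"
      using D0 by (intro mult_left_mono) auto
    also have "\<dots> \<le> C * t powr (Re \<nu> / 2 - 1 / 4)" by (intro mult_right_mono) (auto simp: C_def)
    finally have calc: "D * T powr (R / 2 + 1 / 4) * T powr (- (R / 2 + 1 / 4))
        \<le> C * t powr (Re \<nu> / 2 - 1 / 4)" .
    have "D \<le> C * t powr (Re \<nu> / 2 - 1 / 4)"
    proof -
      have "T powr (R / 2 + 1 / 4) * T powr (- (R / 2 + 1 / 4)) = 1"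
        unfolding powr_add[symmetric] using T1 by simp
      then have "D * T powr (R / 2 + 1 / 4) * T powr (- (R / 2 + 1 / 4)) = D"
        by (simp only: mult.assoc mult_1_right)
      then show ?thesis using calc by (simp only:)
    qed
    then show ?thesis using D[of \<nu> t] \<nu> False t by simp
  qed
  ultimately show ?thesis by blast
qed

text \<open>One majorant for a whole strip of orders and all t > 0. Near 0 it rests on t^(Re \<nu>)
  <= 1, hence on Re \<nu> >= 0; the bound r >= 1/2 makes the exponent on 1 + t nonnegative, so that
  the majorant stays away from 0 there.\<close>

lemma bessel_P_growth_uniform:
  assumes c: "c > 0" and r: "r \<ge> 1 / 2"
  shows "\<exists>C>0. \<forall>\<nu> t. norm \<nu> \<le> R \<longrightarrow> 0 \<le> Re \<nu> \<longrightarrow> Re \<nu> \<le> r \<longrightarrow> t > 0 \<longrightarrow>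
           norm (bessel_P c \<nu> t) \<le> C * (1 + t) powr (r / 2 - 1 / 4)"
proof -
  obtain C1 where C1: "C1 > 0" "\<And>\<nu> t. norm \<nu> \<le> \<bar>R\<bar> \<Longrightarrow> t \<ge> 1 \<Longrightarrow>
      norm (bessel_P c \<nu> t) \<le> C1 * t powr (Re \<nu> / 2 - 1 / 4)"
    using bessel_P_growth[OF c, of "\<bar>R\<bar>"] by auto
  obtain M where M: "M > 0"
    "\<And>\<nu> t. norm \<nu> \<le> R \<Longrightarrow> t > 0 \<Longrightarrow> norm (bessel_P c \<nu> t) \<le> M * t powr Re \<nu> * exp (c * t)"
    using bessel_P_bound_exp[of c R] c by auto
  have "norm (bessel_P c \<nu> t) \<le> max C1 (M * exp c) * (1 + t) powr (r / 2 - 1 / 4)"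
    if "norm \<nu> \<le> R" "0 \<le> Re \<nu>" "Re \<nu> \<le> r" "t > 0" for \<nu> t
  proof (cases "t \<ge> 1")
    case True
    have "t powr (Re \<nu> / 2 - 1 / 4) \<le> t powr (r / 2 - 1 / 4)" using True that by (intro powr_mono) auto
    also have "\<dots> \<le> (1 + t) powr (r / 2 - 1 / 4)" using True r by (intro powr_mono2) auto
    finally have "C1 * t powr (Re \<nu> / 2 - 1 / 4) \<le> max C1 (M * exp c) * (1 + t) powr (r / 2 - 1 / 4)"
      using C1 by (intro mult_mono) auto
    moreover have "norm \<nu> \<le> \<bar>R\<bar>" using that by simp
    ultimately show ?thesis using C1(2)[of \<nu> t] True by linarith
  next
    case False
    have "t powr Re \<nu> \<le> 1" using that False by (intro powr_le1) auto
    then have "M * t powr Re \<nu> * exp (c * t) \<le> M * 1 * exp c"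
      using M(1) c False that by (intro mult_mono) auto
    also have "\<dots> \<le> max C1 (M * exp c) * 1" by simp
    also have "\<dots> \<le> max C1 (M * exp c) * (1 + t) powr (r / 2 - 1 / 4)"
      using that r C1 by (intro mult_left_mono ge_one_powr_ge_zero) auto
    finally show ?thesis using M(2)[of \<nu> t] that by simp
  qed
  then show ?thesis using C1(1) by (meson less_max_iff_disj)
qed

subsection \<open>Improper and Cesaro integrals\<close>

text \<open>Past a point \<open>B\<close> the integrand is within e/2 of \<open>v\<close>, and the
  contribution of [0, B] is a constant divided by T.\<close>

lemma cesaro_mean_tendsto:
  fixes r :: "real \<Rightarrow> 'a::banach"
  assumes cont: "continuous_on {0..} r" and lim: "(r \<longlongrightarrow> v) at_top"
  shows "((\<lambda>T. (1 / T) *\<^sub>R integral {0..T} r) \<longlongrightarrow> v) at_top"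
proof (rule tendstoI)
  fix e :: real assume e: "e > 0"
  have int: "r integrable_on {a..b}" "(\<lambda>s. r s - v) integrable_on {a..b}" if "0 \<le> a" for a b
    using that by (auto intro!: integrable_continuous_interval continuous_intros
        continuous_on_subset[OF cont])
  obtain B0 where B0: "\<And>s. s \<ge> B0 \<Longrightarrow> dist (r s) v < e / 2"
    using tendstoD[OF lim, of "e / 2"] e by (auto simp: eventually_at_top_linorder)
  define B where "B = max B0 1"
  have B: "B > 0" "\<And>s. s \<ge> B \<Longrightarrow> norm (r s - v) \<le> e / 2"
    using B0 by (auto simp: B_def dist_norm less_imp_le)
  define K where "K = norm (integral {0..B} (\<lambda>s. r s - v))"
  have "dist ((1 / T) *\<^sub>R integral {0..T} r) v < e" if T: "T > B" "T > 2 * K / e" for T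
  proof -
    have T0: "T > 0" using T B by linarith
    have "integral {0..T} (\<lambda>s. r s - v) = integral {0..T} r - T *\<^sub>R v"
      using T0 int(1)[of 0 T] by (subst integral_diff) auto
    then have eq: "(1 / T) *\<^sub>R integral {0..T} r - v = (1 / T) *\<^sub>R integral {0..T} (\<lambda>s. r s - v)"
      using T0 by (simp add: scaleR_diff_right)
    have "integral {0..T} (\<lambda>s. r s - v) =
          integral {0..B} (\<lambda>s. r s - v) + integral {B..T} (\<lambda>s. r s - v)"
      using T B
      by (intro Henstock_Kurzweil_Integration.integral_combine[symmetric, OF _ _ int(2)]) auto
    moreover have "norm (integral {B..T} (\<lambda>s. r s - v)) \<le> (e / 2) * (T - B)"
      by (rule integral_bound) (use B T in \<open>auto intro!: continuous_intros continuous_on_subset[OF cont]\<close>)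
    ultimately have "norm (integral {0..T} (\<lambda>s. r s - v)) \<le> K + (e / 2) * (T - B)"
      unfolding K_def by (metis add_left_mono norm_triangle_le)
    moreover have "K < (e / 2) * T" using T(2) e by (simp add: field_simps)
    moreover have "(e / 2) * (T - B) \<le> (e / 2) * T" using B e by simp
    ultimately have "norm (integral {0..T} (\<lambda>s. r s - v)) < e * T"
      by (simp add: field_simps)
    then show ?thesis
      unfolding dist_norm eq using T0 by (simp add: field_simps)
  qed
  then show "\<forall>\<^sub>F T in at_top. dist ((1 / T) *\<^sub>R integral {0..T} r) v < e"
    by (intro eventually_mono[OF eventually_gt_at_top[of "max B (2 * K / e)"]]) auto
qed

text \<open>One direction of Hake's theorem: the gauge integral over the half-line needs only
  convergence of the integrals over [0, T], so conditionally convergent integrals are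
  included.\<close>

lemma has_integral_halflineI:
  fixes f :: "real \<Rightarrow> 'a::banach"
  assumes int: "\<And>T. T > 0 \<Longrightarrow> f integrable_on {0..T}"
    and lim: "((\<lambda>T. integral {0..T} f) \<longlongrightarrow> v) at_top"
  shows "(f has_integral v) {0..}"
  unfolding has_integral_alt'
proof (intro conjI allI impI)
  fix a b :: real
  have "f integrable_on {0..max b 1}" by (rule int) auto
  then have "f integrable_on {max 0 a..b}"
    by (rule integrable_on_subinterval) auto
  moreover have "{0..} \<inter> {a..b} = {max 0 a..b}" by auto
  ultimately show "(\<lambda>x. if x \<in> {0..} then f x else 0) integrable_on cbox a b"
    using integrable_restrict_Int[of "{0..}" f "{a..b}"] by simp
next
  fix e :: real assume "e > 0"
  then obtain B where B: "\<And>T. T \<ge> B \<Longrightarrow> norm (integral {0..T} f - v) < e"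
    using tendstoD[OF lim] by (auto simp: eventually_at_top_linorder dist_norm)
  show "\<exists>B>0. \<forall>a b. ball 0 B \<subseteq> cbox a b \<longrightarrow>
      norm (integral (cbox a b) (\<lambda>x. if x \<in> {0..} then f x else 0) - v) < e"
  proof (intro exI conjI allI impI)
    show "\<bar>B\<bar> + 1 > 0" by simp
    fix a b :: real assume sub: "ball 0 (\<bar>B\<bar> + 1) \<subseteq> cbox a b"
    have "0 \<in> cbox a b" "\<bar>B\<bar> \<in> cbox a b" by (rule subsetD[OF sub]; simp)+
    then have ab: "a \<le> 0" "\<bar>B\<bar> \<le> b" by auto
    then have "{0..} \<inter> {a..b} = {0..b}" by (auto simp: max_def)
    then have "integral (cbox a b) (\<lambda>x. if x \<in> {0..} then f x else 0) = integral {0..b} f"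
      using integral_restrict_Int[of "{a..b}" "{0..}" f] by (simp only: Int_commute interval_cbox)
    then show "norm (integral (cbox a b) (\<lambda>x. if x \<in> {0..} then f x else 0) - v) < e"
      using B[of b] ab by simp
  qed
qed

lemma integral_halfline_tendsto:
  fixes f :: "real \<Rightarrow> 'a::euclidean_space"
  assumes f: "integrable halfline f"
  shows "((\<lambda>T. integral {0..T} f) \<longlongrightarrow> integral\<^sup>L halfline f) at_top"
proof -
  define g where "g = (\<lambda>t. indicator {0<..} t *\<^sub>R f t)"
  have g: "integrable lborel g"
    using f unfolding integrable_halfline_iff set_integrable_def g_def .
  have "((\<lambda>y. \<integral>x. indicator {..y} x *\<^sub>R g x \<partial>lborel) \<longlongrightarrow> (\<integral>x. g x \<partial>lborel)) at_top"
    by (rule tendsto_integral_at_top[OF _ g]) simp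
  moreover have "(\<integral>x. g x \<partial>lborel) = integral\<^sup>L halfline f"
    by (simp add: integral_halfline_eq g_def set_lebesgue_integral_def)
  moreover have "(\<integral>x. indicator {..y} x *\<^sub>R g x \<partial>lborel) = integral {0..y} f" for y
  proof -
    have "indicator {..y} x *\<^sub>R g x = indicator {0<..y} x *\<^sub>R f x" for x
      by (auto simp: g_def indicator_def)
    then have "(\<integral>x. indicator {..y} x *\<^sub>R g x \<partial>lborel) = set_lebesgue_integral lborel {0<..y} f"
      by (simp add: set_lebesgue_integral_def)
    also have "\<dots> = integral {0<..y} f"
      using set_integrable_subset[of lborel "{0<..}" f "{0<..y}"] f
      unfolding integrable_halfline_iff
      by (intro set_borel_integral_eq_integral(2)) (auto simp: greaterThanAtMost_def)
    also have "\<dots> = integral {0..y} f"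
      by (rule integral_spike_set) (rule negligible_subset[of "{0}"]; auto)+
    finally show ?thesis .
  qed
  ultimately show ?thesis by simp
qed

subsection \<open>The regularised Stieltjes transform\<close>

text \<open>For w near z the distance |t - w| is at least some h > 0, and t <= |t - w| + |w|. Hence
  1 + t <= |t - w| + (1 + |z| + h), where the bracket is at most |t - w| / h times itself.\<close>

lemma nonneg_Reals_dist_bound:
  fixes z :: complex
  assumes "z \<notin> \<real>\<^sub>\<ge>\<^sub>0"
  shows "\<exists>d>0. \<exists>r>0. \<forall>w\<in>ball z r. \<forall>t\<ge>0. d * (1 + t) \<le> norm (of_real t - w)"
proof -
  have op: "open (- (\<real>\<^sub>\<ge>\<^sub>0 :: complex set))" by (simp add: open_Compl)
  obtain \<delta> where \<delta>: "\<delta> > 0" "ball z \<delta> \<subseteq> - \<real>\<^sub>\<ge>\<^sub>0"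
    using iffD1[OF open_contains_ball op] assms by blast
  define h where "h = \<delta> / 2"
  have h: "h > 0" using \<delta> by (simp add: h_def)
  define m where "m = 1 + (1 + norm z + h) / h"
  have m: "m > 0" using h by (auto simp: m_def intro!: add_pos_nonneg)
  have "1 / m * (1 + t) \<le> norm (of_real t - w)" if w: "w \<in> ball z h" and t: "t \<ge> 0" for w t
  proof -
    define n where "n = norm (of_real t - w)"
    have "of_real t \<notin> ball z \<delta>" using \<delta>(2) t by (auto simp: subset_iff)
    then have "\<delta> \<le> dist z (of_real t)" by simp
    also have "\<dots> \<le> dist z w + dist w (of_real t)" by (rule dist_triangle)
    also have "dist z w < h" using w by simp
    finally have nh: "h \<le> n" by (simp add: n_def h_def dist_norm norm_minus_commute)
    have "norm w \<le> norm z + h"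
      using w norm_triangle_ineq4[of z "z - w"] by (simp add: dist_norm)
    moreover have "t \<le> n + norm w"
      using norm_triangle_ineq[of "of_real t - w" w] t by (simp add: n_def)
    ultimately have "1 + t \<le> n + (1 + norm z + h) * 1" by simp
    also have "\<dots> \<le> n + (1 + norm z + h) * (n / h)"
      using nh h by (intro add_left_mono mult_left_mono) (auto simp: field_simps)
    also have "\<dots> = n * m" by (simp add: m_def field_simps)
    finally show ?thesis using m by (simp add: n_def field_simps)
  qed
  with h m show ?thesis by (intro exI[of _ "1 / m"] conjI exI[of _ h]) auto
qed

lemma nonneg_Reals_neq: "z \<notin> \<real>\<^sub>\<ge>\<^sub>0 \<Longrightarrow> t \<ge> 0 \<Longrightarrow> complex_of_real t - z \<noteq> 0"
  by auto

text \<open>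
  The integral of \<open>bessel_P c \<alpha> t / (of_real t - z)\<close> after two integrations by parts with the
  boundary terms at infinity dropped.
\<close>

definition bessel_stieltjes :: "real \<Rightarrow> complex \<Rightarrow> complex \<Rightarrow> complex" where
  "bessel_stieltjes c \<alpha> z =
     integral\<^sup>L halfline (\<lambda>t. 2 * bessel_P c (\<alpha> + 2) t / (of_real t - z) ^ 3)"

lemma measurable_bessel_P_quotient:
  assumes "z \<notin> \<real>\<^sub>\<ge>\<^sub>0"
  shows "(\<lambda>t. 2 * bessel_P c \<nu> t / (of_real t - z) ^ n) \<in> borel_measurable halfline"
  using nonneg_Reals_neq[OF assms]
  by (intro measurable_halfline continuous_intros continuous_on_bessel_P) auto

text \<open>The majorant holds for order and point varying together, so it yields both holomorphy in
  \<alpha> and holomorphy in z.\<close>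

lemma bessel_stieltjes_dominated:
  assumes c: "c > 0" and \<alpha>: "-1 < Re \<alpha>" "Re \<alpha> < 5 / 2" and z: "z \<notin> \<real>\<^sub>\<ge>\<^sub>0"
  shows "\<exists>r>0. \<exists>g. integrable halfline g \<and> (\<forall>\<beta>\<in>ball \<alpha> r. \<forall>w\<in>ball z r. \<forall>t>0.
           norm (2 * bessel_P c (\<beta> + 2) t / (of_real t - w) ^ 3) \<le> g t)"
proof -
  obtain d s where d: "d > 0" and s: "s > 0"
    and ds: "\<And>w t. w \<in> ball z s \<Longrightarrow> t \<ge> 0 \<Longrightarrow> d * (1 + t) \<le> norm (of_real t - w)"
    using nonneg_Reals_dist_bound[OF z] by blast
  \<comment> \<open>The three entries keep w in the range of the distance bound, Re \<beta> + 2
    nonnegative, and Re \<beta> + 2 below \<rho>.\<close>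
  define r where "r = min s (min (Re \<alpha> + 1) ((5 / 2 - Re \<alpha>) / 2))"
  have r: "r > 0" using s \<alpha> by (simp add: r_def)
  \<comment> \<open>The midpoint of Re \<alpha> + 2 and 9/2. The value 9/2 is critical: growth with
    exponent \<rho>/2 - 1/4 against a kernel of order -3 leaves the exponent -p with p = 13/4 -
    \<rho>/2, and p > 1 means \<rho> < 9/2.\<close>
  define \<rho> where "\<rho> = Re \<alpha> / 2 + 13 / 4"
  have \<rho>: "\<rho> \<ge> 1 / 2" "\<rho> < 9 / 2" using \<alpha> by (auto simp: \<rho>_def)
  obtain C where C: "C > 0" "\<And>\<nu> t. norm \<nu> \<le> norm \<alpha> + r + 2 \<Longrightarrow> 0 \<le> Re \<nu> \<Longrightarrow> Re \<nu> \<le> \<rho> \<Longrightarrow> t > 0 \<Longrightarrow>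
           norm (bessel_P c \<nu> t) \<le> C * (1 + t) powr (\<rho> / 2 - 1 / 4)"
    using bessel_P_growth_uniform[OF c \<rho>(1), of "norm \<alpha> + r + 2"] by blast
  define p where "p = 13 / 4 - \<rho> / 2"
  have p: "p > 1" using \<rho> by (simp add: p_def)
  define g where "g = (\<lambda>t. 2 * C / d ^ 3 * (1 + t) powr (- p))"
  have "integrable halfline g"
    unfolding g_def by (intro integrable_mult_right integrable_halfline_powr p)
  moreover have "norm (2 * bessel_P c (\<beta> + 2) t / (of_real t - w) ^ 3) \<le> g t"
    if \<beta>: "\<beta> \<in> ball \<alpha> r" and w: "w \<in> ball z r" and t: "t > 0" for \<beta> w t
  proof -
    have n: "norm (\<beta> - \<alpha>) < r" using \<beta> by (simp add: dist_norm norm_minus_commute)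
    then have Re: "\<bar>Re \<beta> - Re \<alpha>\<bar> < r" using abs_Re_le_cmod[of "\<beta> - \<alpha>"] by simp
    have "norm (\<beta> + 2) \<le> norm \<alpha> + norm (\<beta> - \<alpha>) + 2"
      using norm_triangle_ineq[of \<alpha> "\<beta> - \<alpha>"] norm_triangle_ineq[of \<beta> 2] by simp
    then have nb: "norm (\<beta> + 2) \<le> norm \<alpha> + r + 2" using n by simp
    have re: "0 \<le> Re (\<beta> + 2)" "Re (\<beta> + 2) \<le> \<rho>"
      using Re \<alpha> unfolding r_def \<rho>_def by (auto simp: abs_less_iff min_def split: if_splits)
    have P: "norm (bessel_P c (\<beta> + 2) t) \<le> C * (1 + t) powr (\<rho> / 2 - 1 / 4)"
      by (rule C(2)[OF nb re t])
    have D: "d * (1 + t) \<le> norm (of_real t - w)" using w t by (intro ds) (auto simp: r_def)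
    have "norm (2 * bessel_P c (\<beta> + 2) t / (of_real t - w) ^ 3) =
        2 * norm (bessel_P c (\<beta> + 2) t) / norm (of_real t - w) ^ 3"
      by (simp add: norm_mult norm_divide norm_power)
    also have "\<dots> \<le> 2 * (C * (1 + t) powr (\<rho> / 2 - 1 / 4)) / (d * (1 + t)) ^ 3"
      using P D d t C by (intro frac_le power_mono) auto
    also have "\<dots> = 2 * C / d ^ 3 * ((1 + t) powr (\<rho> / 2 - 1 / 4) / (1 + t) ^ 3)"
      by (simp add: power_mult_distrib)
    also have "(1 + t) powr (\<rho> / 2 - 1 / 4) / (1 + t) ^ 3 = (1 + t) powr (- p)"
      using t powr_realpow[of "1 + t" 3] by (simp add: p_def powr_diff[symmetric] flip: powr_numeral)
    finally show ?thesis by (simp add: g_def)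
  qed
  ultimately show ?thesis using r by blast
qed

lemma integrable_bessel_stieltjes:
  assumes "c > 0" "-1 < Re \<alpha>" "Re \<alpha> < 5 / 2" "z \<notin> \<real>\<^sub>\<ge>\<^sub>0"
  shows "integrable halfline (\<lambda>t. 2 * bessel_P c (\<alpha> + 2) t / (of_real t - z) ^ 3)"
proof -
  obtain g where g: "integrable halfline g"
    "\<And>t. t > 0 \<Longrightarrow> norm (2 * bessel_P c (\<alpha> + 2) t / (of_real t - z) ^ 3) \<le> g t"
    using bessel_stieltjes_dominated[OF assms] by (metis centre_in_ball)
  show ?thesis
    by (rule integrable_halfline_bound[OF g(1) measurable_bessel_P_quotient[OF assms(4)] g(2)])
qed

lemma open_strip: "open {\<alpha>. -1 < Re \<alpha> \<and> Re \<alpha> < 5 / 2}"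
  by (intro open_Collect_conj open_Collect_less continuous_intros)

lemma bessel_stieltjes_holomorphic_order:
  assumes "c > 0" "z \<notin> \<real>\<^sub>\<ge>\<^sub>0"
  shows "(\<lambda>\<alpha>. bessel_stieltjes c \<alpha> z) holomorphic_on {\<alpha>. -1 < Re \<alpha> \<and> Re \<alpha> < 5 / 2}"
  unfolding bessel_stieltjes_def
proof (rule holomorphic_on_integral[OF open_strip])
  show "(\<lambda>\<alpha>. 2 * bessel_P c (\<alpha> + 2) t / (of_real t - z) ^ 3) holomorphic_on
      {\<alpha>. -1 < Re \<alpha> \<and> Re \<alpha> < 5 / 2}" if "t \<in> space halfline" for t
  proof -
    have "((\<lambda>\<nu>. bessel_P c \<nu> t) \<circ> (\<lambda>\<alpha>. \<alpha> + 2)) holomorphic_on {\<alpha>. -1 < Re \<alpha> \<and> Re \<alpha> < 5 / 2}"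
      using that by (intro holomorphic_on_compose bessel_P_holomorphic_order holomorphic_intros) auto
    then show ?thesis
      using nonneg_Reals_neq[OF assms(2), of t] that by (auto intro!: holomorphic_intros simp: o_def)
  qed
  show "\<exists>r>0. \<exists>g. integrable halfline g \<and> (\<forall>\<beta>\<in>ball \<alpha> r \<inter> {\<alpha>. -1 < Re \<alpha> \<and> Re \<alpha> < 5 / 2}.
      \<forall>t\<in>space halfline. norm (2 * bessel_P c (\<beta> + 2) t / (of_real t - z) ^ 3) \<le> g t)"
    if "\<alpha> \<in> {\<alpha>. -1 < Re \<alpha> \<and> Re \<alpha> < 5 / 2}" for \<alpha>
    using bessel_stieltjes_dominated[OF assms(1) _ _ assms(2), of \<alpha>] that
    by (metis (no_types, lifting) IntD1 centre_in_ball greaterThan_iff mem_Collect_eq space_halfline)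
qed (rule measurable_bessel_P_quotient[OF assms(2)])

lemma bessel_stieltjes_holomorphic:
  assumes "c > 0" "-1 < Re \<alpha>" "Re \<alpha> < 5 / 2"
  shows "bessel_stieltjes c \<alpha> holomorphic_on - \<real>\<^sub>\<ge>\<^sub>0"
  unfolding bessel_stieltjes_def[abs_def]
proof (rule holomorphic_on_integral)
  show "open (- (\<real>\<^sub>\<ge>\<^sub>0 :: complex set))" by (simp add: open_Compl)
  show "(\<lambda>z. 2 * bessel_P c (\<alpha> + 2) t / (of_real t - z) ^ 3) holomorphic_on - \<real>\<^sub>\<ge>\<^sub>0"
    if "t \<in> space halfline" for t
    using that nonneg_Reals_neq[of _ t] by (intro holomorphic_intros) auto
  show "\<exists>r>0. \<exists>g. integrable halfline g \<and> (\<forall>w\<in>ball z r \<inter> - \<real>\<^sub>\<ge>\<^sub>0.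
      \<forall>t\<in>space halfline. norm (2 * bessel_P c (\<alpha> + 2) t / (of_real t - w) ^ 3) \<le> g t)"
    if "z \<in> - \<real>\<^sub>\<ge>\<^sub>0" for z
    using bessel_stieltjes_dominated[OF assms, of z] that
    by (metis (no_types, lifting) ComplD IntD1 centre_in_ball greaterThan_iff space_halfline)
  show "(\<lambda>t. 2 * bessel_P c (\<alpha> + 2) t / (of_real t - z) ^ 3) \<in> borel_measurable halfline"
    if "z \<in> - \<real>\<^sub>\<ge>\<^sub>0" for z
    using that by (intro measurable_bessel_P_quotient) auto
qed

subsection \<open>Integration by parts\<close>

text \<open>The integrand is the derivative of P_(\<nu>+1)(t) / (t - z)^n. The boundary term at 0
  vanishes because Re \<nu> > -1 puts the raised order in the range where P tends to 0.\<close>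

lemma bessel_P_parts:
  assumes c: "c > 0" and \<nu>: "Re \<nu> > -1" and z: "z \<notin> \<real>\<^sub>\<ge>\<^sub>0" and T: "T \<ge> 0"
  shows "((\<lambda>t. bessel_P c \<nu> t / (of_real t - z) ^ n
            - of_nat n * bessel_P c (\<nu> + 1) t / (of_real t - z) ^ Suc n)
          has_integral bessel_P c (\<nu> + 1) T / (of_real T - z) ^ n) {0..T}"
proof -
  note nz = nonneg_Reals_neq[OF z]
  define f where "f = (\<lambda>t. bessel_P c (\<nu> + 1) t * (1 / (of_real t - z) ^ n))"
  have "((\<lambda>t. bessel_P c (\<nu> + 1) t * (- of_nat n / (of_real t - z) ^ Suc n)
      + bessel_P c \<nu> t * (1 / (of_real t - z) ^ n)) has_integral (f T - f 0)) {0..T}"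
  \<comment> \<open>Differentiability is used in the open interval only, since P_\<nu> may be
    unbounded at 0.\<close>
  proof (rule fundamental_theorem_of_calculus_interior[OF T])
    show "continuous_on {0..T} f"
      unfolding f_def using c \<nu> nz
      by (intro continuous_intros continuous_on_subset[OF continuous_on_bessel_P_0]) auto
    fix t assume t: "t \<in> {0<..<T}"
    have 1: "(bessel_P c (\<nu> + 1) has_vector_derivative bessel_P c \<nu> t) (at t)"
      using bessel_P_deriv[of t c "\<nu> + 1"] t by simp
    have "((\<lambda>w. 1 / (w - z) ^ n) has_field_derivative - of_nat n / (of_real t - z) ^ Suc n) (at (of_real t))"
    proof -
      have "of_real t - z \<noteq> 0" using nz t by auto
      then show ?thesis
      proof (cases n)
        case (Suc m)
        have x: "- (of_nat (Suc m) * x ^ m) / (x ^ Suc m * x ^ Suc m) = - of_nat (Suc m) / x ^ Suc (Suc m)"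
          if "x \<noteq> 0" for x :: complex
          using that by (simp add: field_simps del: of_nat_Suc)
        have "((\<lambda>w. 1 / (w - z) ^ Suc m) has_field_derivative
            - (of_nat (Suc m) * (of_real t - z) ^ m) / ((of_real t - z) ^ Suc m * (of_real t - z) ^ Suc m))
            (at (of_real t))"
          using \<open>of_real t - z \<noteq> 0\<close>
          by (auto intro!: derivative_eq_intros simp del: of_nat_Suc power_Suc)
        then show ?thesis unfolding Suc x[OF \<open>of_real t - z \<noteq> 0\<close>] .
      qed auto
    qed
    then have 2: "((\<lambda>t. 1 / (of_real t - z) ^ n) has_vector_derivative - of_nat n / (of_real t - z) ^ Suc n) (at t)"
      using has_vector_derivative_real_field by fastforce
    show "(f has_vector_derivative bessel_P c (\<nu> + 1) t * (- of_nat n / (of_real t - z) ^ Suc n)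
      + bessel_P c \<nu> t * (1 / (of_real t - z) ^ n)) (at t)"
      unfolding f_def by (rule has_vector_derivative_mult[OF 1 2])
  qed
  moreover have "bessel_P c (\<nu> + 1) t * (- of_nat n / (of_real t - z) ^ Suc n)
      + bessel_P c \<nu> t * (1 / (of_real t - z) ^ n) = bessel_P c \<nu> t / (of_real t - z) ^ n
            - of_nat n * bessel_P c (\<nu> + 1) t / (of_real t - z) ^ Suc n" for t
    by simp
  ultimately show ?thesis by (simp add: f_def mult.commute)
qed

text \<open>The singularity at 0 is at worst t^(Re \<nu>), integrable for Re \<nu> > -1, and the
  denominator stays away from 0.\<close>

lemma bessel_P_quotient_absolutely_integrable:
  assumes c: "c > 0" and \<nu>: "Re \<nu> > -1" and z: "z \<notin> \<real>\<^sub>\<ge>\<^sub>0" and T: "T > 0"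
  shows "(\<lambda>t. bessel_P c \<nu> t / (of_real t - z) ^ n) absolutely_integrable_on {0..T}"
proof -
  obtain M where M: "M > 0" "\<And>t. t > 0 \<Longrightarrow> norm (bessel_P c \<nu> t) \<le> M * t powr Re \<nu> * exp (c * t)"
    using bessel_P_bound_exp[of c "norm \<nu>"] c by auto
  obtain d where d: "d > 0" "\<And>t. t \<ge> 0 \<Longrightarrow> d * (1 + t) \<le> norm (of_real t - z)"
    using nonneg_Reals_dist_bound[OF z] by (metis centre_in_ball)
  define g where "g = (\<lambda>t. M * exp (c * T) / d ^ n * t powr Re \<nu>)"
  have bound: "norm (bessel_P c \<nu> t / (of_real t - z) ^ n) \<le> g t" if t: "t \<in> {0<..T}" for t
  proof -
    have "d \<le> d * (1 + t)" using d t by simp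
    then have "d \<le> norm (of_real t - z)" using d(2)[of t] t by simp
    moreover have "norm (bessel_P c \<nu> t) \<le> M * t powr Re \<nu> * exp (c * T)"
    proof (rule order_trans[OF M(2)])
      show "M * t powr Re \<nu> * exp (c * t) \<le> M * t powr Re \<nu> * exp (c * T)"
        using t c M by (intro mult_left_mono) auto
    qed (use t in auto)
    ultimately have "norm (bessel_P c \<nu> t) / norm (of_real t - z) ^ n \<le> M * t powr Re \<nu> * exp (c * T) / d ^ n"
      using d M by (intro frac_le power_mono) auto
    then show ?thesis by (simp add: g_def norm_divide norm_power mult_ac)
  qed
  have g: "g integrable_on {0<..T}"
    unfolding g_def using integrable_on_powr_from_0'[OF \<nu>, of T] T
    by (intro integrable_on_mult_right) auto
  have "continuous_on {0<..T} (\<lambda>t. bessel_P c \<nu> t / (of_real t - z) ^ n)"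
    using nonneg_Reals_neq[OF z]
    by (intro continuous_intros continuous_on_subset[OF continuous_on_bessel_P]) auto
  then have "(\<lambda>t. bessel_P c \<nu> t / (of_real t - z) ^ n) \<in> borel_measurable (lebesgue_on {0<..T})"
    by (rule continuous_imp_measurable_on_sets_lebesgue) auto
  then have "(\<lambda>t. bessel_P c \<nu> t / (of_real t - z) ^ n) integrable_on {0<..T}"
    by (rule measurable_bounded_by_integrable_imp_integrable[OF _ g bound]) auto
  then have "(\<lambda>t. bessel_P c \<nu> t / (of_real t - z) ^ n) absolutely_integrable_on {0<..T}"
    using absolutely_integrable_integrable_bound[OF bound _ g] by blast
  then show ?thesis
    by (rule absolutely_integrable_spike_set) (rule negligible_subset[of "{0}"]; force)+
qed

lemma bessel_P_quotient_parts:
  assumes "c > 0" "Re \<nu> > -1" "z \<notin> \<real>\<^sub>\<ge>\<^sub>0" "T > 0"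
  shows "integral {0..T} (\<lambda>t. bessel_P c \<nu> t / (of_real t - z) ^ n) =
     bessel_P c (\<nu> + 1) T / (of_real T - z) ^ n
     + of_nat n * integral {0..T} (\<lambda>t. bessel_P c (\<nu> + 1) t / (of_real t - z) ^ Suc n)"
proof -
  have i1: "(\<lambda>t. bessel_P c \<nu> t / (of_real t - z) ^ n) integrable_on {0..T}"
    using bessel_P_quotient_absolutely_integrable[OF assms]
    by (rule set_lebesgue_integral_eq_integral(1))
  have i2: "(\<lambda>t. bessel_P c (\<nu> + 1) t / (of_real t - z) ^ Suc n) integrable_on {0..T}"
    using bessel_P_quotient_absolutely_integrable[OF assms(1) _ assms(3,4), of "\<nu> + 1" "Suc n"] assms(2)
    by (intro set_lebesgue_integral_eq_integral(1)) auto
  have "bessel_P c (\<nu> + 1) T / (of_real T - z) ^ n = integral {0..T}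
     (\<lambda>t. bessel_P c \<nu> t / (of_real t - z) ^ n
       - of_nat n * (bessel_P c (\<nu> + 1) t / (of_real t - z) ^ Suc n))"
    using integral_unique[OF bessel_P_parts[OF assms(1-3), of T n]] assms(4) by simp
  also have "\<dots> = integral {0..T} (\<lambda>t. bessel_P c \<nu> t / (of_real t - z) ^ n)
      - of_nat n * integral {0..T} (\<lambda>t. bessel_P c (\<nu> + 1) t / (of_real t - z) ^ Suc n)"
    by (subst integral_diff[OF i1 integrable_on_mult_right[OF i2]]) (simp only: integral_mult_right)
  finally show ?thesis by simp
qed

text \<open>The exponent condition is the source of both thresholds: order \<alpha> + 1 with n = 1
  means Re \<alpha> < 3/2, and order \<alpha> + 2 with n = 2 means Re \<alpha> < 5/2.\<close>

lemma bessel_P_quotient_tendsto_0: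
  assumes c: "c > 0" and z: "z \<notin> \<real>\<^sub>\<ge>\<^sub>0" and n: "Re \<nu> / 2 - 1 / 4 < real n"
  shows "((\<lambda>T. bessel_P c \<nu> T / (of_real T - z) ^ n) \<longlongrightarrow> 0) at_top"
proof -
  obtain C where C: "C > 0" "\<And>t. t \<ge> 1 \<Longrightarrow> norm (bessel_P c \<nu> t) \<le> C * t powr (Re \<nu> / 2 - 1 / 4)"
    using bessel_P_growth[OF c, of "norm \<nu>"] by auto
  obtain d where d: "d > 0" "\<And>t. t \<ge> 0 \<Longrightarrow> d * (1 + t) \<le> norm (of_real t - z)"
    using nonneg_Reals_dist_bound[OF z] by (metis centre_in_ball)
  have "((\<lambda>T. C / d ^ n * T powr (Re \<nu> / 2 - 1 / 4 - n)) \<longlongrightarrow> C / d ^ n * 0) at_top"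
    using n by (intro tendsto_intros tendsto_neg_powr filterlim_ident) auto
  then have "((\<lambda>T. C / d ^ n * T powr (Re \<nu> / 2 - 1 / 4 - n)) \<longlongrightarrow> 0) at_top" by simp
  then show ?thesis
  proof (rule Lim_null_comparison[rotated])
    show "\<forall>\<^sub>F T in at_top. norm (bessel_P c \<nu> T / (of_real T - z) ^ n) \<le> C / d ^ n * T powr (Re \<nu> / 2 - 1 / 4 - n)"
    proof (rule eventually_mono[OF eventually_ge_at_top[of 1]])
      fix T :: real assume T: "T \<ge> 1"
      have "d * T \<le> d * (1 + T)" using d by simp
      then have dT: "d * T \<le> norm (of_real T - z)" using d(2)[of T] T by simp
      have "norm (bessel_P c \<nu> T / (of_real T - z) ^ n) = norm (bessel_P c \<nu> T) / norm (of_real T - z) ^ n"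
        by (simp add: norm_divide norm_power)
      also have "\<dots> \<le> C * T powr (Re \<nu> / 2 - 1 / 4) / (d * T) ^ n"
        using C T d dT by (intro frac_le power_mono) auto
      also have "\<dots> = C / d ^ n * T powr (Re \<nu> / 2 - 1 / 4 - n)"
        using T by (simp add: powr_diff powr_realpow power_mult_distrib)
      finally show "norm (bessel_P c \<nu> T / (of_real T - z) ^ n) \<le> C / d ^ n * T powr (Re \<nu> / 2 - 1 / 4 - n)" .
    qed
  qed
qed

lemma bessel_P_stieltjes_parts_tendsto:
  assumes c: "c > 0" and \<alpha>: "-1 < Re \<alpha>" "Re \<alpha> < 5 / 2" and z: "z \<notin> \<real>\<^sub>\<ge>\<^sub>0"
  shows "((\<lambda>T. integral {0..T} (\<lambda>t. bessel_P c (\<alpha> + 1) t / (of_real t - z)\<^sup>2))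
           \<longlongrightarrow> bessel_stieltjes c \<alpha> z) at_top"
proof -
  have "((\<lambda>T. bessel_P c (\<alpha> + 2) T / (of_real T - z)\<^sup>2
      + integral {0..T} (\<lambda>t. 2 * bessel_P c (\<alpha> + 2) t / (of_real t - z) ^ 3))
      \<longlongrightarrow> 0 + bessel_stieltjes c \<alpha> z) at_top"
    unfolding bessel_stieltjes_def
    by (intro tendsto_add integral_halfline_tendsto integrable_bessel_stieltjes[OF assms]
        bessel_P_quotient_tendsto_0[OF c z]) (use \<alpha> in \<open>auto simp: field_simps\<close>)
  moreover have "\<forall>\<^sub>F T in at_top. bessel_P c (\<alpha> + 2) T / (of_real T - z)\<^sup>2
      + integral {0..T} (\<lambda>t. 2 * bessel_P c (\<alpha> + 2) t / (of_real t - z) ^ 3)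
      = integral {0..T} (\<lambda>t. bessel_P c (\<alpha> + 1) t / (of_real t - z)\<^sup>2)"
  proof (rule eventually_mono[OF eventually_gt_at_top[of 0]])
    fix T :: real assume T: "T > 0"
    have "integral {0..T} (\<lambda>t. 2 * bessel_P c (\<alpha> + 2) t / (of_real t - z) ^ 3) =
        2 * integral {0..T} (\<lambda>t. bessel_P c (\<alpha> + 2) t / (of_real t - z) ^ 3)"
      unfolding times_divide_eq_right[symmetric] by (rule integral_mult_right)
    then show "bessel_P c (\<alpha> + 2) T / (of_real T - z)\<^sup>2
      + integral {0..T} (\<lambda>t. 2 * bessel_P c (\<alpha> + 2) t / (of_real t - z) ^ 3)
      = integral {0..T} (\<lambda>t. bessel_P c (\<alpha> + 1) t / (of_real t - z)\<^sup>2)"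
      using bessel_P_quotient_parts[OF c _ z T, of "\<alpha> + 1" 2] \<alpha>
      by (simp add: eval_nat_numeral add.assoc)
  qed
  ultimately show ?thesis by (simp add: tendsto_cong)
qed

text \<open>Only the boundary term of the first integration by parts restricts \<alpha> to Re
  \<alpha> < 3/2; what remains converges in the whole strip.\<close>

lemma bessel_P_stieltjes_improper:
  assumes c: "c > 0" and \<alpha>: "-1 < Re \<alpha>" "Re \<alpha> < 3 / 2" and z: "z \<notin> \<real>\<^sub>\<ge>\<^sub>0"
  shows "((\<lambda>t. bessel_P c \<alpha> t / (of_real t - z)) has_integral bessel_stieltjes c \<alpha> z) {0..}"
proof (rule has_integral_halflineI)
  show "(\<lambda>t. bessel_P c \<alpha> t / (of_real t - z)) integrable_on {0..T}" if "T > 0" for T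
    using bessel_P_quotient_absolutely_integrable[OF c \<alpha>(1) z that, of 1]
    by (auto dest: set_lebesgue_integral_eq_integral(1))
  have "((\<lambda>T. bessel_P c (\<alpha> + 1) T / (of_real T - z) ^ 1
      + integral {0..T} (\<lambda>t. bessel_P c (\<alpha> + 1) t / (of_real t - z)\<^sup>2))
      \<longlongrightarrow> 0 + bessel_stieltjes c \<alpha> z) at_top"
    using \<alpha> by (intro tendsto_add bessel_P_quotient_tendsto_0[OF c z]
        bessel_P_stieltjes_parts_tendsto[OF c _ _ z]) (auto simp: field_simps)
  moreover have "\<forall>\<^sub>F T in at_top. bessel_P c (\<alpha> + 1) T / (of_real T - z) ^ 1
      + integral {0..T} (\<lambda>t. bessel_P c (\<alpha> + 1) t / (of_real t - z)\<^sup>2)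
      = integral {0..T} (\<lambda>t. bessel_P c \<alpha> t / (of_real t - z))"
    using bessel_P_quotient_parts[OF c \<alpha>(1) z, of _ 1]
    by (intro eventually_mono[OF eventually_gt_at_top[of 0]]) (auto simp: power2_eq_square)
  ultimately show "((\<lambda>T. integral {0..T} (\<lambda>t. bessel_P c \<alpha> t / (of_real t - z)))
      \<longlongrightarrow> bessel_stieltjes c \<alpha> z) at_top"
    by (simp add: tendsto_cong)
qed

text \<open>The partial integral up to s is P_(\<alpha>+1)(s) / (s - z) plus the convergent G(s).
  Averaging integrates the first term once more: by parts it becomes P_(\<alpha>+2)(T) / (T (T - z))
  plus the mean of P_(\<alpha>+2)(s) / (s - z)^2, and both vanish in the limit for Re \<alpha> <
  5/2.\<close>

lemma bessel_P_stieltjes_cesaro: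
  assumes c: "c > 0" and \<alpha>: "-1 < Re \<alpha>" "Re \<alpha> < 5 / 2" and z: "z \<notin> \<real>\<^sub>\<ge>\<^sub>0"
  shows "((\<lambda>T. (1 / T) *\<^sub>R integral {0..T} (\<lambda>s. integral {0..s} (\<lambda>t. bessel_P c \<alpha> t / (of_real t - z))))
           \<longlongrightarrow> bessel_stieltjes c \<alpha> z) at_top"
proof -
  note nz = nonneg_Reals_neq[OF z]
  have contP: "continuous_on {0..} (\<lambda>s. bessel_P c \<nu> s / (of_real s - z) ^ n)" if "Re \<nu> > 0" for \<nu> n
    using c that nz by (intro continuous_intros continuous_on_bessel_P_0) auto
  define G where "G = (\<lambda>s. integral {0..s} (\<lambda>t. bessel_P c (\<alpha> + 1) t / (of_real t - z)\<^sup>2))"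
  have contG: "continuous_on {0..} G"
    unfolding continuous_on_def
  proof
    fix s :: real assume s: "s \<in> {0..}"
    have "continuous_on {0..s + 1} G"
      unfolding G_def using \<alpha>
      by (intro indefinite_integral_continuous_1 integrable_continuous_interval
          continuous_on_subset[OF contP]) auto
    then have "(G \<longlongrightarrow> G s) (at s within {0..s + 1})" using s by (auto simp: continuous_on_def)
    moreover have "at s within {0..s + 1} = at s within {0..}"
      by (rule at_within_nhd[of _ "{..<s + 1}"]) (use s in auto)
    ultimately show "(G \<longlongrightarrow> G s) (at s within {0..})" by simp
  qed
  have lim1: "((\<lambda>T. (1 / T) *\<^sub>R integral {0..T} G) \<longlongrightarrow> bessel_stieltjes c \<alpha> z) at_top"
    using bessel_P_stieltjes_parts_tendsto[OF assms] contG
    unfolding G_def by (intro cesaro_mean_tendsto) auto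
  have lim2: "((\<lambda>T. (1 / T) *\<^sub>R integral {0..T} (\<lambda>s. bessel_P c (\<alpha> + 2) s / (of_real s - z)\<^sup>2)) \<longlongrightarrow> 0) at_top"
    using \<alpha> by (intro cesaro_mean_tendsto contP bessel_P_quotient_tendsto_0[OF c z]) (auto simp: field_simps)
  \<comment> \<open>The factor 1 - z/T rewrites 1 / (T (T - z)) with denominator (T - z)^2, so that
    the same vanishing quotient can be used.\<close>
  have lim3: "((\<lambda>T. (1 - z * of_real (inverse T)) * (bessel_P c (\<alpha> + 2) T / (of_real T - z)\<^sup>2)) \<longlongrightarrow>
      (1 - z * of_real 0) * 0) at_top"
    using \<alpha> by (intro tendsto_intros bessel_P_quotient_tendsto_0[OF c z] tendsto_inverse_0_at_top
        filterlim_ident) (auto simp: field_simps)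
  have "((\<lambda>T. (1 - z * of_real (inverse T)) * (bessel_P c (\<alpha> + 2) T / (of_real T - z)\<^sup>2)
      + (1 / T) *\<^sub>R integral {0..T} (\<lambda>s. bessel_P c (\<alpha> + 2) s / (of_real s - z)\<^sup>2)
      + (1 / T) *\<^sub>R integral {0..T} G) \<longlongrightarrow> (1 - z * of_real 0) * 0 + 0 + bessel_stieltjes c \<alpha> z) at_top"
    by (intro tendsto_add lim1 lim2 lim3)
  moreover have "\<forall>\<^sub>F T in at_top. (1 - z * of_real (inverse T)) * (bessel_P c (\<alpha> + 2) T / (of_real T - z)\<^sup>2)
      + (1 / T) *\<^sub>R integral {0..T} (\<lambda>s. bessel_P c (\<alpha> + 2) s / (of_real s - z)\<^sup>2)
      + (1 / T) *\<^sub>R integral {0..T} G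
      = (1 / T) *\<^sub>R integral {0..T} (\<lambda>s. integral {0..s} (\<lambda>t. bessel_P c \<alpha> t / (of_real t - z)))"
  proof (rule eventually_mono[OF eventually_gt_at_top[of 0]])
    fix T :: real assume T: "T > 0"
    have "integral {0..T} (\<lambda>s. integral {0..s} (\<lambda>t. bessel_P c \<alpha> t / (of_real t - z)))
        = integral {0..T} (\<lambda>s. bessel_P c (\<alpha> + 1) s / (of_real s - z) ^ 1 + G s)"
    proof (rule integral_cong)
      fix s assume "s \<in> {0..T}"
      then show "integral {0..s} (\<lambda>t. bessel_P c \<alpha> t / (of_real t - z))
        = bessel_P c (\<alpha> + 1) s / (of_real s - z) ^ 1 + G s"
        using bessel_P_quotient_parts[OF c \<alpha>(1) z, of s 1]
        \<comment> \<open>Integration by parts was stated for positive end points; at s = 0 both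
          sides are 0.\<close>
        by (cases "s = 0") (auto simp: G_def power2_eq_square)
    qed
    also have "\<dots> = integral {0..T} (\<lambda>s. bessel_P c (\<alpha> + 1) s / (of_real s - z) ^ 1) + integral {0..T} G"
      using \<alpha> by (intro integral_add integrable_continuous_interval
          continuous_on_subset[OF contP] continuous_on_subset[OF contG]) auto
    also have "integral {0..T} (\<lambda>s. bessel_P c (\<alpha> + 1) s / (of_real s - z) ^ 1) =
        bessel_P c (\<alpha> + 2) T / (of_real T - z)
        + integral {0..T} (\<lambda>s. bessel_P c (\<alpha> + 2) s / (of_real s - z)\<^sup>2)"
      using bessel_P_quotient_parts[OF c _ z T, of "\<alpha> + 1" 1] \<alpha>
      by (simp add: power2_eq_square add.assoc)
    finally have "(1 / T) *\<^sub>R integral {0..T} (\<lambda>s. integral {0..s} (\<lambda>t. bessel_P c \<alpha> t / (of_real t - z)))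
        = (1 / T) *\<^sub>R (bessel_P c (\<alpha> + 2) T / (of_real T - z))
        + (1 / T) *\<^sub>R integral {0..T} (\<lambda>s. bessel_P c (\<alpha> + 2) s / (of_real s - z)\<^sup>2)
        + (1 / T) *\<^sub>R integral {0..T} G"
      by (simp only: scaleR_add_right)
    moreover have "(1 / T) *\<^sub>R (bessel_P c (\<alpha> + 2) T / (of_real T - z))
        = (1 - z * of_real (inverse T)) * (bessel_P c (\<alpha> + 2) T / (of_real T - z)\<^sup>2)"
    proof -
      have 1: "1 / u * (p / x) = x / u * (p / x\<^sup>2)" if "x \<noteq> 0" for u p x :: complex
        using that by (simp add: power2_eq_square)
      have 2: "1 - z * of_real (inverse T) = (of_real T - z) / of_real T"
        using T by (simp add: field_simps)
      have 3: "(1 / T) *\<^sub>R y = 1 / of_real T * y" for y :: complex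
        by (simp add: scaleR_conv_of_real)
      show ?thesis
        unfolding 2 3 by (rule 1) (use nz[of T] T in auto)
    qed
    ultimately show "(1 - z * of_real (inverse T)) * (bessel_P c (\<alpha> + 2) T / (of_real T - z)\<^sup>2)
      + (1 / T) *\<^sub>R integral {0..T} (\<lambda>s. bessel_P c (\<alpha> + 2) s / (of_real s - z)\<^sup>2)
      + (1 / T) *\<^sub>R integral {0..T} G
      = (1 / T) *\<^sub>R integral {0..T} (\<lambda>s. integral {0..s} (\<lambda>t. bessel_P c \<alpha> t / (of_real t - z)))"
      by simp
  qed
  ultimately show ?thesis by (simp add: tendsto_cong)
qed

subsection \<open>Laplace transform\<close>

lemma measurable_halfline_ident [measurable]: "(\<lambda>t. t) \<in> borel_measurable halfline"
  by (intro measurable_halfline continuous_intros)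

text \<open>Integrate the power series termwise: the Gamma integral of t^(b+k) exp(-s t) cancels the
  reciprocal Gamma coefficient and leaves the exponential series of - c/s. The terms in absolute
  value add up to the series of exp(c/s), so the interchange is legitimate for every s > 0.\<close>

lemma bessel_P_laplace:
  fixes b c s :: real
  assumes c: "c > 0" and b: "b > -1" and s: "s > 0"
  shows "integral\<^sup>L halfline (\<lambda>t. bessel_P c (of_real b) t * of_real (exp (- (s * t)))) =
           of_real (exp (- (c / s)) / s powr (b + 1))"
proof -
  define C where "C = (\<lambda>k. (-1) ^ k * rGamma (of_nat k + of_real b + 1) / fact k * (of_real c :: complex) ^ k)"
  define h where "h = (\<lambda>k t. t powr (b + real k) * exp (- (s * t)))"
  define f where "f = (\<lambda>k t. C k * of_real (h k t))"
  have h: "integrable halfline (h k)"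
    "integral\<^sup>L halfline (h k) = Gamma (real k + b + 1) / s powr (b + real k + 1)" for k
    using halfline_Gamma_integral[of "b + real k" s] b s unfolding h_def by (simp_all add: add_ac)
  have h0: "h k t \<ge> 0" for k t by (simp add: h_def)
  have G: "Gamma (real k + b + 1) > 0" for k using b by (intro Gamma_real_pos) auto
  have C: "C k = of_real ((-1) ^ k / fact k * c ^ k / Gamma (real k + b + 1))" for k
  proof -
    have "rGamma (of_nat k + of_real b + 1 :: complex) = of_real (rGamma (real k + b + 1))"
      by (simp flip: rGamma_complex_of_real)
    then show ?thesis by (simp add: C_def rGamma_inverse_Gamma field_simps)
  qed
  have val: "C k * of_real (Gamma (real k + b + 1) / s powr (b + real k + 1)) =
      of_real (1 / s powr (b + 1) * ((- (c / s)) ^ k / fact k))" for k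
  proof -
    have "s powr (b + real k + 1) = s powr (b + 1) * s ^ k"
      using s by (simp add: powr_add powr_realpow)
    then have "(-1) ^ k / fact k * c ^ k / Gamma (real k + b + 1) * (Gamma (real k + b + 1) / s powr (b + real k + 1))
       = 1 / s powr (b + 1) * ((- (c / s)) ^ k / fact k)"
      using G[of k] s by (simp add: power_minus[of "c / s"] power_divide field_simps)
    then show ?thesis unfolding C by (simp only: of_real_mult[symmetric])
  qed
  have nrm: "norm (f k t) = norm (C k) * h k t" for k t
    using h0[of k t] by (simp add: f_def norm_mult)
  have fint: "integrable halfline (f k)" for k
    unfolding f_def using h(1) by (intro integrable_mult_right integrable_of_real)
  have fI: "integral\<^sup>L halfline (f k) = of_real (1 / s powr (b + 1) * ((- (c / s)) ^ k / fact k))" for k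
    unfolding f_def val[symmetric] h(2)[symmetric] by (simp add: integral_complex_of_real)
  have fsums: "(\<lambda>k. f k t) sums (bessel_P c (of_real b) t * of_real (exp (- (s * t))))" if t: "t > 0" for t
  proof -
    have "(\<lambda>k. of_real t powr of_real b * ((-1) ^ k * rGamma (of_nat k + of_real b + 1) / fact k * of_real (c * t) ^ k)
        * of_real (exp (- (s * t)))) sums (bessel_P c (of_real b) t * of_real (exp (- (s * t))))"
      unfolding bessel_P_def by (intro sums_mult2 sums_mult sums_bessel_E)
    moreover have "of_real t powr of_real b * ((-1) ^ k * rGamma (of_nat k + of_real b + 1) / fact k * of_real (c * t) ^ k)
        * of_real (exp (- (s * t))) = f k t" for k
    proof -
      have "h k t = t powr b * t ^ k * exp (- (s * t))"
        using t by (simp add: h_def powr_add powr_realpow)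
      moreover have "complex_of_real t powr of_real b = of_real (t powr b)"
        using t by (simp add: powr_of_real)
      ultimately show ?thesis by (simp add: f_def C_def power_mult_distrib mult_ac)
    qed
    ultimately show ?thesis by simp
  qed
  have summ_norm: "summable (\<lambda>k. norm (f k t))" if t: "t > 0" for t
  proof -
    have "summable (\<lambda>k. norm (of_real t powr of_real b :: complex) * norm ((-1) ^ k * rGamma (of_nat k + of_real b + 1) / fact k * of_real (c * t) ^ k :: complex)
        * exp (- (s * t)))"
      by (intro summable_mult2 summable_mult summable_bessel_E)
    moreover have "norm (of_real t powr of_real b :: complex) * norm ((-1) ^ k * rGamma (of_nat k + of_real b + 1) / fact k * of_real (c * t) ^ k :: complex)
        * exp (- (s * t)) = norm (f k t)" for k
    proof -
      have "h k t = t powr b * t ^ k * exp (- (s * t))"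
        using t by (simp add: h_def powr_add powr_realpow)
      moreover have "norm (complex_of_real t powr of_real b) = t powr b"
        using t by (simp add: norm_powr_real_powr)
      ultimately show ?thesis
        using t c unfolding nrm C_def by (simp add: norm_mult norm_divide norm_power power_mult_distrib mult_ac)
    qed
    ultimately show ?thesis by simp
  qed
  \<comment> \<open>The same cancellation without signs, with c/s in place of - c/s.\<close>
  have summ_int: "summable (\<lambda>k. \<integral>t. norm (f k t) \<partial>halfline)"
  proof -
    have "(\<integral>t. norm (f k t) \<partial>halfline) = 1 / s powr (b + 1) * ((c / s) ^ k / fact k)" for k
    proof -
      have "(\<integral>t. norm (f k t) \<partial>halfline) = norm (C k) * (Gamma (real k + b + 1) / s powr (b + real k + 1))"
        unfolding nrm h(2)[symmetric] by simp
      also have "\<dots> = norm (C k * of_real (Gamma (real k + b + 1) / s powr (b + real k + 1)))"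
        using G[of k] unfolding norm_mult norm_of_real by simp
      also have "\<dots> = 1 / s powr (b + 1) * ((c / s) ^ k / fact k)"
        unfolding val norm_of_real using c s by (simp add: abs_mult power_abs)
      finally show ?thesis .
    qed
    moreover have "summable (\<lambda>k. 1 / s powr (b + 1) * ((c / s) ^ k / fact k))"
      using summable_exp_norm_bound sums_summable by blast
    ultimately show ?thesis by simp
  qed
  have "integral\<^sup>L halfline (\<lambda>t. \<Sum>k. f k t) = (\<Sum>k. integral\<^sup>L halfline (f k))"
    using fint summ_norm summ_int by (intro integral_suminf) (auto intro!: AE_I2)
  moreover have "integral\<^sup>L halfline (\<lambda>t. \<Sum>k. f k t)
      = integral\<^sup>L halfline (\<lambda>t. bessel_P c (of_real b) t * of_real (exp (- (s * t))))"
    by (rule Bochner_Integration.integral_cong[OF refl]) (use fsums in \<open>auto simp: sums_iff\<close>)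
  moreover have "(\<Sum>k. integral\<^sup>L halfline (f k)) = of_real (exp (- (c / s)) / s powr (b + 1))"
  proof -
    have "(\<lambda>k. 1 / s powr (b + 1) * ((- (c / s)) ^ k / fact k)) sums (1 / s powr (b + 1) * exp (- (c / s)))"
      by (rule summable_exp_norm_bound)
    from sums_of_real[OF this, where ?'a = complex] show ?thesis
      unfolding fI by (simp add: sums_iff)
  qed
  ultimately show ?thesis by simp
qed

text \<open>For \<open>b = -\<alpha> - 1\<close> this is $2 (x/c)^{\alpha/2} K_\alpha(2 \sqrt{c x})$.\<close>

definition macdonald :: "real \<Rightarrow> real \<Rightarrow> real \<Rightarrow> real" where
  "macdonald c b x = integral\<^sup>L halfline (\<lambda>s. s powr b * exp (- (s * x) - c / s))"

lemma measurable_macdonald_kernel: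
  "(\<lambda>s. s powr b * exp (- (s * x) - c / s)) \<in> borel_measurable halfline"
  by (intro measurable_halfline continuous_intros) auto

text \<open>Insert 2 / (t + x)^3 as the integral of s^2 exp(- (t + x) s) and exchange the integrals.
  The Laplace transform of order a + 2 produces s^(-a-3) exp(- c/s), and the factor s^2 brings the
  exponent back to - a - 1.\<close>

lemma bessel_stieltjes_eq_macdonald:
  fixes a c x :: real
  assumes c: "c > 0" and a: "-1 < a" "a < 5 / 2" and x: "x > 0"
  shows "bessel_stieltjes c (of_real a) (- of_real x) = of_real (macdonald c (- a - 1) x)"
proof -
  interpret H: sigma_finite_measure halfline by (rule sigma_finite_halfline)
  interpret pair_sigma_finite halfline halfline ..
  define P where "P = bessel_P c (of_real (a + 2))"
  define f where "f = (\<lambda>t s. P t * of_real (s\<^sup>2 * exp (- ((t + x) * s))))"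
  have Pm [measurable]: "P \<in> borel_measurable halfline"
    unfolding P_def by (rule measurable_halfline[OF continuous_on_bessel_P])
  have G: "integrable halfline (\<lambda>s. s\<^sup>2 * exp (- ((t + x) * s)))"
    "integral\<^sup>L halfline (\<lambda>s. s\<^sup>2 * exp (- ((t + x) * s))) = 2 / (t + x) ^ 3" if t: "t > 0" for t
  proof -
    have eq: "s powr 2 * exp (- ((t + x) * s)) = s\<^sup>2 * exp (- ((t + x) * s))" if "s > 0" for s
      using that by (simp add: powr_numeral)
    have tx: "t + x > 0" using t x by simp
    have g3: "Gamma (2 + 1 :: real) = 2" using Gamma_fact[of 2, where ?'a = real] by (simp add: eval_nat_numeral)
    show "integrable halfline (\<lambda>s. s\<^sup>2 * exp (- ((t + x) * s)))"
      by (rule iffD1[OF Bochner_Integration.integrable_cong[OF refl] halfline_Gamma_integral(1)[of 2 "t + x"]])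
         (use eq tx in auto)
    have "integral\<^sup>L halfline (\<lambda>s. s\<^sup>2 * exp (- ((t + x) * s))) =
        integral\<^sup>L halfline (\<lambda>s. s powr 2 * exp (- ((t + x) * s)))"
      by (rule Bochner_Integration.integral_cong[OF refl]) (use eq in auto)
    also have "\<dots> = 2 / (t + x) powr 3"
      using halfline_Gamma_integral(2)[of 2 "t + x"] tx g3 by simp
    finally show "integral\<^sup>L halfline (\<lambda>s. s\<^sup>2 * exp (- ((t + x) * s))) = 2 / (t + x) ^ 3"
      using tx by (simp add: powr_numeral)
  qed
  have z: "- complex_of_real x \<notin> \<real>\<^sub>\<ge>\<^sub>0" using x by (simp add: complex_nonneg_Reals_iff)
  have dom: "integrable halfline (\<lambda>t. 2 * P t / (of_real t - - of_real x) ^ 3)"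
    using integrable_bessel_stieltjes[OF c _ _ z, of "of_real a"] a by (simp add: P_def)
  have "integrable (halfline \<Otimes>\<^sub>M halfline) (case_prod f)"
  proof (rule Fubini_integrable)
    show "case_prod f \<in> borel_measurable (halfline \<Otimes>\<^sub>M halfline)"
      unfolding f_def by measurable
    have "integrable halfline (\<lambda>t. norm (2 * P t / (of_real t - - of_real x) ^ 3))"
      using dom by (rule integrable_norm)
    \<comment> \<open>Integrating the modulus over s reproduces the modulus of the regularised
      integrand, so its integrability is precisely the hypothesis of Fubini's theorem.\<close>
    moreover have "norm (2 * P t / (of_real t - - of_real x) ^ 3) = (\<integral>s. norm (case_prod f (t, s)) \<partial>halfline)"
      if "t \<in> space halfline" for t
    proof -
      have t: "t > 0" using that by simp
      have "(\<integral>s. norm (case_prod f (t, s)) \<partial>halfline) = norm (P t) * (2 / (t + x) ^ 3)"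
        unfolding G(2)[OF t, symmetric] by (simp add: f_def norm_mult norm_power flip: of_real_power)
      also have "\<dots> = norm (2 * P t / (of_real t - - of_real x) ^ 3)"
        using t x by (simp add: norm_mult norm_divide norm_power flip: of_real_add)
      finally show ?thesis by simp
    qed
    ultimately show "integrable halfline (\<lambda>t. \<integral>s. norm (case_prod f (t, s)) \<partial>halfline)"
      by (subst (asm) Bochner_Integration.integrable_cong[OF refl]) auto
    show "AE t in halfline. integrable halfline (\<lambda>s. case_prod f (t, s))"
      using G(1) by (intro AE_I2) (auto simp: f_def simp del: of_real_mult intro!: integrable_mult_right integrable_of_real)
  qed
  then have "(\<integral>s. (\<integral>t. f t s \<partial>halfline) \<partial>halfline) = (\<integral>t. (\<integral>s. f t s \<partial>halfline) \<partial>halfline)"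
    by (rule Fubini_integral)
  moreover have "(\<integral>t. (\<integral>s. f t s \<partial>halfline) \<partial>halfline) = bessel_stieltjes c (of_real a) (- of_real x)"
    unfolding bessel_stieltjes_def
  proof (rule Bochner_Integration.integral_cong[OF refl])
    fix t assume "t \<in> space halfline"
    then have t: "t > 0" by simp
    have "(\<integral>s. f t s \<partial>halfline) = P t * of_real (2 / (t + x) ^ 3)"
      unfolding f_def G(2)[OF t, symmetric] integral_mult_right_zero integral_complex_of_real ..
    then show "(\<integral>s. f t s \<partial>halfline) = 2 * bessel_P c (of_real a + 2) t / (of_real t - - of_real x) ^ 3"
      by (simp add: P_def)
  qed
  moreover have "(\<integral>s. (\<integral>t. f t s \<partial>halfline) \<partial>halfline) =
      (\<integral>s. of_real (s powr (- a - 1) * exp (- (s * x) - c / s)) \<partial>halfline)"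
  proof (rule Bochner_Integration.integral_cong[OF refl])
    fix s assume "s \<in> space halfline"
    then have s: "s > 0" by simp
    have "f t s = of_real (s\<^sup>2 * exp (- (s * x))) * (P t * of_real (exp (- (s * t))))" for t
    proof -
      have "exp (- ((t + x) * s)) = exp (- (s * x)) * exp (- (s * t))"
        by (simp add: exp_add[symmetric] algebra_simps)
      then show ?thesis unfolding f_def by simp
    qed
    then have "(\<integral>t. f t s \<partial>halfline) = of_real (s\<^sup>2 * exp (- (s * x))) * of_real (exp (- (c / s)) / s powr (a + 2 + 1))"
      using bessel_P_laplace[OF c _ s, of "a + 2"] a unfolding P_def by simp
    also have "\<dots> = of_real (s\<^sup>2 * exp (- (s * x)) * (exp (- (c / s)) / s powr (a + 2 + 1)))" by simp
    also have "s\<^sup>2 * exp (- (s * x)) * (exp (- (c / s)) / s powr (a + 2 + 1))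
        = s powr (- a - 1) * exp (- (s * x) - c / s)"
    proof -
      have "- a - 1 = 2 - (a + 2 + 1)" by simp
      then have "s powr (- a - 1) = s powr (2 - (a + 2 + 1))" by (simp only:)
      also have "\<dots> = s\<^sup>2 / s powr (a + 2 + 1)" using s by (simp only: powr_diff powr_numeral)
      finally show ?thesis by (simp add: exp_diff exp_minus field_simps)
    qed
    finally show "(\<integral>t. f t s \<partial>halfline) = of_real (s powr (- a - 1) * exp (- (s * x) - c / s))" .
  qed
  ultimately show ?thesis by (simp only: macdonald_def integral_complex_of_real)
qed

subsection \<open>Evaluation by Wronskians\<close>

text \<open>Here the power is integrable at 0 by itself and \<open>exp (- (s * x))\<close> gives the
  decay at infinity.\<close>

lemma macdonald_kernel_integrable:
  assumes "c > 0" "b > -1" "x > 0"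
  shows "integrable halfline (\<lambda>s. s powr b * exp (- (s * x) - c / s))"
proof (rule integrable_halfline_bound[OF halfline_Gamma_integral(1)[OF assms(2,3)] measurable_macdonald_kernel])
  show "norm (s powr b * exp (- (s * x) - c / s)) \<le> s powr b * exp (- (x * s))" if "s > 0" for s
    using that assms by (auto simp: abs_mult mult.commute intro!: mult_left_mono)
qed

text \<open>The inversion s = 1/u turns the integral at x = 0 into Euler's integral for Gamma(a)
  with rate c.\<close>

lemma macdonald_kernel_integrable_0:
  assumes c: "c > 0" and a: "a > 0"
  shows "integrable halfline (\<lambda>s. s powr (- a - 1) * exp (- (c / s)))"
    and "integral\<^sup>L halfline (\<lambda>s. s powr (- a - 1) * exp (- (c / s))) = Gamma a / c powr a"
proof -
  define f where "f = (\<lambda>u. u powr (a - 1) * exp (- (c * u)))"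
  have f: "integrable halfline f" "integral\<^sup>L halfline f = Gamma a / c powr a"
    using halfline_Gamma_integral[of "a - 1" c] a c by (auto simp: f_def)
  have cont: "continuous_on {0<..} f" unfolding f_def by (intro continuous_intros) auto
  have eq: "f (1 / u) / u\<^sup>2 = u powr (- a - 1) * exp (- (c / u))" if "u > 0" for u
  proof -
    have "- a - 1 = - (a - 1) - 2" by simp
    then have "u powr (- a - 1) = u powr (- (a - 1) - 2)" by (simp only:)
    also have "\<dots> = u powr (- (a - 1)) / u\<^sup>2" using that by (simp only: powr_diff powr_numeral)
    also have "u powr (- (a - 1)) = (1 / u) powr (a - 1)"
      using that by (simp only: powr_minus_divide) (simp add: powr_divide)
    finally show ?thesis by (simp add: f_def)
  qed
  show "integrable halfline (\<lambda>s. s powr (- a - 1) * exp (- (c / s)))"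
    by (rule iffD1[OF Bochner_Integration.integrable_cong[OF refl] halfline_inversion(1)[OF f(1) cont]])
       (use eq in auto)
  have "integral\<^sup>L halfline (\<lambda>s. s powr (- a - 1) * exp (- (c / s))) = integral\<^sup>L halfline (\<lambda>u. f (1 / u) / u\<^sup>2)"
    by (rule Bochner_Integration.integral_cong[OF refl]) (use eq in auto)
  then show "integral\<^sup>L halfline (\<lambda>s. s powr (- a - 1) * exp (- (c / s))) = Gamma a / c powr a"
    using halfline_inversion(2)[OF f(1) cont] f(2) by simp
qed

text \<open>The opposite regime: \<open>exp (- (c / s))\<close> tames the power at 0 and the power
  decays at infinity, so that x = 0 is included.\<close>

lemma macdonald_kernel_integrable':
  assumes c: "c > 0" and a: "a > 0" and x: "x \<ge> 0"
  shows "integrable halfline (\<lambda>s. s powr (- a - 1) * exp (- (s * x) - c / s))"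
proof (rule integrable_halfline_bound[OF macdonald_kernel_integrable_0(1)[OF c a] measurable_macdonald_kernel])
  show "norm (s powr (- a - 1) * exp (- (s * x) - c / s)) \<le> s powr (- a - 1) * exp (- (c / s))" if "s > 0" for s
    using that x by (auto simp: abs_mult intro!: mult_left_mono)
qed

lemma macdonald_deriv:
  assumes c: "c > 0" and b: "b > -2" and x: "x > 0"
    and int: "integrable halfline (\<lambda>s. s powr b * exp (- (s * x) - c / s))"
  shows "(macdonald c b has_real_derivative - macdonald c (b + 1) x) (at x)"
proof -
  have "((\<lambda>x. integral\<^sup>L halfline (\<lambda>s. s powr b * exp (- (s * x) - c / s))) has_field_derivative
      integral\<^sup>L halfline (\<lambda>s. - (s powr (b + 1) * exp (- (s * x) - c / s)))) (at x)"
  \<comment> \<open>Within distance x/2 of x the exponential is at most exp(- s x/2), and b + 1 > -1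
    makes the majorant a Gamma integrand.\<close>
  proof (rule has_field_derivative_integral[where r = "x / 2" and g = "\<lambda>s. s powr (b + 1) * exp (- (x / 2 * s))"
        and f' = "\<lambda>x s. - (s powr (b + 1) * exp (- (s * x) - c / s))"])
    show "integrable halfline (\<lambda>s. s powr (b + 1) * exp (- (x / 2 * s)))"
      using b x by (intro halfline_Gamma_integral) auto
    fix y s assume y: "y \<in> ball x (x / 2)" and "s \<in> space halfline"
    then have s: "s > 0" by simp
    have p: "s powr (b + 1) = s powr b * s" using s by (simp add: powr_add)
    show "((\<lambda>x. s powr b * exp (- (s * x) - c / s)) has_field_derivative
        - (s powr (b + 1) * exp (- (s * y) - c / s))) (at y)"
      unfolding p by (auto intro!: derivative_eq_intros)
    have "x / 2 \<le> y" using y by (auto simp: dist_real_def abs_real_def split: if_splits)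
    then have "s * (x / 2) \<le> s * y" using s by (intro mult_left_mono) auto
    moreover have "c / s \<ge> 0" using c s by simp
    ultimately have "- (s * y) - c / s \<le> - (x / 2 * s)" by (simp add: mult.commute)
    then show "norm (- (s powr (b + 1) * exp (- (s * y) - c / s))) \<le> s powr (b + 1) * exp (- (x / 2 * s))"
      by (auto simp: abs_mult intro!: mult_left_mono)
  qed (use x int measurable_macdonald_kernel in auto)
  then show ?thesis by (simp add: macdonald_def[abs_def])
qed

text \<open>The derivative in s of s^(1-a) exp(- s x - c/s) has integral 0, as this function
  vanishes at both ends. Together with differentiation in x, the relation gives the second order
  equation in x.\<close>

lemma macdonald_recurrence:
  assumes c: "c > 0" and a: "0 < a" "a < 1" and x: "x > 0"
  shows "x * macdonald c (1 - a) x = (1 - a) * macdonald c (- a) x + c * macdonald c (- a - 1) x"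
proof -
  define k where "k = (\<lambda>b s. s powr b * exp (- (s * x) - c / s))"
  define F where "F = k (1 - a)"
  have int: "integrable halfline (k (1 - a))" "integrable halfline (k (- a))" "integrable halfline (k (- a - 1))"
    unfolding k_def using macdonald_kernel_integrable[OF c _ x] macdonald_kernel_integrable'[OF c a(1), of x] a x
    by auto
  define f where "f = (\<lambda>s. (1 - a) * k (- a) s - x * k (1 - a) s + c * k (- a - 1) s)"
  have fi: "integrable halfline f" unfolding f_def using int by simp
  have ei: "einterval 0 \<infinity> = {0<..}" by (auto simp: einterval_def)
  have "(LBINT s=0..\<infinity>. f s) = 0 - 0"
  proof (rule interval_integral_FTC_integrable[where F = F])
    show "set_integrable lborel (einterval 0 \<infinity>) f" using fi by (simp add: ei integrable_halfline_iff)
    show "(F has_vector_derivative f s) (at s)" if "0 < ereal s" "ereal s < \<infinity>" for s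
    proof -
      have s: "s > 0" using that by (simp add: zero_ereal_def)
      have p: "s powr (1 - a) = s * s powr (- a)" "s powr (- a) = s * s powr (- a - 1)"
        using s powr_mult_base[of s "- a"] powr_mult_base[of s "- a - 1"] by simp_all
      have "(F has_real_derivative (s powr (1 - a) * (exp (- (s * x) - c / s) * (- x + c / s\<^sup>2))
          + (1 - a) * s powr (1 - a - 1) * exp (- (s * x) - c / s))) (at s)"
        unfolding F_def k_def using s by (auto intro!: derivative_eq_intros simp: power2_eq_square)
      moreover have "s powr (1 - a) * (exp (- (s * x) - c / s) * (- x + c / s\<^sup>2))
          + (1 - a) * s powr (1 - a - 1) * exp (- (s * x) - c / s) = f s"
        using s by (simp add: f_def k_def p(1)) (simp add: p(2) power2_eq_square field_simps)
      ultimately show ?thesis by (simp add: has_real_derivative_iff_has_vector_derivative)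
    qed
    show "isCont f s" if "0 < ereal s" "ereal s < \<infinity>" for s
      unfolding f_def k_def using that by (intro continuous_intros) (auto simp: zero_ereal_def)
    have F0: "F s \<le> s powr (1 - a)" "0 \<le> F s" if "s > 0" for s
    proof -
      have "s * x \<ge> 0" "c / s \<ge> 0" using that x c by simp_all
      then have "- (s * x) - c / s \<le> 0" by linarith
      then show "F s \<le> s powr (1 - a)" "0 \<le> F s"
        unfolding F_def k_def by (auto intro!: mult_left_le)
    qed
    have "((\<lambda>s. s powr (1 - a)) \<longlongrightarrow> 0 powr (1 - a)) (at_right 0)"
      using a by (intro tendsto_intros) (auto simp: eventually_at_filter)
    then have l1: "((\<lambda>s. s powr (1 - a)) \<longlongrightarrow> 0) (at_right 0)" using a by simp
    have "(F \<longlongrightarrow> 0) (at_right 0)"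
      by (rule Lim_null_comparison[OF _ l1]) (use F0 in \<open>auto simp: eventually_at_filter\<close>)
    then show "((F \<circ> real_of_ereal) \<longlongrightarrow> 0) (at_right 0)"
      unfolding zero_ereal_def by (subst ereal_tendsto_simps1)
    have l2: "((\<lambda>s. s powr (1 - a) * exp (- (s * x))) \<longlongrightarrow> 0) at_top"
    proof -
      have "((\<lambda>s. s powr (1 - a) / exp (x * s)) \<longlongrightarrow> 0) at_top"
        using x a by real_asymp
      then show ?thesis by (simp add: exp_minus field_simps)
    qed
    have "(F \<longlongrightarrow> 0) at_top"
    proof (rule Lim_null_comparison[OF _ l2])
      show "\<forall>\<^sub>F s in at_top. norm (F s) \<le> s powr (1 - a) * exp (- (s * x))"
        using c by (intro eventually_mono[OF eventually_gt_at_top[of 0]])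
          (auto simp: F_def k_def abs_mult intro!: mult_left_mono)
    qed
    then show "((F \<circ> real_of_ereal) \<longlongrightarrow> 0) (at_left \<infinity>)" by (subst ereal_tendsto_simps1)
  qed auto
  then have "integral\<^sup>L halfline f = 0"
    by (simp add: integral_halfline_eq interval_lebesgue_integral_def ei)
  moreover have "integral\<^sup>L halfline f = (1 - a) * macdonald c (- a) x - x * macdonald c (1 - a) x
      + c * macdonald c (- a - 1) x"
    using int unfolding f_def macdonald_def k_def by simp
  ultimately show ?thesis by simp
qed

text \<open>The first limit is dominated convergence. In the second the unweighted integral diverges
  at x = 0; scaling by x extracts the singular power x^(a-1) and leaves an integral with a regular
  limit.\<close>

lemma macdonald_at_0:
  assumes c: "c > 0" and a: "0 < a" "a < 1"
  shows "(macdonald c (- a - 1) \<longlongrightarrow> Gamma a / c powr a) (at_right 0)"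
    and "((\<lambda>x. x powr (1 - a) * macdonald c (- a) x) \<longlongrightarrow> Gamma (1 - a)) (at_right 0)"
proof -
  have "((\<lambda>x. integral\<^sup>L halfline (\<lambda>s. s powr (- a - 1) * exp (- (s * x) - c / s))) \<longlongrightarrow>
      integral\<^sup>L halfline (\<lambda>s. s powr (- a - 1) * exp (- (c / s)))) (at_right 0)"
  proof (rule tendsto_integral_at[OF measurable_macdonald_kernel _ macdonald_kernel_integrable_0(1)[OF c a(1)]])
    show "(\<lambda>s. s powr (- a - 1) * exp (- (c / s))) \<in> borel_measurable halfline"
      using measurable_macdonald_kernel[of "- a - 1" 0 c] by simp
    show "((\<lambda>x. s powr (- a - 1) * exp (- (s * x) - c / s)) \<longlongrightarrow> s powr (- a - 1) * exp (- (c / s))) (at_right 0)"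
      if "s \<in> space halfline" for s
      using that by (auto intro!: tendsto_eq_intros)
    show "norm (s powr (- a - 1) * exp (- (s * x) - c / s)) \<le> s powr (- a - 1) * exp (- (c / s))"
      if "x \<in> {0<..}" "s \<in> space halfline" for x s
      using that by (auto simp: abs_mult intro!: mult_left_mono)
  qed
  then show "(macdonald c (- a - 1) \<longlongrightarrow> Gamma a / c powr a) (at_right 0)"
    using macdonald_kernel_integrable_0(2)[OF c a(1)] by (simp add: macdonald_def[abs_def])
  \<comment> \<open>The kernel after s = u/x: the parameter x now multiplies c, and the limit
    integrand is that of Gamma(1 - a).\<close>
  define f where "f = (\<lambda>x u. u powr (- a) * exp (- (u * 1) - c * x / u))"
  have "((\<lambda>x. integral\<^sup>L halfline (f x)) \<longlongrightarrow> integral\<^sup>L halfline (\<lambda>u. u powr (- a) * exp (- (1 * u)))) (at_right 0)"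
  proof (rule tendsto_integral_at[where g = "\<lambda>u. u powr (- a) * exp (- (1 * u))"])
    show "f x \<in> borel_measurable halfline" for x
      unfolding f_def by (rule measurable_macdonald_kernel)
    show "(\<lambda>u. u powr (- a) * exp (- (1 * u))) \<in> borel_measurable halfline"
      by (intro measurable_halfline continuous_intros) auto
    show "integrable halfline (\<lambda>u. u powr (- a) * exp (- (1 * u)))"
      using a by (intro halfline_Gamma_integral) auto
    show "((\<lambda>x. f x u) \<longlongrightarrow> u powr (- a) * exp (- (1 * u))) (at_right 0)" if "u \<in> space halfline" for u
      using that unfolding f_def by (auto intro!: tendsto_eq_intros)
    show "norm (f x u) \<le> u powr (- a) * exp (- (1 * u))" if "x \<in> {0<..}" "u \<in> space halfline" for x u
      using that c by (auto simp: f_def abs_mult intro!: mult_left_mono)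
  qed
  then have lim: "((\<lambda>x. integral\<^sup>L halfline (f x)) \<longlongrightarrow> Gamma (1 - a)) (at_right 0)"
    using halfline_Gamma_integral(2)[of "- a" 1] a by (simp add: add.commute)
  have eq: "integral\<^sup>L halfline (f x) = x powr (1 - a) * macdonald c (- a) x" if x: "x > 0" for x
  proof -
    have "integrable halfline (f x)"
      unfolding f_def using c a x by (intro macdonald_kernel_integrable) auto
    moreover have "continuous_on {0<..} (f x)"
      unfolding f_def by (intro continuous_intros) auto
    ultimately have "integral\<^sup>L halfline (f x) = integral\<^sup>L halfline (\<lambda>u. x * f x (x * u))"
      using halfline_scaling[OF _ _ x, of "f x"] by simp
    also have "\<dots> = integral\<^sup>L halfline (\<lambda>u. x powr (1 - a) * (u powr (- a) * exp (- (u * x) - c / u)))"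
    proof (rule Bochner_Integration.integral_cong[OF refl])
      fix u assume "u \<in> space halfline"
      then have u: "u > 0" by simp
      have "x * x powr (- a) = x powr (1 - a)" using x powr_mult_base[of x "- a"] by simp
      moreover have "(x * u) powr (- a) = x powr (- a) * u powr (- a)" using x u by (simp add: powr_mult)
      moreover have "c * x / (x * u) = c / u" using x by simp
      ultimately show "x * f x (x * u) = x powr (1 - a) * (u powr (- a) * exp (- (u * x) - c / u))"
        unfolding f_def by (metis mult.assoc mult.commute mult.left_neutral)
    qed
    finally show ?thesis by (simp add: macdonald_def)
  qed
  show "((\<lambda>x. x powr (1 - a) * macdonald c (- a) x) \<longlongrightarrow> Gamma (1 - a)) (at_right 0)"
    by (rule Lim_transform_eventually[OF lim]) (use eq in \<open>auto simp: eventually_at_filter\<close>)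
qed

text \<open>With the equation written as the system u' = f p, p' = g u, the weighted Wronskian has
  derivative 0. The component p has a limit at 0 even where u' = f p blows up, so the constant can
  be read off at the singular point.\<close>

lemma wronskian_const:
  fixes u p w q :: "real \<Rightarrow> complex" and f g :: "real \<Rightarrow> complex"
  assumes u: "\<And>x. x > 0 \<Longrightarrow> (u has_vector_derivative f x * p x) (at x)"
    and p: "\<And>x. x > 0 \<Longrightarrow> (p has_vector_derivative g x * u x) (at x)"
    and w: "\<And>x. x > 0 \<Longrightarrow> (w has_vector_derivative f x * q x) (at x)"
    and q: "\<And>x. x > 0 \<Longrightarrow> (q has_vector_derivative g x * w x) (at x)"
    and lim: "((\<lambda>x. p x * w x - u x * q x) \<longlongrightarrow> L) (at_right 0)"
    and x: "x > 0"
  shows "p x * w x - u x * q x = L"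
proof -
  define D where "D = (\<lambda>x. p x * w x - u x * q x)"
  have "(D has_vector_derivative 0) (at x)" if "x > 0" for x
  proof -
    have "(D has_vector_derivative (p x * (f x * q x) + (g x * u x) * w x) - (u x * (g x * w x) + (f x * p x) * q x)) (at x)"
      unfolding D_def by (intro has_vector_derivative_diff has_vector_derivative_mult u p w q that)
    then show ?thesis by (simp add: mult_ac)
  qed
  then obtain K where K: "\<And>x. x \<in> {0<..} \<Longrightarrow> D x = K"
    using has_vector_derivative_zero_constant[of "{0<..}" D]
    by (metis convex_real_interval(3) greaterThan_iff has_vector_derivative_at_within)
  have "((\<lambda>x. K) \<longlongrightarrow> L) (at_right (0::real))"
    using lim by (rule Lim_transform_eventually) (use K in \<open>auto simp: eventually_at_filter D_def\<close>)
  then have "K = L" by (simp add: tendsto_const_iff)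
  then show ?thesis using K[of x] x by (simp add: D_def)
qed

lemma macdonald_eq_bessel:
  fixes a c x :: real
  assumes c: "c > 0" and a: "0 < a" "a < 1" and x: "x > 0"
  shows "of_real (macdonald c (- a - 1) x) * (sin (of_real pi * of_real a) / of_real pi) =
     of_real c powr - of_real a * bessel_E (- of_real a) (- (of_real c * of_real x))
     - of_real x powr of_real a * bessel_E (of_real a) (- (of_real c * of_real x))"
proof -
  define A where "A = complex_of_real a"
  define C where "C = - complex_of_real c"
  \<comment> \<open>The equation \<open>x y'' + (1 - a) y' = c y\<close> is the system \<open>y' = f v\<close>, \<open>v' = g y\<close>.\<close>
  define f g where "f = (\<lambda>x::real. complex_of_real x powr (A - 1))" and "g = (\<lambda>x::real. - C * of_real x powr (- A))"
  \<comment> \<open>As - \<open>macdonald c (- a)\<close> is the derivative of the first component,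
    p is x^(1-a) u'.\<close>
  define u p where "u = (\<lambda>x. complex_of_real (macdonald c (- a - 1) x))"
    and "p = (\<lambda>x. complex_of_real (- (x powr (1 - a) * macdonald c (- a) x)))"
  \<comment> \<open>At 0 the components v1 and y2 vanish while y1 and v2 tend to reciprocal Gamma
    values, so each of the three Wronskians has a single product as its limit.\<close>
  define y1 v1 where "y1 = (\<lambda>x::real. bessel_E (- A) (C * of_real x))"
    and "v1 = (\<lambda>x::real. - C * (of_real x powr (1 - A) * bessel_E (1 - A) (C * of_real x)))"
  define y2 v2 where "y2 = (\<lambda>x::real. of_real x powr A * bessel_E A (C * of_real x))"
    and "v2 = (\<lambda>x::real. bessel_E (A - 1) (C * of_real x))"
  have fv: "of_real t powr (A - 1) * of_real t powr (1 - A) = (1 :: complex)" if "t > 0" for t :: real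
    using that by (simp flip: powr_add)
  have gv: "of_real t powr (- A) * of_real t powr A = (1 :: complex)" if "t > 0" for t :: real
    using that by (simp flip: powr_add)
  have dE: "((\<lambda>x::real. bessel_E \<nu> (C * of_real x)) has_vector_derivative - C * bessel_E (\<nu> + 1) (C * of_real t)) (at t)" for \<nu> t
  proof -
    have "((\<lambda>z. bessel_E \<nu> (C * z)) has_field_derivative (- bessel_E (\<nu> + 1) (C * of_real t)) * C) (at (of_real t))"
      by (rule DERIV_chain2[OF bessel_E_deriv]) (auto intro!: derivative_eq_intros)
    from has_vector_derivative_real_field[OF this] show ?thesis by (simp add: mult.commute)
  qed
  have dpE: "((\<lambda>x::real. of_real x powr \<nu> * bessel_E \<nu> (C * of_real x)) has_vector_derivative
      of_real t powr (\<nu> - 1) * bessel_E (\<nu> - 1) (C * of_real t)) (at t)" if "t > 0" for \<nu> t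
    using has_vector_derivative_real_field[OF powr_entire_deriv[of "of_real t" \<nu> C]] that by simp
  have y1: "(y1 has_vector_derivative f t * v1 t) (at t)" if t: "t > 0" for t
  proof -
    have "f t * v1 t = (of_real t powr (A - 1) * of_real t powr (1 - A)) * (- C * bessel_E (1 - A) (C * of_real t))"
      by (simp add: f_def v1_def)
    also have "\<dots> = - C * bessel_E (- A + 1) (C * of_real t)" unfolding fv[OF t] by (simp add: add.commute)
    finally show ?thesis unfolding y1_def using dE[of "- A" t] by simp
  qed
  have v1: "(v1 has_vector_derivative g t * y1 t) (at t)" if t: "t > 0" for t
    using has_vector_derivative_mult_right[OF dpE[OF t, of "1 - A"], of "- C"]
    by (simp add: g_def y1_def v1_def mult.assoc)
  have y2: "(y2 has_vector_derivative f t * v2 t) (at t)" if t: "t > 0" for t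
    using dpE[OF t, of A] by (simp add: f_def y2_def v2_def)
  have v2: "(v2 has_vector_derivative g t * y2 t) (at t)" if t: "t > 0" for t
  proof -
    have "g t * y2 t = (of_real t powr (- A) * of_real t powr A) * (- C * bessel_E A (C * of_real t))"
      by (simp add: g_def y2_def)
    also have "\<dots> = - C * bessel_E (A - 1 + 1) (C * of_real t)" unfolding gv[OF t] by simp
    finally show ?thesis unfolding v2_def using dE[of "A - 1" t] by simp
  qed
  have rp: "complex_of_real t powr of_real b = of_real (t powr b)" if "t > 0" for t b :: real
    using that by (simp add: powr_of_real)
  have dM: "(macdonald c (- a - 1) has_real_derivative - macdonald c (- a) t) (at t)"
    "(macdonald c (- a) has_real_derivative - macdonald c (1 - a) t) (at t)" if t: "t > 0" for t
    using macdonald_deriv[OF c _ t macdonald_kernel_integrable'[OF c a(1)]]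
      macdonald_deriv[OF c _ t macdonald_kernel_integrable[OF c _ t], of "- a"] a t by auto
  have u: "(u has_vector_derivative f t * p t) (at t)" if t: "t > 0" for t
  proof -
    have "f t * p t = of_real (- (t powr (a - 1) * t powr (1 - a) * macdonald c (- a) t))"
      using rp[OF t, of "a - 1"] by (simp add: f_def p_def A_def)
    also have "t powr (a - 1) * t powr (1 - a) = 1" using t by (simp flip: powr_add)
    finally have "f t * p t = of_real (- macdonald c (- a) t)" by simp
    then show ?thesis
      unfolding u_def using has_vector_derivative_of_real[OF dM(1)[OF t]] by (simp only:)
  qed
  have p: "(p has_vector_derivative g t * u t) (at t)" if t: "t > 0" for t
  proof -
    have "((\<lambda>x. - (x powr (1 - a) * macdonald c (- a) x)) has_real_derivative
        - (t powr (1 - a) * (- macdonald c (1 - a) t) + (1 - a) * t powr (1 - a - 1) * macdonald c (- a) t)) (at t)"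
      using t by (auto intro!: derivative_eq_intros dM(2)[OF t])
    also have "- (t powr (1 - a) * (- macdonald c (1 - a) t) + (1 - a) * t powr (1 - a - 1) * macdonald c (- a) t)
        = c * t powr (- a) * macdonald c (- a - 1) t"
    proof -
      have "t powr (1 - a) = t powr (- a) * t" using t powr_mult_base[of t "- a"]
        by (simp add: mult.commute)
      then have "- (t powr (1 - a) * (- macdonald c (1 - a) t) + (1 - a) * t powr (1 - a - 1) * macdonald c (- a) t)
        = t powr (- a) * (t * macdonald c (1 - a) t - (1 - a) * macdonald c (- a) t)"
        by (simp add: algebra_simps)
      then show ?thesis unfolding macdonald_recurrence[OF c a t] by simp
    qed
    finally have d: "((\<lambda>x. - (x powr (1 - a) * macdonald c (- a) x)) has_real_derivative
        c * t powr (- a) * macdonald c (- a - 1) t) (at t)" .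
    have e2: "of_real (c * t powr (- a) * macdonald c (- a - 1) t) = g t * u t"
      using rp[OF t, of "- a"] by (simp add: g_def u_def A_def C_def)
    show ?thesis
      unfolding p_def e2[symmetric] by (rule has_vector_derivative_of_real[OF d])
  qed
  have lE: "((\<lambda>x::real. bessel_E \<nu> (C * of_real x)) \<longlongrightarrow> rGamma (\<nu> + 1)) (at_right 0)" for \<nu>
  proof -
    have "isCont (\<lambda>x::real. bessel_E \<nu> (C * of_real x)) 0"
      using has_vector_derivative_continuous[OF dE] .
    then have "((\<lambda>x::real. bessel_E \<nu> (C * of_real x)) \<longlongrightarrow> bessel_E \<nu> (C * of_real 0)) (at 0)"
      by (simp add: isCont_def)
    then have "((\<lambda>x::real. bessel_E \<nu> (C * of_real x)) \<longlongrightarrow> bessel_E \<nu> (C * of_real 0)) (at_right 0)"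
      by (rule tendsto_within_subset) auto
    then show ?thesis by simp
  qed
  have lp: "((\<lambda>x. complex_of_real x powr of_real b) \<longlongrightarrow> 0) (at_right 0)" if b: "b > 0" for b :: real
  proof -
    have "((\<lambda>x. x powr b) \<longlongrightarrow> 0 powr b) (at_right 0)"
      using b by (intro tendsto_intros) (auto simp: eventually_at_filter)
    then have "((\<lambda>x. complex_of_real (x powr b)) \<longlongrightarrow> of_real 0) (at_right 0)"
      using b by (intro tendsto_of_real) simp
    then have l: "((\<lambda>x. complex_of_real (x powr b)) \<longlongrightarrow> 0) (at_right 0)" by simp
    show ?thesis
      by (rule Lim_transform_eventually[OF l]) (auto simp: eventually_at_filter rp)
  qed
  have ly1: "(y1 \<longlongrightarrow> rGamma (1 - A)) (at_right 0)"
    unfolding y1_def using lE[of "- A"] by (simp add: add.commute)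
  have lv1: "(v1 \<longlongrightarrow> 0) (at_right 0)"
    unfolding v1_def using tendsto_mult[OF tendsto_const[of "- C"] tendsto_mult[OF lp[of "1 - a"] lE[of "1 - A"]]] a
    by (simp add: A_def)
  have ly2: "(y2 \<longlongrightarrow> 0) (at_right 0)"
    unfolding y2_def using tendsto_mult[OF lp[of a] lE[of A]] a by (simp add: A_def)
  have lv2: "(v2 \<longlongrightarrow> rGamma A) (at_right 0)"
    unfolding v2_def using lE[of "A - 1"] by simp
  have lu: "(u \<longlongrightarrow> of_real (Gamma a / c powr a)) (at_right 0)"
    unfolding u_def by (intro tendsto_of_real macdonald_at_0 c a)
  have lpp: "(p \<longlongrightarrow> of_real (- Gamma (1 - a))) (at_right 0)"
    unfolding p_def by (intro tendsto_of_real tendsto_minus macdonald_at_0 c a)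
  have ca: "complex_of_real c powr - A = of_real (1 / c powr a)"
    using rp[OF c, of "- a"] by (simp add: A_def powr_minus_divide)
  have GA: "of_real (Gamma a) * rGamma A = (1 :: complex)" "of_real (Gamma (1 - a)) * rGamma (1 - A) = (1 :: complex)"
  proof -
    have *: "of_real (Gamma b) * rGamma (of_real b) = (1 :: complex)" if "b > 0" for b :: real
      using Gamma_real_pos[OF that] by (simp add: rGamma_inverse_Gamma Gamma_complex_of_real)
    from *[OF a(1)] *[of "1 - a"] a
    show "of_real (Gamma a) * rGamma A = (1 :: complex)" "of_real (Gamma (1 - a)) * rGamma (1 - A) = (1 :: complex)"
      by (simp_all add: A_def)
  qed
  have W1: "p x * y1 x - u x * v1 x = - 1"
  proof (rule wronskian_const[OF u p y1 v1 _ x])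
    show "((\<lambda>x. p x * y1 x - u x * v1 x) \<longlongrightarrow> - 1) (at_right 0)"
      using tendsto_diff[OF tendsto_mult[OF lpp ly1] tendsto_mult[OF lu lv1]] GA(2) by simp
  qed
  have W2: "p x * y2 x - u x * v2 x = - (of_real c powr - A)"
  proof (rule wronskian_const[OF u p y2 v2 _ x])
    have "of_real (- Gamma (1 - a)) * 0 - of_real (Gamma a / c powr a) * rGamma A = - (of_real c powr - A)"
      unfolding ca using GA(1) by simp
    then show "((\<lambda>x. p x * y2 x - u x * v2 x) \<longlongrightarrow> - (of_real c powr - A)) (at_right 0)"
      using tendsto_diff[OF tendsto_mult[OF lpp ly2] tendsto_mult[OF lu lv2]] by simp
  qed
  have W3: "v1 x * y2 x - y1 x * v2 x = - (rGamma (1 - A) * rGamma A)"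
  proof (rule wronskian_const[OF y1 v1 y2 v2 _ x])
    show "((\<lambda>x. v1 x * y2 x - y1 x * v2 x) \<longlongrightarrow> - (rGamma (1 - A) * rGamma A)) (at_right 0)"
      using tendsto_diff[OF tendsto_mult[OF lv1 ly2] tendsto_mult[OF ly1 lv2]] by simp
  qed
  \<comment> \<open>Solving the two linear relations for u: in y1 (u v2) - y2 (u v1) the unknown p
    cancels, and the coefficient of u is the Wronskian of y1 and y2.\<close>
  have "u x * (rGamma (1 - A) * rGamma A) = of_real c powr - A * y1 x - y2 x"
  proof -
    have 1: "u x * v1 x = p x * y1 x + 1" using W1 by (simp add: algebra_simps)
    have 2: "u x * v2 x = p x * y2 x + of_real c powr - A" using W2 by (simp add: algebra_simps)
    have r: "rGamma (1 - A) * rGamma A = y1 x * v2 x - v1 x * y2 x"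
      using W3 by (simp add: algebra_simps)
    have "u x * (rGamma (1 - A) * rGamma A) = y1 x * (u x * v2 x) - y2 x * (u x * v1 x)"
      unfolding r by (simp add: algebra_simps)
    then show ?thesis unfolding 1 2 by (simp add: algebra_simps)
  qed
  moreover have "rGamma (1 - A) * rGamma A = sin (of_real pi * A) / of_real pi"
    using rGamma_reflection_complex[of A] by (simp add: mult.commute)
  ultimately show ?thesis
    by (simp add: u_def y1_def y2_def A_def C_def)
qed

subsection \<open>Analytic continuation\<close>

text \<open>The bracket on the left-hand side of the claim divided by (lam/2)^\<alpha>. It involves
  no choice of the argument of z and no division by a sine; for fixed z off the ray it is entire in
  \<alpha>.\<close>

definition bessel_combination :: "real \<Rightarrow> complex \<Rightarrow> complex \<Rightarrow> complex" where
  "bessel_combination c \<alpha> z =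
     of_real c powr - \<alpha> * bessel_E (- \<alpha>) (of_real c * z) - (- z) powr \<alpha> * bessel_E \<alpha> (of_real c * z)"

text \<open>Continuation in the order at a fixed point - x, from the segment (0, 1) to the convex
  strip; the sine stands in the numerator, so integer orders are no obstacle.\<close>

lemma bessel_stieltjes_negative_axis:
  assumes c: "c > 0" and \<alpha>: "-1 < Re \<alpha>" "Re \<alpha> < 5 / 2" and x: "x > 0"
  shows "bessel_stieltjes c \<alpha> (- of_real x) * (sin (of_real pi * \<alpha>) / of_real pi) =
           bessel_combination c \<alpha> (- of_real x)"
proof -
  define S where "S = {\<alpha>. -1 < Re \<alpha> \<and> Re \<alpha> < 5 / 2}"
  define f where "f = (\<lambda>\<alpha>. bessel_stieltjes c \<alpha> (- of_real x) * (sin (of_real pi * \<alpha>) / of_real pi)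
      - bessel_combination c \<alpha> (- of_real x))"
  have z: "- complex_of_real x \<notin> \<real>\<^sub>\<ge>\<^sub>0" using x by (simp add: complex_nonneg_Reals_iff)
  have "f \<alpha> = 0"
  proof (rule analytic_continuation[where f = f and w = \<alpha> and S = S and U = "of_real ` {0<..<1}" and \<xi> = "1 / 2"])
    have E: "(\<lambda>\<alpha>. bessel_E \<alpha> y) holomorphic_on T" for y T
      by (rule holomorphic_on_subset[OF bessel_E_holomorphic_order]) auto
    have E': "(\<lambda>\<alpha>. bessel_E (- \<alpha>) y) holomorphic_on S" for y
    proof -
      have "(\<lambda>\<alpha>. - \<alpha>) holomorphic_on S" by (intro holomorphic_intros)
      from holomorphic_on_compose[OF this E] show ?thesis by (simp add: o_def)
    qed
    show "f holomorphic_on S"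
      unfolding f_def bessel_combination_def using c x
      by (intro holomorphic_intros E E' bessel_stieltjes_holomorphic_order[OF c z, folded S_def]) auto
    show "open S" unfolding S_def by (rule open_strip)
    show "connected S"
    proof (rule convex_connected)
      have "S = {\<alpha>. -1 < Re \<alpha>} \<inter> {\<alpha>. Re \<alpha> < 5 / 2}" by (auto simp: S_def)
      then show "convex S"
        by (simp only:) (intro convex_Int convex_halfspace_Re_gt convex_halfspace_Re_lt)
    qed
    show "complex_of_real ` {0<..<1} \<subseteq> S" "1 / 2 \<in> S" "\<alpha> \<in> S" using \<alpha> by (auto simp: S_def)
    show "1 / 2 islimpt complex_of_real ` {0<..<1}"
      unfolding islimpt_approachable
    proof (intro allI impI)
      fix e :: real assume e: "e > 0"
      define d where "d = min (e / 2) (1 / 4)"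
      have d: "0 < d" "d < e" "d < 1 / 2" using e by (auto simp: d_def)
      have "complex_of_real (1 / 2 + d) - 1 / 2 = of_real d" by simp
      then have "dist (complex_of_real (1 / 2 + d)) (1 / 2) < e" unfolding dist_norm using d by simp
      moreover have "complex_of_real (1 / 2 + d) \<noteq> 1 / 2" using d by (simp add: complex_eq_iff)
      moreover have "complex_of_real (1 / 2 + d) \<in> of_real ` {0<..<1}" using d by (intro imageI) auto
      ultimately show "\<exists>w\<in>complex_of_real ` {0<..<1}. w \<noteq> 1 / 2 \<and> dist w (1 / 2) < e" by blast
    qed
    show "f w = 0" if w: "w \<in> complex_of_real ` {0<..<1}" for w
    proof -
      obtain a where a: "w = of_real a" "0 < a" "a < 1" using w by auto
      show ?thesis
        using macdonald_eq_bessel[OF c a(2,3) x] bessel_stieltjes_eq_macdonald[OF c _ _ x, of a] a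
        by (simp add: f_def bessel_combination_def)
    qed
  qed
  then show ?thesis by (simp add: f_def)
qed

text \<open>Continuation in z at a fixed order. The plane without the ray [0, \<infinity>) is
  starlike, hence connected, and - z avoids the cut of the principal power there.\<close>

lemma bessel_stieltjes_eq:
  assumes c: "c > 0" and \<alpha>: "-1 < Re \<alpha>" "Re \<alpha> < 5 / 2" and z: "z \<notin> \<real>\<^sub>\<ge>\<^sub>0"
  shows "bessel_stieltjes c \<alpha> z * (sin (of_real pi * \<alpha>) / of_real pi) = bessel_combination c \<alpha> z"
proof -
  define f where "f = (\<lambda>z. bessel_stieltjes c \<alpha> z * (sin (of_real pi * \<alpha>) / of_real pi)
      - bessel_combination c \<alpha> z)"
  have eq: "\<real>\<^sub>\<ge>\<^sub>0 = complex_of_real ` {0..}"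
    by (auto simp: nonneg_Reals_def)
  have "f z = 0"
  proof (rule analytic_continuation[where f = f and w = z and S = "- \<real>\<^sub>\<ge>\<^sub>0" and U = "(\<lambda>x. - of_real x) ` {0<..}" and \<xi> = "- 1"])
    have E: "(\<lambda>z. bessel_E \<nu> (of_real c * z)) holomorphic_on - \<real>\<^sub>\<ge>\<^sub>0" for \<nu>
      using holomorphic_on_compose[of "\<lambda>z. of_real c * z" "- \<real>\<^sub>\<ge>\<^sub>0" "bessel_E \<nu>"]
        bessel_E_holomorphic by (auto simp: o_def intro: holomorphic_intros)
    have "- z \<notin> \<real>\<^sub>\<le>\<^sub>0" if "z \<in> - \<real>\<^sub>\<ge>\<^sub>0" for z :: complex
      using that by (auto simp: complex_nonneg_Reals_iff complex_nonpos_Reals_iff)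
    then show "f holomorphic_on - \<real>\<^sub>\<ge>\<^sub>0"
      unfolding f_def bessel_combination_def
      by (intro holomorphic_intros E bessel_stieltjes_holomorphic[OF c \<alpha>]) auto
    show "open (- \<real>\<^sub>\<ge>\<^sub>0 :: complex set)" by (simp add: open_Compl)
    show "connected (- \<real>\<^sub>\<ge>\<^sub>0 :: complex set)"
      unfolding eq by (rule starlike_imp_connected[OF starlike_slotted_complex_plane_right])
    show "(\<lambda>x. - complex_of_real x) ` {0<..} \<subseteq> - \<real>\<^sub>\<ge>\<^sub>0" "- 1 \<in> (- \<real>\<^sub>\<ge>\<^sub>0 :: complex set)" "z \<in> - \<real>\<^sub>\<ge>\<^sub>0"
      using z by (auto simp: complex_nonneg_Reals_iff)
    show "- 1 islimpt (\<lambda>x. - complex_of_real x) ` {0<..}"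
      unfolding islimpt_approachable
    proof (intro allI impI)
      fix e :: real assume e: "e > 0"
      have "- complex_of_real (1 + e / 2) - (- 1) = - of_real (e / 2)" by simp
      then have "dist (- complex_of_real (1 + e / 2)) (- 1) < e"
        unfolding dist_norm using e by (simp only: norm_minus_cancel norm_of_real)
      moreover have "- complex_of_real (1 + e / 2) \<noteq> - 1" using e by (simp add: complex_eq_iff)
      moreover have "- complex_of_real (1 + e / 2) \<in> (\<lambda>x. - complex_of_real x) ` {0<..}"
        using e by (intro imageI) auto
      ultimately show "\<exists>w\<in>(\<lambda>x. - complex_of_real x) ` {0<..}. w \<noteq> - 1 \<and> dist w (- 1) < e" by blast
    qed
    show "f w = 0" if "w \<in> (\<lambda>x. - complex_of_real x) ` {0<..}" for w
      using that bessel_stieltjes_negative_axis[OF c \<alpha>] by (auto simp: f_def)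
  qed
  then show ?thesis by (simp add: f_def)
qed

subsection \<open>Translation to Bessel functions\<close>

lemma bessel_J_eq_bessel_E:
  assumes "w \<noteq> 0"
  shows "bessel_J \<nu> w = (w / 2) powr \<nu> * bessel_E \<nu> ((w / 2)\<^sup>2)"
  using assms by (simp add: bessel_J_def bessel_E_def power_mult)

text \<open>The outer power t^(\<alpha>/2) and the factor (sqrt t)^\<alpha> = t^(\<alpha>/2) inside
  the Bessel function combine to t^\<alpha>; the bases are nonnegative reals, so no branch question
  arises.\<close>

lemma bessel_integrand_eq:
  assumes lam: "lam > 0" and t: "t \<ge> 0"
  shows "bessel_integrand lam z \<alpha> t =
    of_real (lam / 2) powr \<alpha> * (bessel_P (lam\<^sup>2 / 4) \<alpha> t / (of_real t - z))"
proof (cases "t = 0")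
  \<comment> \<open>Both sides are 0 here by the default value of \<open>0 powr\<close>, even for
    \<alpha> = 0.\<close>
  case True
  then show ?thesis by (simp add: bessel_integrand_def)
next
  case False
  then have t0: "t > 0" using t by simp
  define w where "w = complex_of_real (lam * sqrt t)"
  have w0: "w \<noteq> 0" using lam t0 by (simp add: w_def)
  have sq: "(w / 2)\<^sup>2 = of_real (lam\<^sup>2 / 4 * t)"
    using t0 by (simp add: w_def power_divide power_mult_distrib flip: of_real_power)
  have "(w / 2) powr \<alpha> = of_real (lam / 2) powr \<alpha> * of_real (sqrt t) powr \<alpha>"
  proof -
    have "w / 2 = of_real (lam / 2) * of_real (sqrt t)" by (simp add: w_def)
    then show ?thesis using lam t0 by (simp only:) (rule powr_times_real; simp)
  qed
  also have "complex_of_real (sqrt t) powr \<alpha> = of_real t powr (\<alpha> / 2)"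
    using t0 by (simp add: powr_def Ln_of_real ln_sqrt)
  finally have pw: "(w / 2) powr \<alpha> = of_real (lam / 2) powr \<alpha> * of_real t powr (\<alpha> / 2)" .
  have "of_real t powr (\<alpha> / 2) * of_real t powr (\<alpha> / 2) = complex_of_real t powr \<alpha>"
    by (simp flip: powr_add)
  then show ?thesis
    unfolding bessel_integrand_def w_def[symmetric] bessel_J_eq_bessel_E[OF w0] sq pw bessel_P_def
    by (simp add: mult_ac flip: powr_add)
qed

text \<open>Both terms are single-valued: z^(\<alpha>/2) meets z^(-\<alpha>/2) from the Bessel
  function of order - \<alpha>, and conversely. The choice of \<theta> therefore drops out, also on
  the cut.\<close>

lemma bessel_side_eq:
  assumes lam: "lam > 0" and z: "z \<notin> \<real>\<^sub>\<ge>\<^sub>0" and \<theta>: "is_branch_arg z \<theta>"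
  shows "bessel_side lam \<theta> z \<alpha> = of_real (lam / 2) powr \<alpha> *
     (of_real pi / sin (of_real pi * \<alpha>) * bessel_combination (lam\<^sup>2 / 4) \<alpha> z)"
proof -
  have z0: "z \<noteq> 0" using z by auto
  define L where "L = complex_of_real (ln (cmod z)) + \<i> * of_real \<theta>"
  have branch: "branch_powr \<theta> z a = exp (a * L)" for a by (simp add: branch_powr_def L_def)
  have expL: "exp L = z"
  proof -
    have "exp L = of_real (cmod z) * cis \<theta>"
      using z0 by (simp add: L_def exp_add cis_conv_exp exp_of_real)
    then show ?thesis using \<theta> by (simp add: is_branch_arg_def)
  qed
  define w where "w = complex_of_real lam * branch_powr \<theta> z (1 / 2)"
  define l where "l = complex_of_real (ln (lam / 2))"
  have elam: "exp l = of_real (lam / 2)" using lam by (simp add: l_def exp_of_real)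
  have w0: "w \<noteq> 0" using lam by (simp add: w_def branch)
  have w2: "w / 2 = exp (l + L / 2)"
    by (simp add: w_def branch exp_add elam)
  \<comment> \<open>Halving the argument puts \<theta>/2 in [- pi/2, pi/2], inside the principal
    range even for \<theta> = - pi, so the principal power in \<open>bessel_J\<close> agrees with
    the chosen branch.\<close>
  have Ln: "Ln (w / 2) = l + L / 2"
    unfolding w2
  proof (rule Ln_exp)
    have "Im (l + L / 2) = \<theta> / 2" by (simp add: L_def l_def)
    then show "- pi < Im (l + L / 2)" "Im (l + L / 2) \<le> pi"
      using \<theta> pi_gt_zero unfolding is_branch_arg_def by linarith+
  qed
  have sq: "(w / 2)\<^sup>2 = of_real (lam\<^sup>2 / 4) * z"
  proof -
    have "(w / 2)\<^sup>2 = exp l ^ 2 * exp L"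
      unfolding w2 by (simp add: exp_add power_mult_distrib flip: exp_of_nat_mult)
    then show ?thesis unfolding elam expL by (simp add: power_divide)
  qed
  have pw: "(w / 2) powr a = exp (a * l) * exp (a / 2 * L)" for a
    using w0 Ln by (simp add: powr_def exp_add[symmetric] algebra_simps)
  have lp: "complex_of_real (lam / 2) powr a = exp (a * l)" for a
  proof -
    have "Ln (complex_of_real (lam / 2)) = l" unfolding l_def by (rule Ln_of_real) (use lam in simp)
    moreover have "complex_of_real (lam / 2) \<noteq> 0" using lam by simp
    ultimately show ?thesis by (simp only: powr_def if_False)
  qed
  \<comment> \<open>Since c = (lam/2)^2, the factor (lam/2)^(-\<alpha>) of the Bessel function of
    order - \<alpha> equals (lam/2)^\<alpha> c^(-\<alpha>), which makes (lam/2)^\<alpha> common to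
    both terms.\<close>
  have cp: "complex_of_real (lam\<^sup>2 / 4) powr - \<alpha> = exp (- \<alpha> * l) * exp (- \<alpha> * l)"
  proof -
    have "ln (lam\<^sup>2 / 4) = 2 * ln (lam / 2)"
      using lam ln_realpow[of "lam / 2" 2] by (simp add: power_divide)
    then have "Ln (complex_of_real (lam\<^sup>2 / 4)) = 2 * l"
      using lam by (subst Ln_of_real) (simp_all add: l_def)
    then show ?thesis using lam by (simp add: powr_def exp_add[symmetric] algebra_simps)
  qed
  have 1: "exp (\<alpha> / 2 * L) * (exp (- \<alpha> * l) * exp (- \<alpha> / 2 * L)) = exp (\<alpha> * l) * (exp (- \<alpha> * l) * exp (- \<alpha> * l))"
    by (simp add: exp_add[symmetric] algebra_simps)
  have 2: "exp (- \<alpha> / 2 * L) * (exp (\<alpha> * l) * exp (\<alpha> / 2 * L)) = exp (\<alpha> * l)"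
    by (simp add: exp_add[symmetric] algebra_simps)
  have "branch_powr \<theta> z (\<alpha> / 2) * bessel_J (- \<alpha>) w
      - (- z) powr \<alpha> * branch_powr \<theta> z (- \<alpha> / 2) * bessel_J \<alpha> w
      = (exp (\<alpha> / 2 * L) * (exp (- \<alpha> * l) * exp (- \<alpha> / 2 * L))) * bessel_E (- \<alpha>) (of_real (lam\<^sup>2 / 4) * z)
        - (- z) powr \<alpha> * (exp (- \<alpha> / 2 * L) * (exp (\<alpha> * l) * exp (\<alpha> / 2 * L))) * bessel_E \<alpha> (of_real (lam\<^sup>2 / 4) * z)"
    unfolding bessel_J_eq_bessel_E[OF w0] pw branch sq by (simp only: mult.assoc)
  also have "\<dots> = of_real (lam / 2) powr \<alpha> * bessel_combination (lam\<^sup>2 / 4) \<alpha> z"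
    unfolding 1 2 bessel_combination_def cp lp by (simp add: right_diff_distrib mult_ac)
  finally show ?thesis
    unfolding bessel_side_def w_def by (simp only: mult.left_commute)
qed

lemma sin_pi_eq_0_iff: "sin (of_real pi * \<alpha>) = 0 \<longleftrightarrow> \<alpha> \<in> \<int>" for \<alpha> :: complex
proof
  assume "sin (of_real pi * \<alpha>) = 0"
  then obtain n :: int where "of_real pi * \<alpha> = of_real (n * pi)" unfolding sin_eq_0 by blast
  then have "\<alpha> = of_int n" by simp
  then show "\<alpha> \<in> \<int>" by simp
next
  assume "\<alpha> \<in> \<int>"
  then obtain n where "\<alpha> = of_int n" by (auto elim: Ints_cases)
  then show "sin (of_real pi * \<alpha>) = 0" unfolding sin_eq_0 by (intro exI[of _ n]) simp
qed

lemma eventually_not_Ints_at: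
  assumes "\<alpha> \<in> \<int>"
  shows "eventually (\<lambda>\<beta>. \<beta> \<notin> \<int>) (at (\<alpha> :: complex))"
  unfolding eventually_at
proof (intro exI[of _ 1] conjI ballI impI)
  fix \<beta> :: complex assume \<beta>: "\<beta> \<noteq> \<alpha> \<and> dist \<beta> \<alpha> < 1"
  show "\<beta> \<notin> \<int>"
  proof
    assume "\<beta> \<in> \<int>"
    with assms obtain m n where "\<beta> = of_int m" "\<alpha> = of_int n" by (auto elim!: Ints_cases)
    then have "dist \<beta> \<alpha> = \<bar>real_of_int (m - n)\<bar>" "m \<noteq> n"
      using \<beta> by (auto simp: dist_norm simp flip: of_int_diff)
    then show False using \<beta> by linarith
  qed
qed auto

theorem theorem4p5:
  fixes lam \<theta> :: real and \<alpha> z :: complex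
  assumes "lam > 0"
    and "-1 < Re \<alpha>" and "Re \<alpha> < 5 / 2"
    and "z \<notin> \<real>\<^sub>\<ge>\<^sub>0"
    and "is_branch_arg z \<theta>"
  shows "\<exists>v. has_value_at (bessel_side lam \<theta> z) \<alpha> v
           \<and> has_cesaro_integral (bessel_integrand lam z \<alpha>) v
           \<and> (Re \<alpha> < 3 / 2 \<longrightarrow> (bessel_integrand lam z \<alpha> has_integral v) {0..})"
proof -
  define c where "c = lam\<^sup>2 / 4"
  have c: "c > 0" using assms(1) by (simp add: c_def)
  define K where "K = complex_of_real (lam / 2) powr \<alpha>"
  define g where "g = (\<lambda>t. bessel_P c \<alpha> t / (of_real t - z))"
  have fg: "bessel_integrand lam z \<alpha> t = K * g t" if "t \<ge> 0" for t
    unfolding K_def g_def c_def using bessel_integrand_eq[OF assms(1) that] .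
  \<comment> \<open>F \<alpha> is the common value. F is holomorphic on the whole strip and agrees
    with the left-hand side wherever the sine does not vanish, so at an integer F \<alpha> is the
    limit of the left-hand side.\<close>
  define F where "F = (\<lambda>\<beta>. complex_of_real (lam / 2) powr \<beta> * bessel_stieltjes c \<beta> z)"
  have side: "bessel_side lam \<theta> z \<beta> = F \<beta>" if "-1 < Re \<beta>" "Re \<beta> < 5 / 2" "\<beta> \<notin> \<int>" for \<beta>
    using bessel_side_eq[OF assms(1,4,5), of \<beta>] bessel_stieltjes_eq[OF c that(1,2) assms(4), symmetric]
      sin_pi_eq_0_iff[of \<beta>] that(3)
    by (simp add: F_def c_def)
  have "has_value_at (bessel_side lam \<theta> z) \<alpha> (F \<alpha>)"
  proof (cases "\<alpha> \<in> \<int>")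
    case True
    define S where "S = {\<alpha>. -1 < Re \<alpha> \<and> Re \<alpha> < 5 / 2}"
    have S: "\<alpha> \<in> S" "open S" using assms open_strip by (auto simp: S_def)
    have "F holomorphic_on S"
      unfolding F_def using assms(1)
      by (intro holomorphic_intros bessel_stieltjes_holomorphic_order[OF c assms(4), folded S_def])
    then have "isCont F \<alpha>"
      using S by (metis at_within_open continuous_on_eq_continuous_within holomorphic_on_imp_continuous_on)
    then have lim: "(F \<longlongrightarrow> F \<alpha>) (at \<alpha>)" by (simp add: isCont_def)
    have "eventually (\<lambda>\<beta>. \<beta> \<in> S) (at \<alpha>)" using S by (simp add: eventually_at_in_open')
    with eventually_not_Ints_at[OF True]
    have "eventually (\<lambda>\<beta>. F \<beta> = bessel_side lam \<theta> z \<beta>) (at \<alpha>)"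
      by eventually_elim (use side in \<open>auto simp: S_def\<close>)
    with lim have "(bessel_side lam \<theta> z \<longlongrightarrow> F \<alpha>) (at \<alpha>)" by (rule Lim_transform_eventually)
    then show ?thesis using True by (simp add: has_value_at_def)
  next
    case False
    then show ?thesis using side[of \<alpha>] assms by (simp add: has_value_at_def)
  qed
  moreover have "has_cesaro_integral (bessel_integrand lam z \<alpha>) (F \<alpha>)"
    unfolding has_cesaro_integral_def
  proof (intro conjI allI impI)
    fix T :: real assume "T > 0"
    from bessel_P_quotient_absolutely_integrable[OF c assms(2,4) this, of 1]
    have "g absolutely_integrable_on {0..T}" by (simp add: g_def)
    then have "(\<lambda>t. K * g t) absolutely_integrable_on {0..T}"
      by - (rule set_integrable_mult_right)
    then show "bessel_integrand lam z \<alpha> absolutely_integrable_on {0..T}"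
      by (rule iffD1[OF set_integrable_cong, rotated -1]) (use fg in auto)
  next
    have "((\<lambda>T. K * ((1 / T) *\<^sub>R integral {0..T} (\<lambda>s. integral {0..s} g))) \<longlongrightarrow> K * bessel_stieltjes c \<alpha> z) at_top"
      unfolding g_def by (intro tendsto_mult tendsto_const bessel_P_stieltjes_cesaro c assms)
    moreover have "(1 / T) *\<^sub>R integral {0..T} (\<lambda>s. integral {0..s} (bessel_integrand lam z \<alpha>)) =
        K * ((1 / T) *\<^sub>R integral {0..T} (\<lambda>s. integral {0..s} g))" for T
    proof -
      have "integral {0..s} (bessel_integrand lam z \<alpha>) = K * integral {0..s} g" for s
      proof -
        have "integral {0..s} (bessel_integrand lam z \<alpha>) = integral {0..s} (\<lambda>t. K * g t)"
          by (rule integral_cong) (use fg in auto)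
        then show ?thesis by simp
      qed
      then show ?thesis by simp
    qed
    ultimately show "((\<lambda>T. (1 / T) *\<^sub>R integral {0..T} (\<lambda>s. integral {0..s} (bessel_integrand lam z \<alpha>)))
        \<longlongrightarrow> F \<alpha>) at_top"
      unfolding F_def K_def[symmetric] by (simp only:)
  qed
  moreover have "(bessel_integrand lam z \<alpha> has_integral F \<alpha>) {0..}" if "Re \<alpha> < 3 / 2"
  proof -
    have "((\<lambda>t. K * g t) has_integral K * bessel_stieltjes c \<alpha> z) {0..}"
      unfolding g_def by (intro has_integral_mult_right bessel_P_stieltjes_improper c assms that)
    then show ?thesis
      unfolding F_def K_def[symmetric] by (rule has_integral_eq[rotated]) (use fg in auto)
  qed
  ultimately show ?thesis by blast
qed

end
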